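(* Let $(\Gamma_1,L_1)$ and $(\Gamma_2,L_2)$ be $\mathbb C$-Fuchsian groups where $L_1$ and $L_2$ are disjoint, and let $p_1\in L_1$ and $p_2\in L_2$ be the endpoints of the unique orthogeodesic from $L_1$ to $L_2$. Suppose $$s(\mathrm{inj}(p_1))+s(\mathrm{inj}(p_2))<\rho(L_1,L_2).$$ Then $\Gamma=\langle\Gamma_1,\Gamma_2\rangle$ is a discrete subgroup of ${\rm PU}(2,1)$ such that 1. $\Gamma$ is abstractly the free product $\Gamma_1*\Gamma_2$; 2. $S_1=L_1/\Gamma_1$ and $S_2=L_2/\Gamma_2$ are embedded complex geodesic surfaces in $X=\mathbb{H}^2_{\mathbb C}/\Gamma$; 3. $\rho_X(S_1,S_2)=\rho(L_1,L_2)$.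
   Context: Complex hyperbolic $2$-space is the ball $\mathbb{H}^2_{\mathbb C}=\{(p_1,p_2)\in\mathbb C^2: |p_1|^2+|p_2|^2<1\}$ with distance $\rho$ given by $\cosh^2(\rho(p,q)/2)=\frac{\langle \mathbf p,\mathbf q\rangle\langle \mathbf q,\mathbf p\rangle}{\langle \mathbf p,\mathbf p\rangle\langle \mathbf q,\mathbf q\rangle}$, where $\mathbf p=(p_1,p_2,1)$ and $\langle \mathbf p,\mathbf q\rangle=p_1\overline{q_1}+p_2\overline{q_2}-p_3\overline{q_3}$. The group of holomorphic isometries is ${\rm PU}(2,1)$. A complex line is a non-empty intersection of $\mathbb{H}^2_{\mathbb C}$ with a complex one-dimensional affine subspace of $\mathbb C^2$; it is totally geodesic of curvature $-1$. A pair $(\Gamma_1,L_1)$ is a $\mathbb C$-Fuchsian group if $\Gamma_1<{\rm PU}(2,1)$ is a discrete torsion-free subgroup that stabilizes the complex line $L_1$; the quotient $L_1/\Gamma_1$ is a complex geodesic surface. The orthogeodesic from $L_1$ to $L_2$ is the geodesic segment meeting both lines perpendicularly at its endpoints; its length is $\rho(L_1,L_2)$. For $p_i\in L_i$, $\mathrm{inj}(p_i)$ is the injectivity radius, at the projection of $p_i$, of the surface $L_i/\Gamma_i$ (with its curvature $-1$ metric). The function $s$ is $s(x)=2\,\mathrm{arcsinh}\left(\frac{1}{\sinh\frac x2}\right)$. $\rho_X$ is the induced distance on $X=\mathbb{H}^2_{\mathbb C}/\Gamma$. The surface $L_k/\Gamma_k$ is embedded in $X$ if for each $\gamma\in\Gamma$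 either $\gamma\in\Gamma_k$ (so $\gamma(L_k)=L_k$) or $\gamma(L_k)\cap L_k=\emptyset$. *)

theory Defs
  imports "HOL-Analysis.Analysis" "HOL-Algebra.Generated_Groups" "HOL-Algebra.Coset"
begin

section \<open>Complex hyperbolic 2-space\<close>

definition hform :: "complex^3 \<Rightarrow> complex^3 \<Rightarrow> complex" where
  "hform v w = v$1 * cnj (w$1) + v$2 * cnj (w$2) - v$3 * cnj (w$3)"

definition lift_pt :: "complex^2 \<Rightarrow> complex^3" where
  "lift_pt p = vector [p$1, p$2, 1]"

definition H2C :: "(complex^2) set" where
  "H2C = {p. (cmod (p$1))\<^sup>2 + (cmod (p$2))\<^sup>2 < 1}"

definition rho :: "complex^2 \<Rightarrow> complex^2 \<Rightarrow> real" where
  "rho p q = 2 * arcosh (sqrt (Re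
     (hform (lift_pt p) (lift_pt q) * hform (lift_pt q) (lift_pt p) /
      (hform (lift_pt p) (lift_pt p) * hform (lift_pt q) (lift_pt q)))))"

lemma cosh_rho:
  assumes "p \<in> H2C" "q \<in> H2C"
  shows "complex_of_real ((cosh (rho p q / 2))\<^sup>2) =
    hform (lift_pt p) (lift_pt q) * hform (lift_pt q) (lift_pt p) /
      (hform (lift_pt p) (lift_pt p) * hform (lift_pt q) (lift_pt q))"
proof -
  define a where "a = (cmod (p$1))\<^sup>2 + (cmod (p$2))\<^sup>2"
  define b where "b = (cmod (q$1))\<^sup>2 + (cmod (q$2))\<^sup>2"
  define z where "z = p$1 * cnj (q$1) + p$2 * cnj (q$2)"
  define e where "e = (cmod (1 - z))\<^sup>2 / ((1 - a) * (1 - b))"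
  have ab: "a < 1" "b < 1" "0 \<le> a" "0 \<le> b"
    using assms by (auto simp: H2C_def a_def b_def)
  have pp: "hform (lift_pt p) (lift_pt p) = - complex_of_real (1 - a)"
    by (simp add: hform_def lift_pt_def a_def complex_norm_square del: of_real_power)
  have qq: "hform (lift_pt q) (lift_pt q) = - complex_of_real (1 - b)"
    by (simp add: hform_def lift_pt_def b_def complex_norm_square del: of_real_power)
  have pq: "hform (lift_pt p) (lift_pt q) * hform (lift_pt q) (lift_pt p) =
      complex_of_real ((cmod (1 - z))\<^sup>2)"
    unfolding complex_norm_square by (simp add: hform_def lift_pt_def z_def algebra_simps)
  have frac: "hform (lift_pt p) (lift_pt q) * hform (lift_pt q) (lift_pt p) /
      (hform (lift_pt p) (lift_pt p) * hform (lift_pt q) (lift_pt q)) = complex_of_real e"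
    unfolding pp qq pq e_def by (simp add: algebra_simps)
  define s where "s = sqrt a * sqrt b"
  have s: "0 \<le> s" "s\<^sup>2 = a * b" using ab by (auto simp: s_def power_mult_distrib)
  have "s < 1"
    unfolding s_def using ab mult_strict_mono[of "sqrt a" 1 "sqrt b" 1] by simp
  have "cmod z \<le> cmod (p$1) * cmod (q$1) + cmod (p$2) * cmod (q$2)"
    unfolding z_def by (metis norm_triangle_ineq norm_mult complex_mod_cnj)
  also have "\<dots> \<le> s"
  proof -
    define x y u v where "x = cmod (p$1)" and "y = cmod (p$2)" and "u = cmod (q$1)" and "v = cmod (q$2)"
    have "(x * u + y * v)\<^sup>2 \<le> (x\<^sup>2 + y\<^sup>2) * (u\<^sup>2 + v\<^sup>2)"
      using zero_le_power2[of "x * v - y * u"] by (simp add: power2_eq_square algebra_simps)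
    then have "x * u + y * v \<le> sqrt ((x\<^sup>2 + y\<^sup>2) * (u\<^sup>2 + v\<^sup>2))"
      by (rule real_le_rsqrt)
    then show ?thesis
      by (simp add: s_def a_def b_def real_sqrt_mult x_def y_def u_def v_def)
  qed
  finally have "1 - s \<le> cmod (1 - z)"
    using norm_triangle_ineq2[of 1 z] by simp
  then have "(1 - s)\<^sup>2 \<le> (cmod (1 - z))\<^sup>2"
    using \<open>s < 1\<close> by (simp add: power_mono)
  moreover have "(1 - a) * (1 - b) \<le> (1 - s)\<^sup>2"
  proof -
    have "2 * s \<le> a + b"
      using zero_le_power2[of "sqrt a - sqrt b"] ab
      by (simp add: power2_diff s_def)
    then show ?thesis using s by (simp add: power2_diff algebra_simps)
  qed
  ultimately have "1 \<le> e" unfolding e_def using ab by simp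
  then have "cosh (rho p q / 2) = sqrt e"
    unfolding rho_def frac by (simp add: cosh_arcosh_real)
  then show ?thesis using \<open>1 \<le> e\<close> frac by simp
qed

definition set_distance :: "('a \<Rightarrow> 'a \<Rightarrow> real) \<Rightarrow> 'a set \<Rightarrow> 'a set \<Rightarrow> real" where
  "set_distance d A B = Inf {d a b | a b. a \<in> A \<and> b \<in> B}"

definition complex_line :: "(complex^2) set \<Rightarrow> bool" where
  "complex_line L \<longleftrightarrow> L \<noteq> {} \<and> (\<exists>a u. u \<noteq> 0 \<and> L = H2C \<inter> {a + z *s u | z. True})"

text \<open>The Riemannian metric inducing \<open>rho\<close>. With \<open>P\<close> the lift of \<open>p\<close> and \<open>V\<close>, \<open>W\<close>
  the tangent vectors padded by \<open>0\<close>, it is four times the real part of \<open>hform\<close> on the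
  components of \<open>V\<close>, \<open>W\<close> orthogonal to \<open>P\<close>, divided by \<open>- hform P P\<close>.\<close>

definition riem :: "complex^2 \<Rightarrow> complex^2 \<Rightarrow> complex^2 \<Rightarrow> real" where
  "riem p v w = (let P = lift_pt p; V = vector [v$1, v$2, 0]; W = vector [w$1, w$2, 0] in
     - 4 * Re ((hform V W * hform P P - hform V P * hform P W) / (hform P P)\<^sup>2))"

text \<open>For a complex line \<open>L\<close> and \<open>p \<in> L\<close> this is the tangent space of \<open>L\<close> at \<open>p\<close>.\<close>

definition line_tangent :: "(complex^2) set \<Rightarrow> complex^2 \<Rightarrow> (complex^2) set" where
  "line_tangent L p = {z *s (q - p) | z q. q \<in> L}"

definition geodesic_segment :: "(real \<Rightarrow> complex^2) \<Rightarrow> real \<Rightarrow> bool" where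
  "geodesic_segment c l \<longleftrightarrow> 0 < l \<and> c ` {0..l} \<subseteq> H2C \<and>
     (\<forall>s\<in>{0..l}. \<forall>t\<in>{0..l}. rho (c s) (c t) = \<bar>s - t\<bar>)"

definition perpendicular_at ::
    "(real \<Rightarrow> complex^2) \<Rightarrow> real \<Rightarrow> real \<Rightarrow> (complex^2) set \<Rightarrow> bool" where
  "perpendicular_at c l t L \<longleftrightarrow>
     (\<exists>v. (c has_vector_derivative v) (at t within {0..l}) \<and>
          (\<forall>w\<in>line_tangent L (c t). riem (c t) v w = 0))"

definition orthogeodesic ::
    "(complex^2) set \<Rightarrow> (complex^2) set \<Rightarrow> (real \<Rightarrow> complex^2) \<Rightarrow> real \<Rightarrow> bool" where
  "orthogeodesic L\<^sub>1 L\<^sub>2 c l \<longleftrightarrow> geodesic_segment c l \<and> c 0 \<in> L\<^sub>1 \<and> c l \<in> L\<^sub>2 \<and>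
     perpendicular_at c l 0 L\<^sub>1 \<and> perpendicular_at c l l L\<^sub>2"


section \<open>The group PU(2,1)\<close>

definition U21 :: "(complex^3^3) monoid" where
  "U21 = \<lparr>carrier = {A. \<forall>v w. hform (A *v v) (A *v w) = hform v w},
          monoid.mult = (**), one = mat 1\<rparr>"

definition U21_scalars :: "(complex^3^3) set" where
  "U21_scalars = {A \<in> carrier U21. \<exists>c. A = mat c}"

definition PU21 :: "(complex^3^3) set monoid" where
  "PU21 = U21 Mod U21_scalars"

lemma hform_left_nondegenerate:
  assumes "\<And>w. hform v w = 0" shows "v = 0"
proof -
  have "hform v (axis k 1) = (if k = 3 then - v$3 else v$k)" for k :: 3
    using exhaust_3[of k] by (auto simp: hform_def axis_def)
  then have "v$k = 0" for k
    using assms by (metis neg_equal_0_iff_equal)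
  then show ?thesis by (simp add: vec_eq_iff)
qed

lemma U21_invertible:
  assumes "A \<in> carrier U21"
  obtains B where "B \<in> carrier U21" "B ** A = mat 1" "A ** B = mat 1"
proof -
  have A: "hform (A *v v) (A *v w) = hform v w" for v w
    using assms by (simp add: U21_def)
  have "x = 0" if "A *v x = 0" for x
    by (rule hform_left_nondegenerate) (metis A that hform_def mult_zero_left add_0 diff_0_right zero_index)
  then obtain B where B: "B ** A = mat 1"
    using matrix_left_invertible_ker by blast
  then have B': "A ** B = mat 1"
    by (simp add: matrix_left_right_inverse)
  have "hform (B *v v) (B *v w) = hform v w" for v w
    using A[of "B *v v" "B *v w"] by (simp add: matrix_vector_mul_assoc B')
  then have "B \<in> carrier U21" by (simp add: U21_def)
  with B B' that show ?thesis by blast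
qed

lemma group_U21: "group U21"
proof (rule groupI)
  show "\<exists>y\<in>carrier U21. y \<otimes>\<^bsub>U21\<^esub> x = \<one>\<^bsub>U21\<^esub>" if x: "x \<in> carrier U21" for x
  proof -
    obtain B where "B \<in> carrier U21" "B ** x = mat 1"
      using U21_invertible[OF x] by blast
    moreover have "B \<otimes>\<^bsub>U21\<^esub> x = B ** x" "\<one>\<^bsub>U21\<^esub> = mat 1"
      by (simp_all add: U21_def)
    ultimately show ?thesis by metis
  qed
qed (auto simp: U21_def matrix_mul_assoc simp flip: matrix_vector_mul_assoc)

lemma mat_mult_entry:
  fixes A :: "complex^3^3"
  shows "(mat c ** A) $ i $ j = c * A $ i $ j" "(A ** mat c) $ i $ j = A $ i $ j * c"
  using exhaust_3[of i] exhaust_3[of j]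
  by (auto simp: matrix_matrix_mult_def mat_def sum_3)

lemma mat_comm: "mat c ** (A :: complex^3^3) = A ** mat c"
  by (simp add: vec_eq_iff mat_mult_entry)

lemma normal_U21_scalars: "U21_scalars \<lhd> U21"
proof -
  interpret group U21 by (rule group_U21)
  have comm: "x \<otimes>\<^bsub>U21\<^esub> h = h \<otimes>\<^bsub>U21\<^esub> x" if "h \<in> U21_scalars" for x h
    using that by (auto simp: U21_scalars_def U21_def mat_comm)
  have "subgroup U21_scalars U21"
  proof (rule subgroupI)
    show "U21_scalars \<subseteq> carrier U21" by (auto simp: U21_scalars_def)
    have "mat 1 \<in> U21_scalars" by (auto simp: U21_scalars_def U21_def)
    then show "U21_scalars \<noteq> {}" by blast
  next
    fix a b assume "a \<in> U21_scalars" "b \<in> U21_scalars"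
    then obtain c d where ab: "a \<in> carrier U21" "b \<in> carrier U21" "a = mat c" "b = mat d"
      by (auto simp: U21_scalars_def)
    have "mat c ** mat d = (mat (c * d) :: complex^3^3)"
      by (simp add: vec_eq_iff mat_mult_entry) (simp add: mat_def)
    then have "a \<otimes>\<^bsub>U21\<^esub> b = mat (c * d)" by (simp add: U21_def ab)
    then show "a \<otimes>\<^bsub>U21\<^esub> b \<in> U21_scalars"
      using m_closed[OF ab(1,2)] by (auto simp: U21_scalars_def)
  next
    fix a assume "a \<in> U21_scalars"
    then obtain c where a: "a \<in> carrier U21" "a = mat c"
      by (auto simp: U21_scalars_def)
    let ?b = "inv\<^bsub>U21\<^esub> a"
    have ba: "?b ** mat c = mat 1"
      using l_inv[OF a(1)] a(2) by (simp add: U21_def)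
    have entry: "?b $ i $ j * c = (if i = j then 1 else 0)" for i j
    proof -
      have "(?b ** mat c) $ i $ j = ?b $ i $ j * c"
        by (rule mat_mult_entry)
      then show ?thesis unfolding ba by (simp add: mat_def)
    qed
    have "c \<noteq> 0" using entry[of 1 1] by auto
    then have "?b = mat (1 / c)"
      using entry by (simp add: vec_eq_iff mat_def field_simps) (metis mult_zero_left mult_cancel_right)
    then show "?b \<in> U21_scalars"
      using inv_closed[OF a(1)] by (auto simp: U21_scalars_def)
  qed
  moreover have "x \<otimes>\<^bsub>U21\<^esub> h \<otimes>\<^bsub>U21\<^esub> inv\<^bsub>U21\<^esub> x \<in> U21_scalars"
    if x: "x \<in> carrier U21" and h: "h \<in> U21_scalars" for x h
  proof -
    have "h \<in> carrier U21" using h by (simp add: U21_scalars_def)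
    then have "x \<otimes>\<^bsub>U21\<^esub> h \<otimes>\<^bsub>U21\<^esub> inv\<^bsub>U21\<^esub> x = h"
      using comm[OF h] x by (simp add: m_assoc)
    then show ?thesis using h by simp
  qed
  ultimately show ?thesis by (simp add: normal_inv_iff)
qed

lemma group_PU21: "group PU21"
  unfolding PU21_def by (rule normal.factorgroup_is_group[OF normal_U21_scalars])

text \<open>The quotient topology of the subspace topology of \<open>U(2,1)\<close>.\<close>

definition PU21_topology :: "(complex^3^3) set topology" where
  "PU21_topology = topology (\<lambda>W. W \<subseteq> carrier PU21 \<and>
     openin (top_of_set (carrier U21)) {A \<in> carrier U21. U21_scalars #>\<^bsub>U21\<^esub> A \<in> W})"

lemma openin_PU21_topology:
  "openin PU21_topology W \<longleftrightarrow> W \<subseteq> carrier PU21 \<and>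
     openin (top_of_set (carrier U21)) {A \<in> carrier U21. U21_scalars #>\<^bsub>U21\<^esub> A \<in> W}"
proof -
  let ?f = "\<lambda>W. {A \<in> carrier U21. U21_scalars #>\<^bsub>U21\<^esub> A \<in> W}"
  have "?f (S \<inter> T) = ?f S \<inter> ?f T" "?f (\<Union>K) = (\<Union>W\<in>K. ?f W)" for S T K
    by auto
  then have "istopology (\<lambda>W. W \<subseteq> carrier PU21 \<and> openin (top_of_set (carrier U21)) (?f W))"
    unfolding istopology_def by (auto intro!: openin_Union)
  then show ?thesis
    unfolding PU21_topology_def by (simp add: topology_inverse')
qed

definition mat_act :: "complex^3^3 \<Rightarrow> complex^2 \<Rightarrow> complex^2" where
  "mat_act A p = (let v = A *v lift_pt p in vector [v$1 / v$3, v$2 / v$3])"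

text \<open>All representatives of a class act in the same way, so the image is a singleton.\<close>

definition act :: "(complex^3^3) set \<Rightarrow> complex^2 \<Rightarrow> complex^2" where
  "act g p = the_elem ((\<lambda>A. mat_act A p) ` g)"

lemma act_eq:
  assumes "g \<in> carrier PU21" "A \<in> g"
  shows "act g p = mat_act A p"
proof -
  obtain B where B: "B \<in> carrier U21" and g: "g = U21_scalars #>\<^bsub>U21\<^esub> B"
    using assms by (auto simp: PU21_def FactGroup_def RCOSETS_def)
  have *: "mat_act C p = mat_act B p" if "C \<in> g" for C
  proof -
    obtain h where "h \<in> U21_scalars" "C = h \<otimes>\<^bsub>U21\<^esub> B"
      using \<open>C \<in> g\<close> unfolding g r_coset_def by blast
    then obtain c where h: "h \<in> carrier U21" "h = mat c" "C = h ** B"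
      by (auto simp: U21_scalars_def U21_def)
    have mv: "mat c *v v = c *s v" for v :: "complex^3"
      by (simp add: matrix_vector_mult_def mat_def vec_eq_iff sum_3 forall_3)
    have "c \<noteq> 0"
    proof
      assume "c = 0"
      have "hform (mat c *v axis 1 1) (mat c *v axis 1 1) = hform (axis 1 1) (axis 1 1)"
        using h by (simp add: U21_def)
      then show False by (simp add: mv \<open>c = 0\<close> hform_def axis_def)
    qed
    then show ?thesis
      by (simp add: h mat_act_def Let_def mv flip: matrix_vector_mul_assoc)
  qed
  then have "(\<lambda>A. mat_act A p) ` g = {mat_act A p}"
    using assms(2) by (auto simp: *)
  then show ?thesis by (simp add: act_def)
qed

definition discrete_subgroup :: "(complex^3^3) set set \<Rightarrow> bool" where
  "discrete_subgroup \<Gamma> \<longleftrightarrow> subgroup \<Gamma> PU21 \<and>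
     subtopology PU21_topology \<Gamma> = discrete_topology \<Gamma>"

definition torsion_free :: "('a, 'b) monoid_scheme \<Rightarrow> 'a set \<Rightarrow> bool" where
  "torsion_free G H \<longleftrightarrow> (\<forall>g\<in>H. g \<noteq> \<one>\<^bsub>G\<^esub> \<longrightarrow> (\<forall>n::nat. 0 < n \<longrightarrow> g [^]\<^bsub>G\<^esub> n \<noteq> \<one>\<^bsub>G\<^esub>))"

definition C_Fuchsian :: "(complex^3^3) set set \<Rightarrow> (complex^2) set \<Rightarrow> bool" where
  "C_Fuchsian \<Gamma> L \<longleftrightarrow> discrete_subgroup \<Gamma> \<and> torsion_free PU21 \<Gamma> \<and>
     complex_line L \<and> (\<forall>g\<in>\<Gamma>. act g ` L = L)"


section \<open>Quotients\<close>

definition orb :: "(complex^3^3) set set \<Rightarrow> complex^2 \<Rightarrow> (complex^2) set" where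
  "orb \<Gamma> p = (\<lambda>g. act g p) ` \<Gamma>"

text \<open>The induced distance on \<open>H2C/\<Gamma>\<close>, whose points are the orbits: the infimum of
  \<open>rho\<close> over representatives.\<close>

definition rho_quot :: "(complex^2) set \<Rightarrow> (complex^2) set \<Rightarrow> real" where
  "rho_quot x y = set_distance rho x y"

text \<open>The supremum of the radii \<open>r\<close> for which the disc of radius \<open>r\<close> about \<open>p\<close> in \<open>L\<close>
  projects injectively to \<open>L/\<Gamma>\<close>. As \<open>L\<close> is a totally geodesic hyperbolic plane, its intrinsic
  distance is \<open>rho\<close> and its exponential map at \<open>p\<close> is a diffeomorphism, so this is the usual
  injectivity radius. The value is \<open>\<infinity>\<close> when \<open>\<Gamma>\<close> is trivial.\<close>

definition inj_radius :: "(complex^3^3) set set \<Rightarrow> (complex^2) set \<Rightarrow> complex^2 \<Rightarrow> ereal" where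
  "inj_radius \<Gamma> L p = Sup {ereal r | r. inj_on (orb \<Gamma>) {q \<in> L. rho p q < r}}"

text \<open>Extended continuously to the endpoints of \<open>[0, \<infinity>]\<close>.\<close>

definition s_fun :: "ereal \<Rightarrow> ereal" where
  "s_fun x = (if x = \<infinity> then 0 else if x \<le> 0 then \<infinity>
     else ereal (2 * arsinh (1 / sinh (real_of_ereal x / 2))))"

definition embedded_surface ::
    "(complex^3^3) set set \<Rightarrow> (complex^3^3) set set \<Rightarrow> (complex^2) set \<Rightarrow> bool" where
  "embedded_surface \<Gamma> \<Gamma>' L \<longleftrightarrow> (\<forall>g\<in>\<Gamma>. g \<in> \<Gamma>' \<or> act g ` L \<inter> L = {})"


section \<open>Free products\<close>

text \<open>Elements are reduced words: non-identity letters taken alternately from the two factors.\<close>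

definition fp_letters ::
    "('a, 'c) monoid_scheme \<Rightarrow> ('b, 'd) monoid_scheme \<Rightarrow> ('a + 'b) set" where
  "fp_letters G H = Inl ` (carrier G - {\<one>\<^bsub>G\<^esub>}) \<union> Inr ` (carrier H - {\<one>\<^bsub>H\<^esub>})"

definition fp_words ::
    "('a, 'c) monoid_scheme \<Rightarrow> ('b, 'd) monoid_scheme \<Rightarrow> ('a + 'b) list set" where
  "fp_words G H = {w. set w \<subseteq> fp_letters G H \<and> successively (\<lambda>a b. isl a \<noteq> isl b) w}"

fun fp_cons :: "('a, 'c) monoid_scheme \<Rightarrow> ('b, 'd) monoid_scheme \<Rightarrow>
    'a + 'b \<Rightarrow> ('a + 'b) list \<Rightarrow> ('a + 'b) list" where
  "fp_cons G H (Inl x) (Inl y # w) =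
     (if x \<otimes>\<^bsub>G\<^esub> y = \<one>\<^bsub>G\<^esub> then w else Inl (x \<otimes>\<^bsub>G\<^esub> y) # w)"
| "fp_cons G H (Inr x) (Inr y # w) =
     (if x \<otimes>\<^bsub>H\<^esub> y = \<one>\<^bsub>H\<^esub> then w else Inr (x \<otimes>\<^bsub>H\<^esub> y) # w)"
| "fp_cons G H a w = a # w"

definition free_product ::
    "('a, 'c) monoid_scheme \<Rightarrow> ('b, 'd) monoid_scheme \<Rightarrow> ('a + 'b) list monoid" where
  "free_product G H = \<lparr>carrier = fp_words G H, monoid.mult = (\<lambda>u v. foldr (fp_cons G H) u v), one = []\<rparr>"

lemma group_free_product:
  assumes "group G" "group H"
  shows "group (free_product G H)"
proof -
  interpret G: group G by fact
  interpret H: group H by fact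
  let ?c = "fp_cons G H" and ?L = "fp_letters G H" and ?W = "fp_words G H"
  have fpw: "a # w \<in> ?W \<longleftrightarrow> a \<in> ?L \<and> w \<in> ?W \<and> (w = [] \<or> isl a \<noteq> isl (hd w))" for a w
    by (cases w) (auto simp: fp_words_def)
  have LI: "Inl x \<in> ?L \<longleftrightarrow> x \<in> carrier G \<and> x \<noteq> \<one>\<^bsub>G\<^esub>" for x by (auto simp: fp_letters_def)
  have LR: "Inr x \<in> ?L \<longleftrightarrow> x \<in> carrier H \<and> x \<noteq> \<one>\<^bsub>H\<^esub>" for x by (auto simp: fp_letters_def)
  have Nil: "[] \<in> ?W" by (simp add: fp_words_def)
  have closed1: "?c a w \<in> ?W" if "a \<in> ?L" "w \<in> ?W" for a w
    using that
    by (cases "(G, H, a, w)" rule: fp_cons.cases) (auto simp: fpw LI LR Nil split: sum.splits)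
  have closed: "foldr ?c u v \<in> ?W" if "set u \<subseteq> ?L" "v \<in> ?W" for u v
    using that by (induction u) (auto simp: closed1)
  have Gs: "\<lbrakk>x \<otimes>\<^bsub>G\<^esub> y = \<one>\<^bsub>G\<^esub>; x \<in> carrier G; y \<in> carrier G; z \<in> carrier G\<rbrakk>
      \<Longrightarrow> x \<otimes>\<^bsub>G\<^esub> (y \<otimes>\<^bsub>G\<^esub> z) = z" for x y z
    by (simp flip: G.m_assoc)
  have Hs: "\<lbrakk>x \<otimes>\<^bsub>H\<^esub> y = \<one>\<^bsub>H\<^esub>; x \<in> carrier H; y \<in> carrier H; z \<in> carrier H\<rbrakk>
      \<Longrightarrow> x \<otimes>\<^bsub>H\<^esub> (y \<otimes>\<^bsub>H\<^esub> z) = z" for x y z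
    by (simp flip: H.m_assoc)
  have canG: "?c (Inl x) (?c (Inl y) w) = (if x \<otimes>\<^bsub>G\<^esub> y = \<one>\<^bsub>G\<^esub> then w else ?c (Inl (x \<otimes>\<^bsub>G\<^esub> y)) w)"
    if "Inl x \<in> ?L" "Inl y \<in> ?L" "w \<in> ?W" for x y w
  proof (cases "w \<noteq> [] \<and> isl (hd w)")
    case False
    then have "?c (Inl z) w = Inl z # w" for z
      by (cases w; cases "hd w") auto
    then show ?thesis by simp
  next
    case True
    then obtain z v where w: "w = Inl z # v"
      by (cases w; cases "hd w") auto
    have v: "v = [] \<or> (\<exists>z' v'. v = Inr z' # v')"
      using that(3) w by (cases v; cases "hd v") (auto simp: fpw)
    have [simp]: "?c (Inl k) v = Inl k # v" for k
      using v by auto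
    have in': "x \<in> carrier G" "y \<in> carrier G" "z \<in> carrier G" "x \<noteq> \<one>\<^bsub>G\<^esub>"
      using that w by (auto simp: fpw LI)
    have e1: "x \<otimes>\<^bsub>G\<^esub> y \<otimes>\<^bsub>G\<^esub> z = x" if "y \<otimes>\<^bsub>G\<^esub> z = \<one>\<^bsub>G\<^esub>"
      using that in' by (simp add: G.m_assoc)
    have e2: "y \<otimes>\<^bsub>G\<^esub> z \<noteq> \<one>\<^bsub>G\<^esub>" if "x \<otimes>\<^bsub>G\<^esub> y = \<one>\<^bsub>G\<^esub>" "z \<noteq> x" 
    proof
      assume "y \<otimes>\<^bsub>G\<^esub> z = \<one>\<^bsub>G\<^esub>"
      then have "x \<otimes>\<^bsub>G\<^esub> (y \<otimes>\<^bsub>G\<^esub> z) = x" using in' by simp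
      with Gs[OF that(1)] in' that(2) show False by simp
    qed
    have e3: "z \<noteq> \<one>\<^bsub>G\<^esub>" using that w by (auto simp: fpw LI)
    show ?thesis
      using in' e1 e2 e3 w Gs[of x y z] by (auto simp: G.m_assoc)
  qed
  have canH: "?c (Inr x) (?c (Inr y) w) = (if x \<otimes>\<^bsub>H\<^esub> y = \<one>\<^bsub>H\<^esub> then w else ?c (Inr (x \<otimes>\<^bsub>H\<^esub> y)) w)"
    if "Inr x \<in> ?L" "Inr y \<in> ?L" "w \<in> ?W" for x y w
  proof (cases "w \<noteq> [] \<and> \<not> isl (hd w)")
    case False
    then have "?c (Inr z) w = Inr z # w" for z
      by (cases w; cases "hd w") auto
    then show ?thesis by simp
  next
    case True
    then obtain z v where w: "w = Inr z # v"
      by (cases w; cases "hd w") auto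
    have v: "v = [] \<or> (\<exists>z' v'. v = Inl z' # v')"
      using that(3) w by (cases v; cases "hd v") (auto simp: fpw)
    have [simp]: "?c (Inr k) v = Inr k # v" for k
      using v by auto
    have in': "x \<in> carrier H" "y \<in> carrier H" "z \<in> carrier H" "x \<noteq> \<one>\<^bsub>H\<^esub>"
      using that w by (auto simp: fpw LR)
    have e1: "x \<otimes>\<^bsub>H\<^esub> y \<otimes>\<^bsub>H\<^esub> z = x" if "y \<otimes>\<^bsub>H\<^esub> z = \<one>\<^bsub>H\<^esub>"
      using that in' by (simp add: H.m_assoc)
    have e2: "y \<otimes>\<^bsub>H\<^esub> z \<noteq> \<one>\<^bsub>H\<^esub>" if "x \<otimes>\<^bsub>H\<^esub> y = \<one>\<^bsub>H\<^esub>" "z \<noteq> x" 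
    proof
      assume "y \<otimes>\<^bsub>H\<^esub> z = \<one>\<^bsub>H\<^esub>"
      then have "x \<otimes>\<^bsub>H\<^esub> (y \<otimes>\<^bsub>H\<^esub> z) = x" using in' by simp
      with Hs[OF that(1)] in' that(2) show False by simp
    qed
    have e3: "z \<noteq> \<one>\<^bsub>H\<^esub>" using that w by (auto simp: fpw LR)
    show ?thesis
      using in' e1 e2 e3 w Hs[of x y z] by (auto simp: H.m_assoc)
  qed
  have step: "foldr ?c (?c a v) w = ?c a (foldr ?c v w)"
    if "a \<in> ?L" "v \<in> ?W" "w \<in> ?W" for a v w
  proof (cases v)
    case (Cons b v')
    have "set v' \<subseteq> ?L" "b \<in> ?L"
      using that Cons by (auto simp: fp_words_def)
    then have v': "foldr ?c v' w \<in> ?W" "b \<in> ?L"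
      using closed that by blast+
    show ?thesis
      using that(1) v' Cons canG[OF _ _ v'(1)] canH[OF _ _ v'(1)]
      by (cases a; cases b) auto
  qed (cases a; simp)
  have assoc: "foldr ?c (foldr ?c u v) w = foldr ?c u (foldr ?c v w)"
    if "set u \<subseteq> ?L" "v \<in> ?W" "w \<in> ?W" for u v w
    using that by (induction u) (auto simp: step closed)
  have inverse: "\<exists>u\<in>?W. foldr ?c u w = []" if "w \<in> ?W" for w
    using that
  proof (induction w)
    case Nil
    then show ?case by (auto intro!: bexI[of _ "[]"])
  next
    case (Cons a w)
    then obtain u where u: "u \<in> ?W" "foldr ?c u w = []" and a: "a \<in> ?L" "w \<in> ?W"
      by (auto simp: fpw)
    obtain b where b: "b \<in> ?L" "?c b (a # w) = w"
    proof (cases a)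
      case (Inl x)
      then show ?thesis
        using a(1) by (intro that[of "Inl (inv\<^bsub>G\<^esub> x)"]) (auto simp: LI)
    next
      case (Inr x)
      then show ?thesis
        using a(1) by (intro that[of "Inr (inv\<^bsub>H\<^esub> x)"]) (auto simp: LR)
    qed
    have "foldr ?c (foldr ?c u [b]) (a # w) = foldr ?c u (foldr ?c [b] (a # w))"
      using u b Cons.prems by (intro assoc) (auto simp: fp_words_def)
    then have "foldr ?c (foldr ?c u [b]) (a # w) = []"
      using b u by simp
    moreover have "foldr ?c u [b] \<in> ?W"
      using u b by (intro closed) (auto simp: fp_words_def)
    ultimately show ?case by blast
  qed
  show ?thesis
  proof (rule groupI)
    show "\<exists>y\<in>carrier (free_product G H). y \<otimes>\<^bsub>free_product G H\<^esub> x = \<one>\<^bsub>free_product G H\<^esub>"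
      if "x \<in> carrier (free_product G H)" for x
      using inverse that by (simp add: free_product_def)
  qed (use closed assoc Nil in \<open>auto simp: free_product_def fp_words_def\<close>)
qed

text \<open>For two subgroups of \<open>G\<close>, the canonical homomorphism from their free product to \<open>G\<close>.\<close>

definition fp_eval :: "('a, 'c) monoid_scheme \<Rightarrow> ('a + 'a) list \<Rightarrow> 'a" where
  "fp_eval G w = foldr (\<lambda>a x. case_sum id id a \<otimes>\<^bsub>G\<^esub> x) w \<one>\<^bsub>G\<^esub>"

definition is_free_product_of ::
    "('a, 'c) monoid_scheme \<Rightarrow> 'a set \<Rightarrow> 'a set \<Rightarrow> 'a set \<Rightarrow> bool" where
  "is_free_product_of G K A B \<longleftrightarrow>
     fp_eval G \<in> iso (free_product (G\<lparr>carrier := A\<rparr>) (G\<lparr>carrier := B\<rparr>)) (G\<lparr>carrier := K\<rparr>)"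

end

theory Submission
  imports Defs
begin

text \<open>Let \<open>\<Sigma>\<close> be the complex line through the end points \<open>p1\<close>, \<open>p2\<close> of the orthogeodesic; it meets both
\<open>L1\<close> and \<open>L2\<close> orthogonally (\<open>common_spine\<close>). Two kinds of orthogonal projection carry the proof.

\<^emph>\<open>Projection to \<open>\<Sigma>\<close>.\<close> It does not increase distances and collapses \<open>L1\<close> to \<open>p1\<close> and \<open>L2\<close> to \<open>p2\<close>.
Writing \<open>F q\<close> and \<open>G q\<close> for the distances from \<open>p1\<close> and \<open>p2\<close> to the projection of \<open>q\<close>, this gives
\<open>F q \<le> rho x q\<close> for \<open>x \<in> L1\<close> (\<open>height_le_rho\<close>), the same for \<open>G\<close> and \<open>L2\<close>, and
\<open>F q + G q \<ge> rho p1 p2\<close> by the triangle inequality. In particular \<open>rho p1 p2 = \<rho>(L1, L2)\<close>.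

\<^emph>\<open>Projection to \<open>L1\<close>.\<close> Let the tube \<open>V\<close> consist of the points that project into the disc of radius
\<open>r1\<close> about \<open>p1\<close>, a disc that embeds in \<open>L1/\<Gamma>1\<close>; \<open>r1\<close> and \<open>r2\<close> can be chosen so that \<open>s(r1) + s(r2)\<close> is still less than
\<open>rho p1 p2\<close> (\<open>injective_disc\<close>). A discrete torsion-free
group acts freely (\<open>fixed_point_trivial\<close>) and isometries that preserve \<open>L1\<close> commute with the
projection, so every non-trivial element of \<open>\<Gamma>1\<close> moves \<open>V\<close> off itself (\<open>tube_moved_off\<close>). Let \<open>W\<close> be
the analogous tube about \<open>L2\<close>.

The two projections interact. Use ball coordinates with centre \<open>p1\<close> and axes \<open>L1\<close> and \<open>\<Sigma>\<close>. Off \<open>V\<close> we have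
\<open>\<bar>z1\<bar> \<ge> tanh (r1/2)\<close>, and since \<open>\<bar>z1\<bar>\<^sup>2 + \<bar>z2\<bar>\<^sup>2 < 1\<close> this forces \<open>\<bar>z2\<bar> < 1 / cosh (r1/2) = tanh (s(r1)/2)\<close>,
that is, \<open>F < s(r1)\<close> (\<open>outside_tube_height\<close>). Likewise \<open>G < s(r2)\<close> off \<open>W\<close>. As
\<open>F + G \<ge> rho p1 p2 > s(r1) + s(r2)\<close>, no point lies outside both tubes.

So the complements of \<open>V\<close> and \<open>W\<close> are disjoint, and ping-pong applies: a reduced word sends the tube
that belongs to its last letter off the tube that belongs to its first letter (\<open>word_moves\<close>). On
\<open>L1\<close> we have \<open>F = 0\<close>, so \<open>G \<ge> rho p1 p2 > s(r2)\<close> and \<open>L1 \<subseteq> W\<close>; likewise \<open>L2 \<subseteq> V\<close>. Thus \<open>p1\<close> lies in the open set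
\<open>V \<inter> W\<close>, and every non-empty reduced word moves it out of this set. This gives both the free product and
discreteness. For an element outside \<open>\<Gamma>1\<close>, remove the outer \<open>\<Gamma>1\<close>-letters of its word; what remains
is not empty and sends \<open>L1 \<subseteq> W\<close> off \<open>W\<close>, hence off \<open>L1\<close>. This is embeddedness.

For the distance between the surfaces, let \<open>w\<close> be a reduced word that begins in \<open>\<Gamma>2\<close> and ends in \<open>\<Gamma>1\<close>.
Along a geodesic from \<open>x1 \<in> L1\<close> to \<open>w x2 \<in> w L2\<close>, consider \<open>F\<close>, which bounds the distance to \<open>x1\<close> from
below, and \<open>G \<circ> w\<^sup>-\<^sup>1\<close>, which does so for \<open>w x2\<close>. Ping-pong prevents these from being simultaneously
below \<open>rho p1 p2 - s(r2)\<close> and \<open>s(r2)\<close>, so by connectedness some point of the geodesic satisfies both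
lower bounds, and the length is at least \<open>rho p1 p2\<close> (\<open>moved_line_distance\<close>).\<close>

section \<open>The Hermitian form and the distance\<close>

lemma vec3_eq_iff: "(v :: 'a^3) = w \<longleftrightarrow> v$1 = w$1 \<and> v$2 = w$2 \<and> v$3 = w$3"
  by (simp add: vec_eq_iff forall_3)

lemma vec2_eq_iff: "(v :: 'a^2) = w \<longleftrightarrow> v$1 = w$1 \<and> v$2 = w$2"
  by (simp add: vec_eq_iff forall_2)

lemma hform_add_left: "hform (u + v) w = hform u w + hform v w"
  by (simp add: hform_def algebra_simps)

lemma hform_add_right: "hform u (v + w) = hform u v + hform u w"
  by (simp add: hform_def algebra_simps)

lemma hform_diff_left: "hform (u - v) w = hform u w - hform v w"
  by (simp add: hform_def algebra_simps)

lemma hform_diff_right: "hform u (v - w) = hform u v - hform u w"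
  by (simp add: hform_def algebra_simps)

lemma hform_scale_left: "hform (c *s v) w = c * hform v w"
  by (simp add: hform_def algebra_simps)

lemma hform_scale_right: "hform v (c *s w) = cnj c * hform v w"
  by (simp add: hform_def algebra_simps)

lemmas hform_simps = hform_add_left hform_add_right hform_diff_left hform_diff_right
  hform_scale_left hform_scale_right

lemma hform_commute: "hform w v = cnj (hform v w)"
  by (simp add: hform_def algebra_simps)

definition hsq :: "complex^3 \<Rightarrow> real" where
  "hsq v = (cmod (v$1))\<^sup>2 + (cmod (v$2))\<^sup>2 - (cmod (v$3))\<^sup>2"

lemma hform_self: "hform v v = complex_of_real (hsq v)"
  by (simp add: hform_def hsq_def complex_norm_square del: of_real_power)

lemma hsq_scale: "hsq (c *s v) = (cmod c)\<^sup>2 * hsq v"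
  by (simp add: hsq_def norm_mult power_mult_distrib algebra_simps)

lemma U21_hform: "A \<in> carrier U21 \<Longrightarrow> hform (A *v v) (A *v w) = hform v w"
  by (simp add: U21_def)

lemma U21_hsq: "A \<in> carrier U21 \<Longrightarrow> hsq (A *v v) = hsq v"
  by (metis U21_hform hform_self of_real_eq_iff)

lemma matrix_scale: "(A :: complex^3^3) *v (c *s v) = c *s (A *v v)"
  by (simp add: matrix_vector_mult_def vec_eq_iff sum_3 algebra_simps)

lemma hsq_neg_third: "hsq v < 0 \<Longrightarrow> v$3 \<noteq> 0"
  by (smt (verit) hsq_def norm_zero power_zero_numeral zero_le_power2)

definition drop_pt :: "complex^3 \<Rightarrow> complex^2" where
  "drop_pt v = vector [v$1 / v$3, v$2 / v$3]"

lemma lift_pt_nth [simp]: "lift_pt p $ 1 = p$1" "lift_pt p $ 2 = p$2" "lift_pt p $ 3 = 1"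
  by (simp_all add: lift_pt_def)

lemma drop_pt_nth [simp]: "drop_pt v $ 1 = v$1 / v$3" "drop_pt v $ 2 = v$2 / v$3"
  by (simp_all add: drop_pt_def)

lemma lift_drop: "v$3 \<noteq> 0 \<Longrightarrow> lift_pt (drop_pt v) = (1 / v$3) *s v"
  by (simp add: vec3_eq_iff)

lemma drop_lift [simp]: "drop_pt (lift_pt p) = p"
  by (simp add: vec2_eq_iff)

lemma drop_scale: "c \<noteq> 0 \<Longrightarrow> drop_pt (c *s v) = drop_pt v"
  by (simp add: vec2_eq_iff)

lemma mat_act_drop: "mat_act A p = drop_pt (A *v lift_pt p)"
  by (simp add: mat_act_def drop_pt_def Let_def)

lemma H2C_hsq: "p \<in> H2C \<longleftrightarrow> hsq (lift_pt p) < 0"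
  by (simp add: H2C_def hsq_def)

lemma drop_H2C: "hsq v < 0 \<Longrightarrow> drop_pt v \<in> H2C"
  by (simp add: H2C_hsq lift_drop hsq_neg_third hsq_scale mult_pos_neg)

text \<open>The value of \<open>cosh (rho/2)\<^sup>2\<close> as a function of representing vectors. It is unchanged by scaling and by
\<open>U(2,1)\<close>, so distances can be computed from whichever representatives have the simplest coordinates.\<close>

definition hratio :: "complex^3 \<Rightarrow> complex^3 \<Rightarrow> real" where
  "hratio v w = (cmod (hform v w))\<^sup>2 / (hsq v * hsq w)"

lemma hratio_scale: "c \<noteq> 0 \<Longrightarrow> d \<noteq> 0 \<Longrightarrow> hratio (c *s v) (d *s w) = hratio v w"
  by (simp add: hratio_def hform_simps hsq_scale norm_mult power_mult_distrib)

lemma hratio_commute: "hratio v w = hratio w v"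
  by (metis hratio_def hform_commute complex_mod_cnj mult.commute)

lemma hratio_U21: "A \<in> carrier U21 \<Longrightarrow> hratio (A *v v) (A *v w) = hratio v w"
  by (simp add: hratio_def U21_hform U21_hsq)

lemma hratio_drop: "hsq v < 0 \<Longrightarrow> hsq w < 0 \<Longrightarrow>
    hratio (lift_pt (drop_pt v)) (lift_pt (drop_pt w)) = hratio v w"
  by (simp add: lift_drop hsq_neg_third hratio_scale)

lemma rho_hratio: "rho p q = 2 * arcosh (sqrt (hratio (lift_pt p) (lift_pt q)))"
proof -
  have "hform (lift_pt p) (lift_pt q) * hform (lift_pt q) (lift_pt p) =
      complex_of_real ((cmod (hform (lift_pt p) (lift_pt q)))\<^sup>2)"
    unfolding complex_norm_square by (metis hform_commute)
  then show ?thesis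
    by (simp add: rho_def hratio_def hform_self flip: of_real_mult of_real_divide del: of_real_power)
qed

lemma cosh_sq_rho:
  assumes "p \<in> H2C" "q \<in> H2C"
  shows "(cosh (rho p q / 2))\<^sup>2 = hratio (lift_pt p) (lift_pt q)"
proof -
  have "hform (lift_pt p) (lift_pt q) * hform (lift_pt q) (lift_pt p) =
      complex_of_real ((cmod (hform (lift_pt p) (lift_pt q)))\<^sup>2)"
    unfolding complex_norm_square by (metis hform_commute)
  then have "complex_of_real ((cosh (rho p q / 2))\<^sup>2) = complex_of_real (hratio (lift_pt p) (lift_pt q))"
    unfolding cosh_rho[OF assms]
    by (simp add: hratio_def hform_self flip: of_real_mult of_real_divide del: of_real_power)
  then show ?thesis using of_real_eq_iff by blast
qed

lemma hratio_ge1: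
  assumes "p \<in> H2C" "q \<in> H2C"
  shows "1 \<le> hratio (lift_pt p) (lift_pt q)"
  using cosh_sq_rho[OF assms] cosh_real_ge_1[of "rho p q / 2"] by (metis one_le_power)

lemma rho_nonneg: "p \<in> H2C \<Longrightarrow> q \<in> H2C \<Longrightarrow> 0 \<le> rho p q"
  by (simp add: rho_hratio hratio_ge1)

lemma rho_commute: "rho p q = rho q p"
  by (simp add: rho_hratio hratio_commute)

lemma rho_mono_hratio:
  assumes "p \<in> H2C" "q \<in> H2C" "p' \<in> H2C" "q' \<in> H2C"
  shows "rho p q \<le> rho p' q' \<longleftrightarrow> hratio (lift_pt p) (lift_pt q) \<le> hratio (lift_pt p') (lift_pt q')"
proof -
  have "rho p q \<le> rho p' q' \<longleftrightarrow> cosh (rho p q / 2) \<le> cosh (rho p' q' / 2)"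
    using assms by (simp add: cosh_real_nonneg_le_iff rho_nonneg)
  also have "\<dots> \<longleftrightarrow> (cosh (rho p q / 2))\<^sup>2 \<le> (cosh (rho p' q' / 2))\<^sup>2"
    by (simp add: abs_le_square_iff[symmetric])
  finally show ?thesis using assms by (simp add: cosh_sq_rho)
qed

lemma mat_act_H2C: "A \<in> carrier U21 \<Longrightarrow> p \<in> H2C \<Longrightarrow> mat_act A p \<in> H2C"
  by (simp add: mat_act_drop drop_H2C U21_hsq H2C_hsq[symmetric])

lemma lift_mat_act:
  assumes "A \<in> carrier U21" "p \<in> H2C"
  shows "(A *v lift_pt p)$3 \<noteq> 0" "A *v lift_pt p = (A *v lift_pt p)$3 *s lift_pt (mat_act A p)"
proof -
  show *: "(A *v lift_pt p)$3 \<noteq> 0"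
    using assms by (simp add: hsq_neg_third U21_hsq H2C_hsq)
  show "A *v lift_pt p = (A *v lift_pt p)$3 *s lift_pt (mat_act A p)"
    using * by (simp add: mat_act_drop lift_drop)
qed

lemma mat_act_rho:
  assumes "A \<in> carrier U21" "p \<in> H2C" "q \<in> H2C"
  shows "rho (mat_act A p) (mat_act A q) = rho p q"
  using assms by (simp add: rho_hratio mat_act_drop hratio_drop U21_hsq hratio_U21 H2C_hsq)

lemma mat_act_mult:
  assumes "A \<in> carrier U21" "B \<in> carrier U21" "p \<in> H2C"
  shows "mat_act (A ** B) p = mat_act A (mat_act B p)"
proof -
  let ?c = "(B *v lift_pt p)$3"
  have "(A ** B) *v lift_pt p = A *v (?c *s lift_pt (mat_act B p))"
    using lift_mat_act(2)[OF assms(2,3)] by (metis matrix_vector_mul_assoc)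
  then have "(A ** B) *v lift_pt p = ?c *s (A *v lift_pt (mat_act B p))"
    by (simp add: matrix_scale)
  then show ?thesis
    using lift_mat_act(1)[OF assms(2,3)] by (simp add: mat_act_drop drop_scale)
qed

lemma mat_act_one [simp]: "mat_act (mat 1) p = p"
  by (simp add: mat_act_drop)

section \<open>Orthonormal frames\<close>

text \<open>The form has signature \<open>(2,1)\<close>, so the orthogonal complement of a negative vector is positive definite.
In coordinates this is the Cauchy--Schwarz inequality in the first two components.\<close>

lemma orthogonal_to_negative:
  assumes "hsq P < 0" "hform v P = 0" "v \<noteq> 0"
  shows "0 < hsq v"
proof -
  define a b where "a = (cmod (v$1))\<^sup>2 + (cmod (v$2))\<^sup>2" and "b = (cmod (P$1))\<^sup>2 + (cmod (P$2))\<^sup>2"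
  have b: "b < (cmod (P$3))\<^sup>2" using assms(1) by (simp add: hsq_def b_def)
  have "v$3 * cnj (P$3) = v$1 * cnj (P$1) + v$2 * cnj (P$2)"
    using assms(2) by (simp add: hform_def)
  then have "cmod (v$3) * cmod (P$3) \<le> cmod (v$1) * cmod (P$1) + cmod (v$2) * cmod (P$2)"
    by (metis norm_triangle_ineq norm_mult complex_mod_cnj)
  then have "(cmod (v$3) * cmod (P$3))\<^sup>2 \<le> (cmod (v$1) * cmod (P$1) + cmod (v$2) * cmod (P$2))\<^sup>2"
    by (simp add: power_mono)
  also have "\<dots> \<le> a * b"
    using zero_le_power2[of "cmod (v$1) * cmod (P$2) - cmod (v$2) * cmod (P$1)"]
    by (simp add: a_def b_def power2_eq_square algebra_simps)
  finally have *: "(cmod (v$3))\<^sup>2 * (cmod (P$3))\<^sup>2 \<le> a * b"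
    by (simp add: power_mult_distrib)
  have "P$3 \<noteq> 0" using hsq_neg_third assms(1) by blast
  show ?thesis
  proof (cases "a = 0")
    case True
    then have "v$1 = 0" "v$2 = 0" by (auto simp: a_def sum_power2_eq_zero_iff)
    then show ?thesis
      using assms \<open>P$3 \<noteq> 0\<close> by (auto simp: hform_def vec3_eq_iff)
  next
    case False
    then have "a > 0" unfolding a_def by (smt (verit) zero_le_power2)
    then have "a * b < a * (cmod (P$3))\<^sup>2" using b by simp
    then have "(cmod (v$3))\<^sup>2 * (cmod (P$3))\<^sup>2 < a * (cmod (P$3))\<^sup>2" using * by linarith
    then have "(cmod (v$3))\<^sup>2 < a" by (simp add: mult_less_cancel_right)
    then show ?thesis by (simp add: hsq_def a_def)
  qed
qed

text \<open>The vector is the cross product, twisted by the signs of the form and by conjugation; its length is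
given by the Lagrange identity.\<close>

lemma exists_orthogonal_unit:
  assumes "hform a a = 1" "hform b b = -1" "hform a b = 0"
  obtains x where "hform x a = 0" "hform x b = 0" "hform x x = 1"
proof
  let ?x = "vector [cnj (a$2 * b$3 - a$3 * b$2), cnj (a$3 * b$1 - a$1 * b$3),
      - cnj (a$1 * b$2 - a$2 * b$1)] :: complex^3"
  show "hform ?x a = 0" "hform ?x b = 0"
    by (simp_all add: hform_def algebra_simps)
  have "hform ?x ?x = hform a b * cnj (hform a b) - hform a a * hform b b"
    by (simp add: hform_def algebra_simps)
  then show "hform ?x ?x = 1" using assms by simp
qed

text \<open>The matrix with columns \<open>a\<close>, \<open>x\<close>, \<open>b\<close> carries the standard basis to this one and preserves the form;
\<open>M\<close> is its inverse.\<close>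

lemma U21_of_orthonormal:
  assumes "hform a a = 1" "hform x x = 1" "hform b b = -1"
    "hform a b = 0" "hform x a = 0" "hform x b = 0"
  obtains M where "M \<in> carrier U21"
    "M *v a = axis 1 1" "M *v x = axis 2 1" "M *v b = axis 3 1"
proof -
  define N :: "complex^3^3" where "N = (\<chi> i. vector [a$i, x$i, b$i])"
  have N: "N *v v = v$1 *s a + v$2 *s x + v$3 *s b" for v
    by (simp add: N_def matrix_vector_mult_def vec3_eq_iff sum_3 algebra_simps)
  have c: "hform b a = 0" "hform a x = 0" "hform b x = 0"
    using assms hform_commute[of b a] hform_commute[of a x] hform_commute[of b x] by auto
  have "N \<in> carrier U21"
    by (simp add: U21_def N hform_simps assms c) (simp add: hform_def)
  then obtain M where M: "M \<in> carrier U21" "M ** N = mat 1"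
    using U21_invertible by blast
  have "M *v (N *v v) = v" for v
    by (simp add: matrix_vector_mul_assoc M)
  from this[of "axis 1 1"] this[of "axis 2 1"] this[of "axis 3 1"] that[OF M(1)] show ?thesis
    by (simp add: N axis_def)
qed

text \<open>Gram--Schmidt, started with the negative vector over \<open>p\<close> and the direction \<open>u\<close>: some element of \<open>U(2,1)\<close>
moves \<open>p\<close> to the centre of the ball and \<open>u\<close> to the first coordinate axis.\<close>

lemma frame_exists:
  assumes "p \<in> H2C" "(u :: complex^2) \<noteq> 0"
  obtains M c d e where "M \<in> carrier U21" "c \<noteq> 0" "M *v lift_pt p = c *s axis 3 1"
    "d \<noteq> 0" "M *v vector [u$1, u$2, 0] = vector [d, 0, e]"
proof -
  define P U where "P = lift_pt p" and "U = (vector [u$1, u$2, 0] :: complex^3)"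
  define h where "h = hsq P"
  have h: "h < 0" using assms by (simp add: h_def P_def H2C_hsq)
  define E where "E = complex_of_real h *s U - hform U P *s P"
  have EP: "hform E P = 0" by (simp add: E_def hform_simps hform_self h_def)
  have "E \<noteq> 0"
  proof
    assume E0: "E = 0"
    then have "hform U P = 0" by (simp add: E_def vec3_eq_iff P_def U_def)
    then show False
      using E0 h assms(2) by (auto simp: E_def vec3_eq_iff vec2_eq_iff U_def)
  qed
  then have k: "0 < hsq E" using orthogonal_to_negative EP h h_def by blast
  define r s where "r = sqrt (hsq E)" and "s = sqrt (-h)"
  have r: "r > 0" "r * r = hsq E" and s: "s > 0" "s * s = -h"
    using k h by (auto simp: r_def s_def)
  define a b where "a = complex_of_real (1/r) *s E" and "b = complex_of_real (1/s) *s P"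
  have aa: "hform a a = 1" using r k
    by (simp add: a_def hform_self hsq_scale norm_divide power_divide power2_eq_square)
  have bb: "hform b b = -1" using s h
    by (simp add: b_def hform_self hsq_scale norm_divide power_divide power2_eq_square h_def[symmetric])
  have ab: "hform a b = 0" by (simp add: a_def b_def hform_simps EP)
  obtain x where x: "hform x a = 0" "hform x b = 0" "hform x x = 1"
    using exists_orthogonal_unit[OF aa bb ab] .
  obtain M where M: "M \<in> carrier U21" "M *v a = axis 1 1" "M *v x = axis 2 1" "M *v b = axis 3 1"
    using U21_of_orthonormal[OF aa x(3) bb ab x(1,2)] .
  have P: "P = complex_of_real s *s b" and "E = complex_of_real r *s a"
    using r s by (auto simp: a_def b_def vec3_eq_iff)
  moreover have "U = complex_of_real (1/h) *s E + (hform U P / of_real h) *s P"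
    using h by (simp add: E_def vec3_eq_iff field_simps)
  ultimately have "U = complex_of_real (r/h) *s a + (hform U P * s / of_real h) *s b"
    by (simp add: vec3_eq_iff)
  then have "M *v U = complex_of_real (r/h) *s axis 1 1 + (hform U P * s / of_real h) *s axis 3 1"
    by (metis matrix_vector_right_distrib matrix_scale M(2,4))
  then have "M *v U = vector [of_real (r/h), 0, hform U P * s / of_real h]"
    by (simp add: vec3_eq_iff axis_def)
  moreover have "M *v P = complex_of_real s *s axis 3 1"
    by (simp add: P matrix_scale M)
  moreover have "complex_of_real s \<noteq> 0" "complex_of_real (r/h) \<noteq> 0"
    using r s h by auto
  ultimately show ?thesis using that[OF M(1)] unfolding P_def U_def by blast
qed

section \<open>The action and the topology of \<open>PU(2,1)\<close>\<close>

definition cls :: "complex^3^3 \<Rightarrow> (complex^3^3) set" where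
  "cls A = U21_scalars #>\<^bsub>U21\<^esub> A"

interpretation U21: group U21 by (rule group_U21)
interpretation PU21: group PU21 by (rule group_PU21)

lemma U21_mult: "A \<otimes>\<^bsub>U21\<^esub> B = A ** B" and U21_one: "\<one>\<^bsub>U21\<^esub> = mat 1"
  by (simp_all add: U21_def)

lemma U21_closed: "A \<in> carrier U21 \<Longrightarrow> B \<in> carrier U21 \<Longrightarrow> A ** B \<in> carrier U21"
  using U21.m_closed by (simp add: U21_mult)

lemma U21_one_closed: "mat 1 \<in> carrier U21"
  using U21.one_closed by (simp add: U21_one)

lemma carrier_PU21: "carrier PU21 = cls ` carrier U21"
  by (auto simp: PU21_def FactGroup_def RCOSETS_def cls_def)

lemma cls_mult: "A \<in> carrier U21 \<Longrightarrow> B \<in> carrier U21 \<Longrightarrow> cls A \<otimes>\<^bsub>PU21\<^esub> cls B = cls (A ** B)"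
  using normal.rcos_sum[OF normal_U21_scalars, of A B]
  by (simp add: PU21_def FactGroup_def cls_def U21_mult)

lemma cls_one: "cls (mat 1) = \<one>\<^bsub>PU21\<^esub>"
proof -
  have "U21_scalars \<subseteq> carrier U21" by (auto simp: U21_scalars_def)
  then show ?thesis
    using U21.coset_mult_one[of U21_scalars] by (simp add: PU21_def FactGroup_def cls_def U21_one)
qed

lemma cls_pow: "A \<in> carrier U21 \<Longrightarrow> cls A [^]\<^bsub>PU21\<^esub> (n::nat) = cls (A [^]\<^bsub>U21\<^esub> n)"
  by (induction n) (simp_all add: cls_one[folded U21_one] cls_mult flip: U21_mult)

lemma act_cls: "A \<in> carrier U21 \<Longrightarrow> act (cls A) p = mat_act A p"
  using U21.rcos_self[OF _ normal_imp_subgroup[OF normal_U21_scalars], of A]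
  by (intro act_eq) (auto simp: carrier_PU21 cls_def)

lemma act_mult:
  assumes "g \<in> carrier PU21" "h \<in> carrier PU21" "p \<in> H2C"
  shows "act (g \<otimes>\<^bsub>PU21\<^esub> h) p = act g (act h p)"
  using assms by (auto simp: carrier_PU21 cls_mult act_cls U21_closed mat_act_mult)

lemma act_one: "act \<one>\<^bsub>PU21\<^esub> p = p"
  by (simp add: U21_one_closed act_cls flip: cls_one)

lemma act_H2C: "g \<in> carrier PU21 \<Longrightarrow> p \<in> H2C \<Longrightarrow> act g p \<in> H2C"
  by (auto simp: carrier_PU21 act_cls mat_act_H2C)

lemma act_rho: "g \<in> carrier PU21 \<Longrightarrow> p \<in> H2C \<Longrightarrow> q \<in> H2C \<Longrightarrow> rho (act g p) (act g q) = rho p q"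
  by (auto simp: carrier_PU21 act_cls mat_act_rho)

lemma act_inv: "g \<in> carrier PU21 \<Longrightarrow> p \<in> H2C \<Longrightarrow> act (inv\<^bsub>PU21\<^esub> g) (act g p) = p"
  by (simp flip: act_mult add: act_one)

lemma act_inv': "g \<in> carrier PU21 \<Longrightarrow> p \<in> H2C \<Longrightarrow> act g (act (inv\<^bsub>PU21\<^esub> g) p) = p"
  by (simp flip: act_mult add: act_one)

lemma matrix_mult_nth: "((A :: complex^3^3) ** B) $ i $ j = (\<Sum>k\<in>UNIV. A$i$k * B$k$j)"
  by (simp add: matrix_matrix_mult_def)

lemma tendsto_matrix_mult:
  fixes f g :: "'x \<Rightarrow> complex^3^3"
  assumes "(f \<longlongrightarrow> A) F" "(g \<longlongrightarrow> B) F"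
  shows "((\<lambda>x. f x ** g x) \<longlongrightarrow> A ** B) F"
  by (intro vec_tendstoI) (auto simp: matrix_mult_nth intro!: tendsto_intros assms)

lemma continuous_on_matrix_mult:
  fixes f g :: "'x::topological_space \<Rightarrow> complex^3^3"
  shows "continuous_on S f \<Longrightarrow> continuous_on S g \<Longrightarrow> continuous_on S (\<lambda>x. f x ** g x)"
  unfolding continuous_on_def by (auto intro: tendsto_matrix_mult)

lemma tendsto_drop_pt:
  assumes "(f \<longlongrightarrow> v) F" "v$3 \<noteq> 0"
  shows "((\<lambda>x. drop_pt (f x)) \<longlongrightarrow> drop_pt v) F"
proof (rule vec_tendstoI)
  show "((\<lambda>x. drop_pt (f x) $ i) \<longlongrightarrow> drop_pt v $ i) F" for i
    using exhaust_2[of i] by (elim disjE; simp; intro tendsto_intros assms)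
qed

lemma tendsto_lift_pt: "(f \<longlongrightarrow> p) F \<Longrightarrow> ((\<lambda>x. lift_pt (f x)) \<longlongrightarrow> lift_pt p) F"
proof (rule vec_tendstoI)
  show "((\<lambda>x. lift_pt (f x) $ i) \<longlongrightarrow> lift_pt p $ i) F" if "(f \<longlongrightarrow> p) F" for i
    using exhaust_3[of i] by (elim disjE; simp; intro tendsto_intros that)
qed

lemma tendsto_matrix_vector:
  fixes f :: "'x \<Rightarrow> complex^3^3"
  assumes "(f \<longlongrightarrow> A) F" "(g \<longlongrightarrow> v) F"
  shows "((\<lambda>x. f x *v g x) \<longlongrightarrow> A *v v) F"
  by (intro vec_tendstoI) (auto simp: matrix_vector_mult_def intro!: tendsto_intros assms)

lemma tendsto_mat_act:
  assumes "(f \<longlongrightarrow> A) F" "(g \<longlongrightarrow> p) F" "A \<in> carrier U21" "p \<in> H2C"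
  shows "((\<lambda>x. mat_act (f x) (g x)) \<longlongrightarrow> mat_act A p) F"
  unfolding mat_act_drop
  by (intro tendsto_drop_pt tendsto_matrix_vector tendsto_lift_pt assms lift_mat_act)

lemma continuous_on_act: "g \<in> carrier PU21 \<Longrightarrow> continuous_on H2C (act g)"
proof -
  assume "g \<in> carrier PU21"
  then obtain A where A: "A \<in> carrier U21" "g = cls A"
    by (auto simp: carrier_PU21)
  then have "act g = mat_act A" by (simp add: act_cls fun_eq_iff)
  note A = A this
  then show ?thesis
    unfolding continuous_on_def A(3) using A(1) by (auto intro!: tendsto_mat_act tendsto_intros)
qed

lemma openin_PU21: "openin PU21_topology W \<longleftrightarrow> W \<subseteq> carrier PU21 \<and>
    openin (top_of_set (carrier U21)) {A \<in> carrier U21. cls A \<in> W}"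
  by (simp add: openin_PU21_topology cls_def)

lemma topspace_PU21: "topspace PU21_topology = carrier PU21"
proof -
  have "{A \<in> carrier U21. cls A \<in> carrier PU21} = carrier U21"
    by (auto simp: carrier_PU21)
  then have "openin PU21_topology (carrier PU21)" by (simp add: openin_PU21)
  then show ?thesis
    using openin_PU21[of "topspace PU21_topology"] by (auto dest: openin_subset)
qed

lemma openin_act_preimage:
  assumes "open U" "p \<in> H2C"
  shows "openin PU21_topology {g \<in> carrier PU21. act g p \<in> U}"
proof -
  have "{A \<in> carrier U21. cls A \<in> {g \<in> carrier PU21. act g p \<in> U}} =
      carrier U21 \<inter> (\<lambda>A. mat_act A p) -` U"
    by (auto simp: carrier_PU21 act_cls)
  moreover have "continuous_on (carrier U21) (\<lambda>A. mat_act A p)"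
    unfolding continuous_on_def by (auto intro!: tendsto_mat_act assms tendsto_intros)
  ultimately show ?thesis
    using assms(1) by (simp add: openin_PU21 continuous_openin_preimage_gen)
qed

lemma openin_translate:
  assumes "openin PU21_topology W" "g \<in> carrier PU21"
  shows "openin PU21_topology {h \<in> carrier PU21. g \<otimes>\<^bsub>PU21\<^esub> h \<in> W}"
proof -
  obtain B where B: "B \<in> carrier U21" "g = cls B"
    using assms by (auto simp: carrier_PU21)
  have "{A \<in> carrier U21. cls A \<in> {h \<in> carrier PU21. g \<otimes>\<^bsub>PU21\<^esub> h \<in> W}} =
      carrier U21 \<inter> (\<lambda>A. B ** A) -` {A \<in> carrier U21. cls A \<in> W}"
    using B by (auto simp: carrier_PU21 cls_mult U21_closed)
  moreover have "openin (top_of_set (carrier U21)) \<dots>"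
    by (rule continuous_openin_preimage[where T="carrier U21"])
      (use assms B in \<open>auto simp: openin_PU21 U21_closed intro!: continuous_on_matrix_mult continuous_intros\<close>)
  ultimately show ?thesis by (auto simp: openin_PU21)
qed

text \<open>Left translations are homeomorphisms, so all points of a subgroup are isolated as soon as the
identity is.\<close>

lemma discrete_subgroup_iff:
  "discrete_subgroup \<Gamma> \<longleftrightarrow> subgroup \<Gamma> PU21 \<and> (\<exists>W. openin PU21_topology W \<and> W \<inter> \<Gamma> = {\<one>\<^bsub>PU21\<^esub>})"
proof (cases "subgroup \<Gamma> PU21")
  case True
  then interpret subgroup \<Gamma> PU21 .
  have "subtopology PU21_topology \<Gamma> = discrete_topology \<Gamma> \<longleftrightarrow>
      topspace (subtopology PU21_topology \<Gamma>) = \<Gamma> \<and>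
      (\<forall>g\<in>\<Gamma>. openin (subtopology PU21_topology \<Gamma>) {g})"
    by (metis discrete_topology_unique)
  also have "\<dots> \<longleftrightarrow> (\<forall>g\<in>\<Gamma>. \<exists>W. openin PU21_topology W \<and> W \<inter> \<Gamma> = {g})"
    using subset by (simp add: topspace_PU21 Int_absorb1 openin_subtopology eq_commute[of "{_}"])
  also have "\<dots> \<longleftrightarrow> (\<exists>W. openin PU21_topology W \<and> W \<inter> \<Gamma> = {\<one>\<^bsub>PU21\<^esub>})"
  proof
    assume "\<exists>W. openin PU21_topology W \<and> W \<inter> \<Gamma> = {\<one>\<^bsub>PU21\<^esub>}"
    then obtain W where W: "openin PU21_topology W" "W \<inter> \<Gamma> = {\<one>\<^bsub>PU21\<^esub>}" by blast
    show "\<forall>g\<in>\<Gamma>. \<exists>W. openin PU21_topology W \<and> W \<inter> \<Gamma> = {g}"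
    proof
      fix g assume g: "g \<in> \<Gamma>"
      let ?W = "{h \<in> carrier PU21. inv\<^bsub>PU21\<^esub> g \<otimes>\<^bsub>PU21\<^esub> h \<in> W}"
      have "h = g" if "h \<in> \<Gamma>" "inv\<^bsub>PU21\<^esub> g \<otimes>\<^bsub>PU21\<^esub> h \<in> W" for h
      proof -
        have "inv\<^bsub>PU21\<^esub> g \<otimes>\<^bsub>PU21\<^esub> h = \<one>\<^bsub>PU21\<^esub>" using W(2) that g by blast
        moreover have "g \<otimes>\<^bsub>PU21\<^esub> (inv\<^bsub>PU21\<^esub> g \<otimes>\<^bsub>PU21\<^esub> h) = h"
          using that g PU21.m_assoc[of g "inv\<^bsub>PU21\<^esub> g" h] by simp
        ultimately show ?thesis using g by simp
      qed
      moreover have "g \<in> ?W"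
        using W(2) g by auto
      ultimately have "?W \<inter> \<Gamma> = {g}" using g by blast
      moreover have "openin PU21_topology ?W" using openin_translate W(1) g by simp
      ultimately show "\<exists>W. openin PU21_topology W \<and> W \<inter> \<Gamma> = {g}" by blast
    qed
  qed auto
  finally show ?thesis using True by (simp add: discrete_subgroup_def)
qed (simp add: discrete_subgroup_def)

section \<open>Torsion-free discrete groups act freely\<close>

text \<open>The stabilizer of the centre of the ball is contained in \<open>U(3)\<close>: the squared norm of \<open>w\<close> is
\<open>hsq w + 2 \<bar>\<langle>w, e\<^sub>3\<rangle>\<bar>\<^sup>2\<close>, and both terms are preserved.\<close>

lemma stabilizer_unitary:
  assumes "C \<in> carrier U21" "C *v axis 3 1 = c *s axis 3 1"
  shows "norm (C *v v) = norm v"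
proof -
  have n: "(norm w)\<^sup>2 = hsq w + 2 * (cmod (hform w (axis 3 1)))\<^sup>2" for w :: "complex^3"
    by (simp add: norm_vec_def L2_set_def sum_3 hsq_def hform_def axis_def)
  have "hsq (c *s axis 3 1) = hsq (axis 3 1)"
    using U21_hsq[OF assms(1)] assms(2) by metis
  then have "(cmod c)\<^sup>2 = 1\<^sup>2" by (simp add: hsq_def axis_def norm_mult)
  then have "cmod c = 1" by (rule power2_eq_imp_eq) auto
  then have "cmod (hform w (axis 3 1)) = cmod (hform w (c *s axis 3 1))" for w
    by (simp add: hform_simps norm_mult)
  then have "cmod (hform (C *v v) (axis 3 1)) = cmod (hform v (axis 3 1))"
    by (metis U21_hform assms)
  then have "(norm (C *v v))\<^sup>2 = (norm v)\<^sup>2"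
    by (simp add: n U21_hsq assms)
  then show ?thesis by simp
qed

lemma matrix_axis_nth: "(C :: complex^3^3) $ i $ j = (C *v axis j 1) $ i"
  by (simp add: matrix_vector_mult_def axis_def if_distrib cong: if_cong)

text \<open>Point stabilizers are compact, so the powers of an element \<open>g\<close> of one accumulate. Then some quotients
\<open>g\<^sup>k\<close> of two of these powers with \<open>k > 0\<close> converge to the identity, and discreteness makes one of them
equal to it, against torsion-freeness.\<close>

lemma fixed_point_trivial:
  assumes "discrete_subgroup \<Gamma>" "torsion_free PU21 \<Gamma>" "g \<in> \<Gamma>" "p \<in> H2C" "act g p = p"
  shows "g = \<one>\<^bsub>PU21\<^esub>"
proof (rule ccontr)
  assume ne: "g \<noteq> \<one>\<^bsub>PU21\<^esub>"
  have sg: "subgroup \<Gamma> PU21" using assms(1) by (simp add: discrete_subgroup_iff)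
  then have gc: "g \<in> carrier PU21" using assms(3) subgroup.mem_carrier by metis
  then obtain A where A: "A \<in> carrier U21" "g = cls A" by (auto simp: carrier_PU21)
  obtain W where W: "openin PU21_topology W" "W \<inter> \<Gamma> = {\<one>\<^bsub>PU21\<^esub>}"
    using assms(1) by (auto simp: discrete_subgroup_iff)
  then obtain T where T: "open T" "{A \<in> carrier U21. cls A \<in> W} = carrier U21 \<inter> T"
    by (auto simp: openin_PU21 openin_open)
  have "mat 1 \<in> {A \<in> carrier U21. cls A \<in> W}" using W(2) U21_one_closed cls_one by auto
  then have T1: "mat 1 \<in> T" unfolding T(2) by blast
  obtain M c where M: "M \<in> carrier U21" "c \<noteq> 0" "M *v lift_pt p = c *s axis 3 1"
    using frame_exists[OF assms(4), of "axis 1 1"] by (metis axis_eq_0_iff one_neq_zero)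
  obtain M' where M': "M' \<in> carrier U21" "M' ** M = mat 1" "M ** M' = mat 1"
    using U21_invertible[OF M(1)] .
  define An where "An n = A [^]\<^bsub>U21\<^esub> (n::nat)" for n
  \<comment> \<open>Conjugating the powers by \<open>M\<close> turns them into unitary matrices.\<close>
  define Bn where "Bn n = M ** An n ** M'" for n
  have An: "An n \<in> carrier U21" "An (m + n) = An m ** An n" "cls (An n) = g [^]\<^bsub>PU21\<^esub> n" for m n
    using A by (auto simp: An_def cls_pow U21.nat_pow_mult[symmetric] U21_mult)
  have Bn: "Bn n \<in> carrier U21" "Bn (m + n) = Bn m ** Bn n" "An n = M' ** Bn n ** M" for m n
  proof -
    show "Bn n \<in> carrier U21" by (simp add: Bn_def U21_closed M M' An)
    have "Bn m ** Bn n = M ** An m ** (M' ** M) ** An n ** M'"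
      by (simp add: Bn_def matrix_mul_assoc)
    then show "Bn (m + n) = Bn m ** Bn n" by (simp add: M' Bn_def An matrix_mul_assoc)
    have "M' ** Bn n ** M = (M' ** M) ** An n ** (M' ** M)"
      by (simp add: Bn_def matrix_mul_assoc)
    then show "An n = M' ** Bn n ** M" by (simp add: M')
  qed
  have fixes_axis: "\<exists>d. Bn n *v axis 3 1 = d *s axis 3 1" for n
  proof -
    have "act (g [^]\<^bsub>PU21\<^esub> n) p = p"
      by (induction n) (auto simp: act_one act_mult gc assms)
    then have "mat_act (An n) p = p" by (metis An(1,3) act_cls)
    then obtain d where d: "An n *v lift_pt p = d *s lift_pt p"
      using lift_mat_act(2)[OF An(1) assms(4)] by metis
    have M'e: "M' *v axis 3 1 = (1/c) *s lift_pt p"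
    proof -
      have "M' *v (c *s axis 3 1) = lift_pt p"
        by (simp flip: M(3) add: matrix_vector_mul_assoc M')
      then have "c *s (M' *v axis 3 1) = lift_pt p" by (simp add: matrix_scale)
      then show ?thesis using M(2) by (auto simp: vec3_eq_iff field_simps)
    qed
    have "Bn n *v axis 3 1 = M *v (An n *v (M' *v axis 3 1))"
      by (simp add: Bn_def flip: matrix_vector_mul_assoc)
    also have "\<dots> = d *s axis 3 1"
      using M(2) by (simp add: M'e matrix_scale d M(3))
    finally show ?thesis by blast
  qed
  then have unit: "norm (Bn n *v v) = norm v" for n v
    using stabilizer_unitary Bn(1) by metis
  have "norm (Bn n) \<le> 9" for n
  proof -
    have "cmod (Bn n $ i $ j) \<le> 1" for i j
      unfolding matrix_axis_nth by (rule order_trans[OF Finite_Cartesian_Product.norm_nth_le]) (simp add: unit)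
    then have "norm (Bn n $ i) \<le> (\<Sum>j\<in>(UNIV::3 set). 1)" for i
      unfolding norm_vec_def[of "Bn n $ i"] by (intro order_trans[OF L2_set_le_sum] sum_mono) auto
    then have "norm (Bn n) \<le> (\<Sum>i\<in>(UNIV::3 set). 3)"
      unfolding norm_vec_def[of "Bn n"] by (intro order_trans[OF L2_set_le_sum] sum_mono) auto
    then show ?thesis by simp
  qed
  then have "bounded (range Bn)" by (auto simp: bounded_iff)
  then obtain C r where r: "strict_mono r" "(Bn \<circ> r) \<longlonglongrightarrow> C"
    using bounded_imp_convergent_subsequence by blast
  define k where "k n = r (Suc n) - r n" for n
  have k: "r (Suc n) = r n + k n" "0 < k n" for n
    using strict_monoD[OF r(1), of n "Suc n"] by (auto simp: k_def)
  have "(\<lambda>n. Bn (k n) $ i $ j) \<longlonglongrightarrow> mat 1 $ i $ j" for i j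
  proof -
    let ?e = "axis j 1 :: complex^3"
    have C1: "(\<lambda>n. Bn (r n)) \<longlonglongrightarrow> C" using r(2) by (simp add: o_def)
    have C2: "(\<lambda>n. Bn (r (Suc n))) \<longlonglongrightarrow> C" by (rule LIMSEQ_Suc[OF C1])
    have "(\<lambda>n. Bn (r (Suc n)) *v ?e - Bn (r n) *v ?e) \<longlonglongrightarrow> C *v ?e - C *v ?e"
      by (intro tendsto_intros tendsto_matrix_vector C1 C2)
    then have lim: "(\<lambda>n. norm (Bn (r (Suc n)) *v ?e - Bn (r n) *v ?e)) \<longlonglongrightarrow> 0"
      using tendsto_norm by fastforce
    have "cmod (Bn (k n) $ i $ j - mat 1 $ i $ j) \<le> norm (Bn (r (Suc n)) *v ?e - Bn (r n) *v ?e)" for n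
    proof -
      have "Bn (k n) $ i $ j - mat 1 $ i $ j = (Bn (k n) *v ?e - ?e) $ i"
        using matrix_axis_nth[of "mat 1" i j] by (simp add: matrix_axis_nth)
      also have "cmod \<dots> \<le> norm (Bn (k n) *v ?e - ?e)" by (rule Finite_Cartesian_Product.norm_nth_le)
      \<comment> \<open>Multiplying by a unitary matrix turns the quotient of two powers into their difference.\<close>
      also have "\<dots> = norm (Bn (r n) *v (Bn (k n) *v ?e - ?e))" by (simp add: unit)
      also have "Bn (r n) *v (Bn (k n) *v ?e - ?e) = Bn (r (Suc n)) *v ?e - Bn (r n) *v ?e"
        by (simp add: k Bn(2) matrix_vector_mult_diff_distrib matrix_vector_mul_assoc)
      finally show ?thesis .
    qed
    then show ?thesis
      by (intro Lim_transform_bound[OF _ lim, THEN LIM_zero_cancel] always_eventually) auto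
  qed
  then have "(\<lambda>n. Bn (k n)) \<longlonglongrightarrow> mat 1"
    by (intro vec_tendstoI)
  then have "(\<lambda>n. M' ** Bn (k n) ** M) \<longlonglongrightarrow> M' ** mat 1 ** M"
    by (intro tendsto_matrix_mult tendsto_const)
  then have "(\<lambda>n. An (k n)) \<longlonglongrightarrow> mat 1" by (simp add: M' flip: Bn(3))
  then have "eventually (\<lambda>n. An (k n) \<in> T) sequentially"
    using T(1) T1 by (rule topological_tendstoD)
  then obtain n where "An (k n) \<in> T"
    using eventually_happens by fastforce
  then have "cls (An (k n)) \<in> W" using T(2) An(1) by blast
  moreover have "g [^]\<^bsub>PU21\<^esub> k n \<in> \<Gamma>"
    using PU21.subgroup_int_pow_closed[OF sg assms(3), of "int (k n)"] by (simp add: int_pow_int)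
  ultimately have "g [^]\<^bsub>PU21\<^esub> k n = \<one>\<^bsub>PU21\<^esub>" using W(2) An(3) by auto
  then show False using assms(2,3) ne k(2) by (auto simp: torsion_free_def)
qed

section \<open>Frames adapted to a complex line\<close>

text \<open>Coordinates in which \<open>p\<close> is the centre of the ball and \<open>L\<close> is the first axis.\<close>

definition line_frame :: "complex^3^3 \<Rightarrow> (complex^2) set \<Rightarrow> complex^2 \<Rightarrow> bool" where
  "line_frame M L p \<longleftrightarrow> M \<in> carrier U21 \<and> p \<in> L \<and>
     (M *v lift_pt p)$1 = 0 \<and> (M *v lift_pt p)$2 = 0 \<and>
     L = {q \<in> H2C. (M *v lift_pt q)$2 = 0}"

lemma line_frame_exists:
  assumes "complex_line L" "p \<in> L"
  obtains M where "line_frame M L p"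
proof -
  obtain a u where u: "u \<noteq> 0" and L: "L = H2C \<inter> {a + z *s u | z. True}"
    using assms(1) by (auto simp: complex_line_def)
  obtain z0 where p: "p \<in> H2C" "p = a + z0 *s u" using assms(2) L by auto
  obtain M c d e where M: "M \<in> carrier U21" "c \<noteq> 0" "M *v lift_pt p = c *s axis 3 1"
    "d \<noteq> 0" "M *v vector [u$1, u$2, 0] = vector [d, 0, e]"
    using frame_exists[OF p(1) u] .
  obtain M' where M': "M' ** M = mat 1" using U21_invertible[OF M(1)] by metis
  have M'M: "M' *v (M *v v) = v" for v by (simp add: matrix_vector_mul_assoc M')
  have "q \<in> {a + z *s u | z. True} \<longleftrightarrow> (M *v lift_pt q)$2 = 0" for q
  proof
    assume "q \<in> {a + z *s u | z. True}"
    then obtain z where "q = a + z *s u" by auto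
    moreover obtain w where "z = w + z0" by (metis diff_add_cancel)
    ultimately have "lift_pt q = lift_pt p + w *s vector [u$1, u$2, 0]"
      by (simp add: p vec3_eq_iff algebra_simps)
    then show "(M *v lift_pt q)$2 = 0"
      by (simp add: matrix_vector_right_distrib matrix_scale M axis_def)
  next
    assume "(M *v lift_pt q)$2 = 0"
    then obtain z w where zw: "M *v lift_pt q = z *s vector [d, 0, e] + w *s (c *s axis 3 1)"
      using M(2,4) that[of "(M *v lift_pt q)$1 / d" "((M *v lift_pt q)$3 - (M *v lift_pt q)$1 / d * e) / c"]
      by (simp add: vec3_eq_iff axis_def)
    have "lift_pt q = z *s vector [u$1, u$2, 0] + w *s lift_pt p"
      using arg_cong[OF zw, of "\<lambda>v. M' *v v"] unfolding M(3,5)[symmetric]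
      by (simp add: M'M matrix_vector_right_distrib matrix_scale)
    then have "q$1 = z * u$1 + w * p$1" "q$2 = z * u$2 + w * p$2" "w = 1"
      unfolding vec3_eq_iff by simp_all
    moreover have "p$1 = a$1 + z0 * u$1" "p$2 = a$2 + z0 * u$2"
      unfolding p(2) by simp_all
    ultimately have "q = a + (z0 + z) *s u"
      unfolding vec2_eq_iff by (simp add: distrib_right)
    then show "q \<in> {a + z *s u | z. True}" by blast
  qed
  then have "L = {q \<in> H2C. (M *v lift_pt q)$2 = 0}" unfolding L by auto
  then have "line_frame M L p"
    using M(1) assms(2) by (simp add: line_frame_def M(3) axis_def)
  then show ?thesis ..
qed

lemma frame_third_nonzero: "line_frame M L p \<Longrightarrow> q \<in> H2C \<Longrightarrow> (M *v lift_pt q)$3 \<noteq> 0"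
  by (simp add: line_frame_def lift_mat_act(1))

lemma frame_point: "line_frame M L p \<Longrightarrow> p \<in> H2C \<and> L \<subseteq> H2C"
  by (auto simp: line_frame_def)

lemma frame_off_centre_point:
  assumes f: "line_frame M L p"
  obtains y k where "y \<in> L" "k \<noteq> 0" "M *v lift_pt y = k *s vector [1, 0, 2]"
proof -
  have M: "M \<in> carrier U21" and L: "L = {q \<in> H2C. (M *v lift_pt q)$2 = 0}"
    using f by (auto simp: line_frame_def)
  obtain M' where M': "M' \<in> carrier U21" "M ** M' = mat 1"
    using U21_invertible[OF M] by metis
  \<comment> \<open>Any vector in the plane of the line that is negative and has non-zero first coordinate would do.\<close>
  define v where "v = M' *v vector [1, 0, 2]"
  have Mv: "M *v v = vector [1, 0, 2]" by (simp add: v_def matrix_vector_mul_assoc M')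
  have hv: "hsq v < 0" using M' by (simp add: v_def U21_hsq) (simp add: hsq_def)
  have My: "M *v lift_pt (drop_pt v) = (1 / v$3) *s vector [1, 0, 2]"
    by (simp add: lift_drop hsq_neg_third hv matrix_scale Mv)
  then have "drop_pt v \<in> L" using drop_H2C[OF hv] by (simp add: L)
  then show ?thesis using that[OF _ _ My] hsq_neg_third[OF hv] by simp
qed

lemma tanh_cosh_sq: "(tanh x)\<^sup>2 * (cosh x)\<^sup>2 = (cosh x)\<^sup>2 - (1::real)"
  by (simp add: tanh_def sinh_square_eq power_divide)

lemma rho_less_iff:
  assumes "p \<in> H2C" "q \<in> H2C" "0 \<le> r"
  shows "rho p q < r \<longleftrightarrow> hratio (lift_pt p) (lift_pt q) < (cosh (r/2))\<^sup>2"
proof -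
  have "rho p q < r \<longleftrightarrow> cosh (rho p q / 2) < cosh (r/2)"
    using assms by (simp add: cosh_real_nonneg_less_iff rho_nonneg)
  also have "\<dots> \<longleftrightarrow> (cosh (rho p q / 2))\<^sup>2 < (cosh (r/2))\<^sup>2"
    using power2_less_imp_less[of "cosh (rho p q / 2)" "cosh (r/2)"]
      power_strict_mono[of "cosh (rho p q / 2)" "cosh (r/2)" 2] by auto
  finally show ?thesis using assms by (simp add: cosh_sq_rho)
qed

lemma hratio_frame:
  assumes "line_frame M L p" "q \<in> H2C"
  shows "hratio (lift_pt p) (lift_pt q) = (cmod ((M *v lift_pt q)$3))\<^sup>2 / - hsq (lift_pt q)"
proof -
  let ?P = "M *v lift_pt p"
  have M: "M \<in> carrier U21" "?P$1 = 0" "?P$2 = 0" and P: "?P$3 \<noteq> 0"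
    using assms frame_third_nonzero frame_point by (auto simp: line_frame_def)
  have "hratio (lift_pt p) (lift_pt q) = hratio ?P (M *v lift_pt q)"
    using M by (simp add: hratio_U21)
  also have "\<dots> = (cmod ((M *v lift_pt q)$3))\<^sup>2 / - hsq (M *v lift_pt q)"
    using M P by (simp add: hratio_def hform_def hsq_def[of ?P] norm_mult power_mult_distrib)
  finally show ?thesis using M by (simp add: U21_hsq)
qed

lemma hsq_frame:
  assumes "line_frame M L p"
  shows "hsq (lift_pt q) = (cmod ((M *v lift_pt q)$1))\<^sup>2 + (cmod ((M *v lift_pt q)$2))\<^sup>2
    - (cmod ((M *v lift_pt q)$3))\<^sup>2"
  using assms U21_hsq[of M "lift_pt q"] by (simp add: line_frame_def hsq_def[of "M *v _"])

lemma rho_frame_less_iff: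
  assumes f: "line_frame M L p" and x: "x \<in> L" and r: "0 < r"
  shows "rho p x < r \<longleftrightarrow> cmod ((M *v lift_pt x)$1) < tanh (r/2) * cmod ((M *v lift_pt x)$3)"
proof -
  define a b C where "a = (cmod ((M *v lift_pt x)$1))\<^sup>2" and "b = (cmod ((M *v lift_pt x)$3))\<^sup>2"
    and "C = (cosh (r/2))\<^sup>2"
  have xH: "x \<in> H2C" "(M *v lift_pt x)$2 = 0" using f x by (auto simp: line_frame_def)
  have h: "hsq (lift_pt x) = a - b" "a - b < 0"
    using hsq_frame[OF f, of x] xH by (auto simp: a_def b_def H2C_hsq)
  have "rho p x < r \<longleftrightarrow> b / (b - a) < C"
    using rho_less_iff[of p x r] hratio_frame[OF f xH(1)] frame_point[OF f] xH r
    by (simp add: h(1) C_def b_def)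
  also have "\<dots> \<longleftrightarrow> a * C < (C - 1) * b"
    using h(2) by (simp add: pos_divide_less_eq algebra_simps)
  also have "C - 1 = (tanh (r/2))\<^sup>2 * C"
    by (simp add: C_def tanh_cosh_sq)
  also have "a * C < (tanh (r/2))\<^sup>2 * C * b \<longleftrightarrow> a < (tanh (r/2))\<^sup>2 * b"
    using mult_less_cancel_right_pos[of C a "(tanh (r/2))\<^sup>2 * b"] by (simp add: C_def algebra_simps)
  also have "\<dots> \<longleftrightarrow> (cmod ((M *v lift_pt x)$1))\<^sup>2 < (tanh (r/2) * cmod ((M *v lift_pt x)$3))\<^sup>2"
    by (simp add: a_def b_def power_mult_distrib)
  also have "\<dots> \<longleftrightarrow> cmod ((M *v lift_pt x)$1) < tanh (r/2) * cmod ((M *v lift_pt x)$3)"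
    using r by (auto intro: power2_less_imp_less power_strict_mono)
  finally show ?thesis .
qed

section \<open>Tubes over discs in a complex line\<close>

text \<open>\<open>x\<close> is the orthogonal projection of \<open>q\<close> to \<open>L\<close>: some multiple of the lift of \<open>x\<close> differs from the lift of \<open>q\<close> by
a vector orthogonal to \<open>L\<close>. In this form the notion is visibly preserved by all isometries that
preserve \<open>L\<close>.\<close>

definition proj_to :: "(complex^2) set \<Rightarrow> complex^2 \<Rightarrow> complex^2 \<Rightarrow> bool" where
  "proj_to L q x \<longleftrightarrow> x \<in> L \<and>
     (\<exists>k. \<forall>y\<in>L. hform (lift_pt q) (lift_pt y) = k * hform (lift_pt x) (lift_pt y))"

definition tube :: "(complex^2) set \<Rightarrow> complex^2 \<Rightarrow> real \<Rightarrow> (complex^2) set" where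
  "tube L p r = {q \<in> H2C. \<exists>x. proj_to L q x \<and> rho p x < r}"

text \<open>In adapted coordinates the projection forgets the second coordinate: pairing with \<open>p\<close>
and with one more point of the line determines the other two up to a common factor.\<close>

lemma proj_to_frame:
  assumes f: "line_frame M L p" and q: "q \<in> H2C"
  shows "proj_to L q x \<longleftrightarrow> x \<in> L \<and> (\<exists>k. k \<noteq> 0 \<and>
    (M *v lift_pt q)$1 = k * (M *v lift_pt x)$1 \<and> (M *v lift_pt q)$3 = k * (M *v lift_pt x)$3)"
    (is "_ \<longleftrightarrow> _ \<and> ?R")
proof (cases "x \<in> L")
  case True
  define Q X where "Q = M *v lift_pt q" and "X = M *v lift_pt x"
  have M: "M \<in> carrier U21" and L: "L = {q \<in> H2C. (M *v lift_pt q)$2 = 0}"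
    using f by (auto simp: line_frame_def)
  have form: "hform (lift_pt z) (lift_pt y) =
      (M *v lift_pt z)$1 * cnj ((M *v lift_pt y)$1) - (M *v lift_pt z)$3 * cnj ((M *v lift_pt y)$3)"
    if "y \<in> L" for y z
    using that U21_hform[OF M, of "lift_pt z" "lift_pt y"] L by (simp add: hform_def[of "M *v _"])
  have "proj_to L q x \<longleftrightarrow> (\<exists>k. \<forall>y\<in>L. hform (lift_pt q) (lift_pt y) = k * hform (lift_pt x) (lift_pt y))"
    using True by (simp add: proj_to_def)
  also have "\<dots> \<longleftrightarrow> (\<exists>k. Q$1 = k * X$1 \<and> Q$3 = k * X$3)"
  proof
    assume "\<exists>k. \<forall>y\<in>L. hform (lift_pt q) (lift_pt y) = k * hform (lift_pt x) (lift_pt y)"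
    then obtain k where k: "\<And>y. y \<in> L \<Longrightarrow> hform (lift_pt q) (lift_pt y) = k * hform (lift_pt x) (lift_pt y)"
      by blast
    have 3: "Q$3 = k * X$3"
      using k[of p] form[of p] f frame_third_nonzero[OF f, of p] frame_point[OF f]
      by (auto simp: line_frame_def Q_def X_def)
    obtain y c where y: "y \<in> L" "c \<noteq> 0" "M *v lift_pt y = c *s vector [1, 0, 2]"
      using frame_off_centre_point[OF f] .
    then have "(Q$1 - k * X$1) * cnj c = (Q$3 - k * X$3) * cnj (2 * c)"
      using k[of y] by (simp add: form y(3) Q_def X_def algebra_simps)
    then have "Q$1 = k * X$1" using 3 y(2) by simp
    with 3 show "\<exists>k. Q$1 = k * X$1 \<and> Q$3 = k * X$3" by blast
  next
    assume "\<exists>k. Q$1 = k * X$1 \<and> Q$3 = k * X$3"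
    then obtain k where "Q$1 = k * X$1" "Q$3 = k * X$3" by blast
    then show "\<exists>k. \<forall>y\<in>L. hform (lift_pt q) (lift_pt y) = k * hform (lift_pt x) (lift_pt y)"
      by (auto intro!: exI[of _ k] simp: form algebra_simps Q_def X_def)
  qed
  also have "\<dots> \<longleftrightarrow> ?R"
    using frame_third_nonzero[OF f q] by (auto simp: Q_def X_def)
  finally show ?thesis using True by blast
qed (simp add: proj_to_def)

lemma proj_to_unique:
  assumes L: "complex_line L" and q: "q \<in> H2C" and x: "proj_to L q x" and y: "proj_to L q y"
  shows "x = y"
proof -
  have xL: "x \<in> L" "y \<in> L" using x y by (auto simp: proj_to_def)
  obtain M where f: "line_frame M L x" using line_frame_exists[OF L xL(1)] .
  obtain M' where M': "M' ** M = mat 1"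
    using U21_invertible f unfolding line_frame_def by metis
  have x2: "(M *v lift_pt x)$2 = 0" "(M *v lift_pt y)$2 = 0"
    using f xL by (auto simp: line_frame_def)
  obtain k l where "k \<noteq> 0" "(M *v lift_pt q)$1 = k * (M *v lift_pt x)$1"
      "(M *v lift_pt q)$3 = k * (M *v lift_pt x)$3"
    and "l \<noteq> 0" "(M *v lift_pt q)$1 = l * (M *v lift_pt y)$1"
      "(M *v lift_pt q)$3 = l * (M *v lift_pt y)$3"
    using x y proj_to_frame[OF f q] by metis
  then have kl: "k \<noteq> 0" "M *v (k *s lift_pt x) = M *v (l *s lift_pt y)" "l \<noteq> 0"
    using x2 by (simp_all add: matrix_scale vec3_eq_iff)
  then have "k *s lift_pt x = l *s lift_pt y"
    by (metis M' matrix_vector_mul_assoc matrix_vector_mul_lid)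
  then have "drop_pt (k *s lift_pt x) = drop_pt (l *s lift_pt y)" by simp
  then show ?thesis using kl by (simp add: drop_scale)
qed

lemma proj_to_act:
  assumes g: "g \<in> carrier PU21" "act g ` L = L" and L: "L \<subseteq> H2C" and q: "q \<in> H2C"
    and x: "proj_to L q x"
  shows "proj_to L (act g q) (act g x)"
proof -
  obtain A where A: "A \<in> carrier U21" "g = cls A" using g by (auto simp: carrier_PU21)
  define a where "a y = (A *v lift_pt y)$3" for y
  have a: "a y \<noteq> 0" "lift_pt (act g y) = (1 / a y) *s (A *v lift_pt y)" if "y \<in> H2C" for y
    using lift_mat_act[OF A(1) that] that by (auto simp: a_def A act_cls vec3_eq_iff)
  have form: "hform (lift_pt (act g z)) (lift_pt (act g y)) = hform (lift_pt z) (lift_pt y) / (a z * cnj (a y))"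
    if "z \<in> H2C" "y \<in> H2C" for y z
    using that by (simp add: a hform_simps U21_hform A(1))
  obtain k where k: "\<And>y. y \<in> L \<Longrightarrow> hform (lift_pt q) (lift_pt y) = k * hform (lift_pt x) (lift_pt y)"
    and xL: "x \<in> L" using x by (auto simp: proj_to_def)
  have "hform (lift_pt (act g q)) (lift_pt y) = (k * a x / a q) * hform (lift_pt (act g x)) (lift_pt y)"
    if "y \<in> L" for y
  proof -
    have "y \<in> act g ` L" using that g(2) by simp
    then obtain y' where y': "y' \<in> L" "y = act g y'" by (elim imageE)
    have xH: "x \<in> H2C" and yH: "y' \<in> H2C" using xL y'(1) L by auto
    show ?thesis
      unfolding y'(2) form[OF q yH] form[OF xH yH] k[OF y'(1)] using a(1)[OF xH] by simp
  qed
  moreover have "act g x \<in> L" using imageI[OF xL, of "act g"] g(2) by simp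
  ultimately show ?thesis unfolding proj_to_def by blast
qed

text \<open>The projection forgets the second coordinate, so a tube is described by the first and third alone.\<close>

lemma tube_frame:
  assumes f: "line_frame M L p" and r: "0 < r"
  shows "tube L p r =
    {q \<in> H2C. cmod ((M *v lift_pt q)$1) < tanh (r/2) * cmod ((M *v lift_pt q)$3)}"
proof -
  have "(\<exists>x. proj_to L q x \<and> rho p x < r) \<longleftrightarrow>
      cmod ((M *v lift_pt q)$1) < tanh (r/2) * cmod ((M *v lift_pt q)$3)" if q: "q \<in> H2C" for q
  proof
    assume "\<exists>x. proj_to L q x \<and> rho p x < r"
    then obtain x k where "x \<in> L" "rho p x < r" "k \<noteq> 0"
      "(M *v lift_pt q)$1 = k * (M *v lift_pt x)$1" "(M *v lift_pt q)$3 = k * (M *v lift_pt x)$3"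
      using proj_to_frame[OF f q] by metis
    then show "cmod ((M *v lift_pt q)$1) < tanh (r/2) * cmod ((M *v lift_pt q)$3)"
      using rho_frame_less_iff[OF f _ r, of x] by (simp add: norm_mult algebra_simps)
  next
    assume less: "cmod ((M *v lift_pt q)$1) < tanh (r/2) * cmod ((M *v lift_pt q)$3)"
    define Q where "Q = M *v lift_pt q"
    have M: "M \<in> carrier U21" and L: "L = {q \<in> H2C. (M *v lift_pt q)$2 = 0}"
      using f by (auto simp: line_frame_def)
    obtain M' where M': "M' \<in> carrier U21" "M ** M' = mat 1"
      using U21_invertible[OF M] by metis
    define v where "v = M' *v vector [Q$1, 0, Q$3]"
    have Mv: "M *v v = vector [Q$1, 0, Q$3]" by (simp add: v_def matrix_vector_mul_assoc M')
    have "hsq v = (cmod (Q$1))\<^sup>2 - (cmod (Q$3))\<^sup>2"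
      using U21_hsq[OF M, of v] by (simp add: Mv) (simp add: hsq_def)
    moreover have "hsq Q < 0" using q M by (simp add: Q_def U21_hsq H2C_hsq)
    ultimately have hv: "hsq v < 0" by (simp add: hsq_def) (smt (verit) zero_le_power2)
    have v3: "v$3 \<noteq> 0" using hsq_neg_third[OF hv] .
    have Mx: "M *v lift_pt (drop_pt v) = (1 / v$3) *s vector [Q$1, 0, Q$3]"
      by (simp add: lift_drop v3 matrix_scale Mv)
    have x: "drop_pt v \<in> L" using drop_H2C[OF hv] by (simp add: L Mx)
    then have "proj_to L q (drop_pt v)"
      using proj_to_frame[OF f q] v3 by (auto simp: Mx Q_def intro!: exI[of _ "v$3"])
    moreover have "rho p (drop_pt v) < r"
      unfolding rho_frame_less_iff[OF f x r] Mx
      using less v3 by (simp add: Q_def norm_mult norm_divide field_simps)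
    ultimately show "\<exists>x. proj_to L q x \<and> rho p x < r" by blast
  qed
  then show ?thesis by (auto simp: tube_def)
qed

lemma orb_act:
  assumes "subgroup \<Gamma> PU21" "g \<in> \<Gamma>" "x \<in> H2C"
  shows "orb \<Gamma> (act g x) = orb \<Gamma> x"
proof -
  interpret subgroup \<Gamma> PU21 by fact
  have 1: "act h (act g x) = act (h \<otimes>\<^bsub>PU21\<^esub> g) x" if "h \<in> \<Gamma>" for h
    using that assms by (simp add: act_mult)
  have 2: "act h x = act (h \<otimes>\<^bsub>PU21\<^esub> inv\<^bsub>PU21\<^esub> g) (act g x)" if "h \<in> \<Gamma>" for h
    using that assms by (simp add: act_mult act_inv act_H2C)
  show ?thesis
    unfolding orb_def
  proof (intro subset_antisym image_subsetI)
    show "act h (act g x) \<in> (\<lambda>g. act g x) ` \<Gamma>" if "h \<in> \<Gamma>" for h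
      unfolding 1[OF that] by (rule imageI) (use that assms in simp)
    show "act h x \<in> (\<lambda>h. act h (act g x)) ` \<Gamma>" if "h \<in> \<Gamma>" for h
      unfolding 2[OF that] by (rule imageI) (use that assms in simp)
  qed
qed

text \<open>If \<open>q\<close> and \<open>g q\<close> both lay in the tube, then their projections \<open>x\<close> and \<open>g x\<close> would be two points of the disc
in the same orbit, hence equal, and \<open>g\<close> would have a fixed point.\<close>

lemma tube_moved_off:
  assumes \<Gamma>: "C_Fuchsian \<Gamma> L" and inj: "inj_on (orb \<Gamma>) {q \<in> L. rho p q < r}"
    and g: "g \<in> \<Gamma>" "g \<noteq> \<one>\<^bsub>PU21\<^esub>" and q: "q \<in> tube L p r"
  shows "act g q \<notin> tube L p r"
proof
  assume gq: "act g q \<in> tube L p r"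
  have d: "discrete_subgroup \<Gamma>" "torsion_free PU21 \<Gamma>" and L: "complex_line L" "act g ` L = L"
    using \<Gamma> g by (auto simp: C_Fuchsian_def)
  have sg: "subgroup \<Gamma> PU21" using d by (simp add: discrete_subgroup_def)
  then have gc: "g \<in> carrier PU21" using g subgroup.mem_carrier by metis
  have LH: "L \<subseteq> H2C" using L(1) by (auto simp: complex_line_def)
  have qH: "q \<in> H2C" using q by (simp add: tube_def)
  obtain x where x: "proj_to L q x" "rho p x < r" using q by (auto simp: tube_def)
  obtain y where y: "proj_to L (act g q) y" "rho p y < r" using gq by (auto simp: tube_def)
  have "y = act g x"
    using proj_to_unique[OF L(1) act_H2C[OF gc qH] y(1) proj_to_act[OF gc L(2) LH qH x(1)]] .
  moreover have xL: "x \<in> L" "y \<in> L" using x y by (auto simp: proj_to_def)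
  ultimately have "orb \<Gamma> y = orb \<Gamma> x" using orb_act[OF sg g(1)] LH by auto
  then have "y = x" using inj xL x(2) y(2) by (simp add: inj_on_def)
  then have "act g x = x" using \<open>y = act g x\<close> by simp
  then show False using fixed_point_trivial[OF d g(1)] xL LH g(2) by blast
qed

section \<open>Geodesics from the centre of the ball\<close>

lemma norm_vec2: "(norm (x :: complex^2))\<^sup>2 = (cmod (x$1))\<^sup>2 + (cmod (x$2))\<^sup>2"
  by (simp add: norm_vec_def L2_set_def sum_2)

lemma H2C_norm: "x \<in> H2C \<longleftrightarrow> norm x < 1"
proof -
  have "x \<in> H2C \<longleftrightarrow> (norm x)\<^sup>2 < 1\<^sup>2" by (simp add: H2C_def norm_vec2)
  then show ?thesis
    using power2_less_imp_less[of "norm x" 1] power_strict_mono[of "norm x" 1 2] by auto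
qed

lemma hsq_lift: "hsq (lift_pt x) = (norm x)\<^sup>2 - 1"
  by (simp add: hsq_def norm_vec2)

lemma Re_hform_lift: "Re (hform (lift_pt x) (lift_pt y)) = x \<bullet> y - 1"
  by (simp add: hform_def inner_vec_def sum_2 inner_complex_def)

lemma cmod_hform_lift_ge:
  "1 - x \<bullet> y \<le> cmod (hform (lift_pt x) (lift_pt y))"
  using complex_Re_le_cmod[of "- hform (lift_pt x) (lift_pt y)"] by (simp add: Re_hform_lift)

lemma rho_eqI:
  assumes "p \<in> H2C" "q \<in> H2C" "0 \<le> d" "hratio (lift_pt p) (lift_pt q) = (cosh (d/2))\<^sup>2"
  shows "rho p q = d"
  using assms cosh_real_nonneg[of "d/2"]
  by (simp add: rho_hratio arcosh_cosh_real)

lemma zero_H2C: "0 \<in> H2C" by (simp add: H2C_norm)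

lemma hratio_zero: "norm x < 1 \<Longrightarrow> hratio (lift_pt 0) (lift_pt x) = 1 / (1 - (norm x)\<^sup>2)"
  by (simp add: hratio_def hsq_lift hform_def divide_simps)

lemma cosh_half_sq: "(cosh (x::real))\<^sup>2 * (1 - (tanh x)\<^sup>2) = 1"
  using tanh_cosh_sq[of x] by (simp add: algebra_simps)

lemma norm_tanh_rho:
  assumes "x \<in> H2C"
  shows "norm x = tanh (rho 0 x / 2)"
proof -
  let ?C = "(cosh (rho 0 x / 2))\<^sup>2"
  have n: "norm x < 1" using assms by (simp add: H2C_norm)
  then have "(norm x)\<^sup>2 < 1" by (simp add: power_less_one_iff abs_square_less_1)
  moreover have "?C = 1 / (1 - (norm x)\<^sup>2)"
    using cosh_sq_rho[OF zero_H2C assms] n by (simp add: hratio_zero)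
  ultimately have "?C * (1 - (norm x)\<^sup>2) = 1" by simp
  then have "?C * (1 - (norm x)\<^sup>2) = ?C * (1 - (tanh (rho 0 x / 2))\<^sup>2)"
    unfolding cosh_half_sq .
  moreover have "?C \<noteq> 0" by simp
  ultimately have "1 - (norm x)\<^sup>2 = 1 - (tanh (rho 0 x / 2))\<^sup>2" using mult_left_cancel by blast
  then have "(norm x)\<^sup>2 = (tanh (rho 0 x / 2))\<^sup>2" by simp
  then show ?thesis
    using rho_nonneg[OF zero_H2C assms] by (simp add: power2_eq_iff_nonneg)
qed

lemma cosh_diff_tanh: "cosh (a - b) = cosh a * cosh b * (1 - tanh a * tanh (b::real))"
  by (simp add: cosh_diff tanh_def algebra_simps)

lemma hratio_tanh:
  assumes "norm x = tanh a" "norm y = tanh b"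
  shows "hratio (lift_pt x) (lift_pt y) = (cmod (hform (lift_pt x) (lift_pt y)) * cosh a * cosh b)\<^sup>2"
proof -
  have "hsq (lift_pt x) = - 1 / (cosh a)\<^sup>2" "hsq (lift_pt y) = - 1 / (cosh b)\<^sup>2"
    using cosh_half_sq[of a] cosh_half_sq[of b] assms by (simp_all add: hsq_lift field_simps)
  then show ?thesis by (simp add: hratio_def power_mult_distrib)
qed

text \<open>At the centre of the ball the form is the Hermitian product minus one, and the inequality is
Cauchy--Schwarz followed by the addition theorem for \<open>cosh\<close>.\<close>

lemma rho_triangle_zero:
  assumes "x \<in> H2C" "y \<in> H2C"
  shows "rho x y \<le> rho 0 x + rho 0 y"
proof -
  let ?a = "rho 0 x / 2" and ?b = "rho 0 y / 2"
  note n = norm_tanh_rho[OF assms(1)] norm_tanh_rho[OF assms(2)]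
  let ?z = "x$1 * cnj (y$1) + x$2 * cnj (y$2)"
  have "cmod ?z \<le> cmod (x$1) * cmod (y$1) + cmod (x$2) * cmod (y$2)"
    by (metis norm_triangle_ineq norm_mult complex_mod_cnj)
  also have "\<dots> \<le> norm x * norm y"
  proof (rule power2_le_imp_le)
    show "(cmod (x$1) * cmod (y$1) + cmod (x$2) * cmod (y$2))\<^sup>2 \<le> (norm x * norm y)\<^sup>2"
      using zero_le_power2[of "cmod (x$1) * cmod (y$2) - cmod (x$2) * cmod (y$1)"]
      unfolding power_mult_distrib[of "norm x"] norm_vec2 by (simp add: power2_eq_square algebra_simps)
  qed simp
  finally have "cmod (hform (lift_pt x) (lift_pt y)) \<le> 1 + tanh ?a * tanh ?b"
    using norm_triangle_ineq4[of ?z 1] by (simp add: hform_def n)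
  then have "cmod (hform (lift_pt x) (lift_pt y)) * (cosh ?a * cosh ?b) \<le> (1 + tanh ?a * tanh ?b) * (cosh ?a * cosh ?b)"
    by (rule mult_right_mono) simp
  also have "\<dots> = cosh (?a + ?b)"
    by (simp add: cosh_add tanh_def algebra_simps)
  finally have "(cmod (hform (lift_pt x) (lift_pt y)) * cosh ?a * cosh ?b)\<^sup>2 \<le> (cosh (?a + ?b))\<^sup>2"
    by (intro power_mono) (simp_all add: mult.assoc)
  then have "(cosh (rho x y / 2))\<^sup>2 \<le> (cosh (?a + ?b))\<^sup>2"
    by (simp add: cosh_sq_rho assms hratio_tanh[OF n])
  then have "cosh (rho x y / 2) \<le> cosh (?a + ?b)"
    by (rule power2_le_imp_le) simp
  then show ?thesis
    using rho_nonneg[OF assms] rho_nonneg[OF zero_H2C] assms by (simp add: cosh_real_nonneg_le_iff)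
qed

lemma move_to_zero:
  assumes "p \<in> H2C"
  obtains M M' c where "M \<in> carrier U21" "M' \<in> carrier U21" "M' ** M = mat 1" "M ** M' = mat 1"
    "c \<noteq> 0" "M *v lift_pt p = c *s axis 3 1" "mat_act M p = 0" "mat_act M' 0 = p"
proof -
  obtain M c where M: "M \<in> carrier U21" "c \<noteq> 0" "M *v lift_pt p = c *s axis 3 1"
    using frame_exists[OF assms, of "axis 1 1"] by (metis axis_eq_0_iff one_neq_zero)
  obtain M' where M': "M' \<in> carrier U21" "M' ** M = mat 1" "M ** M' = mat 1"
    using U21_invertible[OF M(1)] .
  have 0: "mat_act M p = 0" by (simp add: mat_act_drop M vec2_eq_iff axis_def)
  then have "mat_act M' 0 = p" using mat_act_mult[OF M'(1) M(1) assms] by (simp add: M')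
  then show ?thesis using that M M' 0 by blast
qed

lemma rho_triangle:
  assumes "p \<in> H2C" "q \<in> H2C" "r \<in> H2C"
  shows "rho q r \<le> rho p q + rho p r"
proof -
  obtain M where M: "M \<in> carrier U21" "mat_act M p = 0"
    using move_to_zero[OF assms(1)] by metis
  show ?thesis
    using rho_triangle_zero[OF mat_act_H2C[OF M(1) assms(2)] mat_act_H2C[OF M(1) assms(3)]]
      mat_act_rho[OF M(1)] assms M(2) by metis
qed

text \<open>Radial segments are geodesics, and every point can be moved to the centre.\<close>

lemma geodesic_exists:
  assumes "p \<in> H2C" "q \<in> H2C"
  obtains \<gamma> :: "real \<Rightarrow> complex^2" where "continuous_on {0..1} \<gamma>" "\<gamma> ` {0..1} \<subseteq> H2C"
    "\<gamma> 0 = p" "\<gamma> 1 = q" "\<And>t. t \<in> {0..1} \<Longrightarrow> rho p (\<gamma> t) + rho (\<gamma> t) q = rho p q"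
proof -
  obtain M M' where M: "M \<in> carrier U21" "M' \<in> carrier U21" "M' ** M = mat 1"
    "mat_act M p = 0" "mat_act M' 0 = p"
    using move_to_zero[OF assms(1)] by metis
  define w where "w = mat_act M q"
  have w: "w \<in> H2C" "mat_act M' w = q"
    using mat_act_H2C M assms mat_act_mult[OF M(2,1) assms(2)] by (auto simp: w_def)
  have tw: "t *\<^sub>R w \<in> H2C" if "t \<in> {0..1}" for t
    using that w(1) mult_left_le_one_le[of "norm w" t] by (simp add: H2C_norm)
  let ?\<gamma> = "\<lambda>t. mat_act M' (t *\<^sub>R w)"
  show ?thesis
  proof
    show "continuous_on {0..1} ?\<gamma>"
      unfolding continuous_on_def
      by (intro ballI tendsto_mat_act tendsto_intros M tw)
    show "?\<gamma> ` {0..1} \<subseteq> H2C" using mat_act_H2C[OF M(2)] tw by blast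
    show "?\<gamma> 0 = p" "?\<gamma> 1 = q" by (simp_all add: M w)
    fix t :: real assume t: "t \<in> {0..1}"
    let ?a = "rho 0 (t *\<^sub>R w) / 2" and ?b = "rho 0 w / 2"
    note n = norm_tanh_rho[OF tw[OF t]] norm_tanh_rho[OF w(1)]
    have "norm (t *\<^sub>R w) \<le> norm w" using t mult_left_le_one_le[of "norm w" t] by simp
    then have ab: "?a \<le> ?b" unfolding n by simp
    have "hform (lift_pt (t *\<^sub>R w)) (lift_pt w) = complex_of_real (t * (norm w)\<^sup>2 - 1)"
      by (simp add: hform_def norm_vec2 scaleR_conv_of_real[where 'a=complex] algebra_simps
          complex_norm_square[symmetric] flip: of_real_power)
    also have "t * (norm w)\<^sup>2 = norm (t *\<^sub>R w) * norm w"
      using t by (simp add: power2_eq_square)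
    finally have h: "hform (lift_pt (t *\<^sub>R w)) (lift_pt w) = complex_of_real (tanh ?a * tanh ?b - 1)"
      by (simp only: n)
    have "tanh ?a * tanh ?b \<le> 1 * 1"
      using rho_nonneg[OF zero_H2C w(1)] rho_nonneg[OF zero_H2C tw[OF t]]
      by (intro mult_mono) (auto simp: less_imp_le tanh_real_lt_1)
    then have "cmod (hform (lift_pt (t *\<^sub>R w)) (lift_pt w)) = 1 - tanh ?a * tanh ?b"
      unfolding h norm_of_real by simp
    then have "hratio (lift_pt (t *\<^sub>R w)) (lift_pt w) = (cosh (?b - ?a))\<^sup>2"
      by (simp add: hratio_tanh[OF n] cosh_diff_tanh mult_ac)
    then have "rho (t *\<^sub>R w) w = 2 * (?b - ?a)"
      using ab by (intro rho_eqI tw t w) auto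
    then have "rho 0 (t *\<^sub>R w) + rho (t *\<^sub>R w) w = rho 0 w" by simp
    then show "rho p (?\<gamma> t) + rho (?\<gamma> t) q = rho p q"
      using mat_act_rho[OF M(2) zero_H2C tw[OF t]] mat_act_rho[OF M(2) tw[OF t] w(1)]
        mat_act_rho[OF M(2) zero_H2C w(1)] by (simp add: M w)
  qed
qed

text \<open>The equality case of the triangle inequality forces equality in Cauchy--Schwarz. So the geodesic
from the centre to \<open>y\<close> is unique and radial.\<close>

lemma between_zero:
  assumes "x \<in> H2C" "y \<in> H2C" "0 < rho 0 y" "rho 0 x + rho x y = rho 0 y"
  shows "x = (tanh (rho 0 x / 2) / tanh (rho 0 y / 2)) *\<^sub>R y"
proof -
  let ?a = "rho 0 x / 2" and ?b = "rho 0 y / 2"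
  note n = norm_tanh_rho[OF assms(1)] norm_tanh_rho[OF assms(2)]
  have "(cosh (?b - ?a))\<^sup>2 = (cmod (hform (lift_pt x) (lift_pt y)) * cosh ?a * cosh ?b)\<^sup>2"
  proof -
    have "?b - ?a = rho x y / 2" using assms(4) by simp
    then show ?thesis by (simp only: cosh_sq_rho[OF assms(1,2)] hratio_tanh[OF n])
  qed
  then have "cosh (?b - ?a) = cmod (hform (lift_pt x) (lift_pt y)) * cosh ?a * cosh ?b"
    by (rule power2_eq_imp_eq) auto
  then have "cmod (hform (lift_pt x) (lift_pt y)) = 1 - tanh ?a * tanh ?b"
    by (simp add: cosh_diff_tanh mult.commute)
  then have "norm x * norm y \<le> x \<bullet> y"
    using cmod_hform_lift_ge[of x y] by (simp add: n)
  then have "norm x * norm y = x \<bullet> y" using norm_cauchy_schwarz[of x y] by simp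
  then have "norm x *\<^sub>R y = norm y *\<^sub>R x" by (metis norm_cauchy_schwarz_eq)
  then have "tanh ?a *\<^sub>R y = tanh ?b *\<^sub>R x" by (simp add: n)
  then have "(1 / tanh ?b) *\<^sub>R (tanh ?a *\<^sub>R y) = (1 / tanh ?b) *\<^sub>R (tanh ?b *\<^sub>R x)" by simp
  then show ?thesis using assms(3) by simp
qed

section \<open>Perpendicularity\<close>

text \<open>Up to the factor \<open>hform P P\<close>, the Hermitian product of the components of \<open>V\<close> and \<open>W\<close> orthogonal to \<open>P\<close>;
its real part is the Riemannian metric at \<open>P\<close> (\<open>riem_hperp\<close>).\<close>

definition hperp :: "complex^3 \<Rightarrow> complex^3 \<Rightarrow> complex^3 \<Rightarrow> complex" where
  "hperp P V W = hform V W * hform P P - hform V P * hform P W"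

lemma hperp_add: "hperp P (U + V) W = hperp P U W + hperp P V W"
  and hperp_scale: "hperp P (c *s V) W = c * hperp P V W"
  and hperp_self: "hperp P P W = 0"
  and hperp_diff_right: "hperp P V (W - X) = hperp P V W - hperp P V X"
  and hperp_scale_right: "hperp P V (c *s W) = cnj c * hperp P V W"
  and hperp_self_right: "hperp P V P = 0"
  by (simp_all add: hperp_def hform_simps algebra_simps)

lemma hperp_U21: "A \<in> carrier U21 \<Longrightarrow> hperp (A *v P) (A *v V) (A *v W) = hperp P V W"
  by (simp add: hperp_def U21_hform)

definition pad :: "complex^2 \<Rightarrow> complex^3" where
  "pad v = vector [v$1, v$2, 0]"

lemma pad_nth [simp]: "pad v $ 1 = v$1" "pad v $ 2 = v$2" "pad v $ 3 = 0"
  by (simp_all add: pad_def)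

lemma tendsto_hform:
  "(f \<longlongrightarrow> v) F \<Longrightarrow> (g \<longlongrightarrow> w) F \<Longrightarrow> ((\<lambda>x. hform (f x) (g x)) \<longlongrightarrow> hform v w) F"
  unfolding hform_def by (intro tendsto_intros)

lemma tendsto_pad:
  assumes "(f \<longlongrightarrow> v) F"
  shows "((\<lambda>x. pad (f x)) \<longlongrightarrow> pad v) F"
proof (rule vec_tendstoI)
  show "((\<lambda>x. pad (f x) $ i) \<longlongrightarrow> pad v $ i) F" for i
    using exhaust_3[of i] by (elim disjE; simp; intro tendsto_intros assms)
qed

lemma riem_hperp: "riem p v w = - 4 * Re (hperp (lift_pt p) (pad v) (pad w)) / (hsq (lift_pt p))\<^sup>2"
proof -
  have "(hform (lift_pt p) (lift_pt p))\<^sup>2 = complex_of_real ((hsq (lift_pt p))\<^sup>2)"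
    by (simp add: hform_self)
  then show ?thesis
    unfolding riem_def Let_def hperp_def pad_def by (simp del: of_real_power)
qed

text \<open>The initial velocity of the geodesic points towards its end point, because a geodesic from the
centre of the ball is radial. Hence a line perpendicular to the velocity is perpendicular to the
direction of the end point. Real orthogonality to a complex line becomes Hermitian orthogonality
after multiplying tangent vectors by \<open>\<i>\<close>.\<close>

lemma perpendicular_hperp:
  assumes geo: "geodesic_segment c l" and perp: "perpendicular_at c l 0 L" and L: "c 0 \<in> L" "q \<in> L"
  shows "hperp (lift_pt (c 0)) (lift_pt (c l)) (lift_pt q) = 0"
proof -
  have l: "0 < l" and cH: "\<And>s. s \<in> {0..l} \<Longrightarrow> c s \<in> H2C"
    and dist: "\<And>s t. s \<in> {0..l} \<Longrightarrow> t \<in> {0..l} \<Longrightarrow> rho (c s) (c t) = \<bar>s - t\<bar>"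
    using geo by (auto simp: geodesic_segment_def)
  define P W where "P = lift_pt (c 0)" and "W = lift_pt q"
  obtain v where v: "(c has_vector_derivative v) (at 0 within {0..l})"
    and perp0: "\<And>w. w \<in> line_tangent L (c 0) \<Longrightarrow> riem (c 0) v w = 0"
    using perp by (auto simp: perpendicular_at_def)
  have hP: "hsq P \<noteq> 0" using cH[of 0] l by (simp add: P_def H2C_hsq)
  have Re0: "Re (cnj z * hperp P (pad v) W) = 0" for z
  proof -
    have "pad (z *s (q - c 0)) = z *s (W - P)" by (simp add: vec3_eq_iff W_def P_def)
    moreover have "z *s (q - c 0) \<in> line_tangent L (c 0)"
      using L by (auto simp: line_tangent_def)
    ultimately show ?thesis
      using perp0[of "z *s (q - c 0)"] hP
      by (simp add: riem_hperp P_def[symmetric] hperp_scale_right hperp_diff_right hperp_self_right)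
  qed
  have V0: "hperp P (pad v) W = 0"
    using Re0[of 1] Re0[of \<i>] by (simp add: complex_eq_iff)
  have "((\<lambda>s. ((c s - c 0) - (s - 0) *\<^sub>R v) /\<^sub>R norm (s - 0)) \<longlongrightarrow> 0) (at 0 within {0..l})"
    using v unfolding has_vector_derivative_def has_derivative_at_within by blast
  moreover have "\<forall>\<^sub>F s in at 0 within {0..l}.
      ((c s - c 0) - (s - 0) *\<^sub>R v) /\<^sub>R norm (s - 0) = (c s - c 0) /\<^sub>R s - v"
    unfolding eventually_at_filter
    by (intro always_eventually allI impI) (simp add: scaleR_diff_right)
  ultimately have "((\<lambda>s. (c s - c 0) /\<^sub>R s - v) \<longlongrightarrow> 0) (at 0 within {0..l})"
    by (rule Lim_transform_eventually)
  then have "((\<lambda>s. (c s - c 0) /\<^sub>R s) \<longlongrightarrow> v) (at 0 within {0..l})"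
    by (rule LIM_zero_cancel)
  then have lim1: "((\<lambda>s. hperp P (pad ((c s - c 0) /\<^sub>R s)) W) \<longlongrightarrow> 0) (at 0 within {0..l})"
    unfolding V0[symmetric] hperp_def by (intro tendsto_intros tendsto_hform tendsto_pad)
  obtain M k where M: "M \<in> carrier U21" "k \<noteq> 0" "M *v lift_pt (c 0) = k *s axis 3 1" "mat_act M (c 0) = 0"
    using move_to_zero[OF cH[of 0]] l by (metis atLeastAtMost_iff less_imp_le order_refl)
  define Z where "Z s = (M *v lift_pt (c s))$3" for s
  define b where "b = hperp P (lift_pt (c l)) W"
  define \<tau> where "\<tau> s = tanh (s/2) / tanh (l/2)" for s
  have Z: "Z s \<noteq> 0" "M *v lift_pt (c s) = Z s *s lift_pt (mat_act M (c s))" if "s \<in> {0..l}" for s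
    using lift_mat_act[OF M(1) cH[OF that]] by (simp_all add: Z_def)
  \<comment> \<open>Moving \<open>c 0\<close> to the centre makes the geodesic radial, with \<open>\<tau> s\<close> the ratio of Euclidean radii.\<close>
  have eq: "hperp P (lift_pt (c s)) W = Z s * \<tau> s / Z l * b" if s: "s \<in> {0..l}" for s
  proof -
    let ?x = "mat_act M (c s)" and ?y = "mat_act M (c l)"
    have l': "l \<in> {0..l}" "0 \<in> {0..l}" using l by auto
    have d: "rho 0 ?x = s" "rho 0 ?y = l" "rho ?x ?y = l - s"
      using mat_act_rho[OF M(1)] cH s l' dist M(4) by (metis abs_of_nonneg abs_minus_commute diff_zero atLeastAtMost_iff diff_ge_0_iff_ge)+
    have "?x = \<tau> s *\<^sub>R ?y"
      using between_zero[of ?x ?y] mat_act_H2C[OF M(1)] cH s l' l d by (simp add: \<tau>_def)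
    then have "lift_pt ?x = of_real (\<tau> s) *s lift_pt ?y + ((1 - of_real (\<tau> s)) / k) *s (M *v P)"
      unfolding P_def M(3) using M(2) by (simp add: vec3_eq_iff axis_def) (simp add: scaleR_conv_of_real)
    then have *: "hperp (M *v P) (lift_pt ?x) (M *v W) = of_real (\<tau> s) * hperp (M *v P) (lift_pt ?y) (M *v W)"
      by (simp only: hperp_add hperp_scale hperp_self mult_zero_right add_0_right)
    have "hperp P (lift_pt (c s)) W = Z s * hperp (M *v P) (lift_pt ?x) (M *v W)"
      using hperp_U21[OF M(1), of P "lift_pt (c s)" W] by (simp add: Z(2)[OF s] hperp_scale)
    moreover have "b = Z l * hperp (M *v P) (lift_pt ?y) (M *v W)"
      using hperp_U21[OF M(1), of P "lift_pt (c l)" W] by (simp add: Z(2)[OF l'(1)] hperp_scale b_def)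
    ultimately show ?thesis using * Z(1)[OF l'(1)] by simp
  qed
  have "(c \<longlongrightarrow> c 0) (at 0 within {0..l})"
    using has_vector_derivative_continuous[OF v] by (simp add: continuous_within)
  then have limZ: "(Z \<longlongrightarrow> Z 0) (at 0 within {0..l})"
    unfolding Z_def by (intro tendsto_vec_nth tendsto_matrix_vector tendsto_lift_pt tendsto_const)
  have "((\<lambda>s. tanh (s/2)) has_real_derivative (1/2)) (at 0 within {0..l})"
    by (auto intro!: derivative_eq_intros)
  then have limt: "((\<lambda>s. tanh (s/2) / s) \<longlongrightarrow> 1/2) (at 0 within {0..l})"
    by (simp add: has_field_derivative_iff)
  have "((\<lambda>s. Z s * of_real (tanh (s/2) / s / tanh (l/2)) / Z l * b) \<longlongrightarrow>
      Z 0 * of_real ((1/2) / tanh (l/2)) / Z l * b) (at 0 within {0..l})"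
    using Z(1)[of l] l by (intro tendsto_intros limZ limt) auto
  moreover have "\<forall>\<^sub>F s in at 0 within {0..l}. Z s * of_real (tanh (s/2) / s / tanh (l/2)) / Z l * b =
      hperp P (pad ((c s - c 0) /\<^sub>R s)) W"
    unfolding eventually_at_filter
  proof (intro always_eventually allI impI)
    fix s :: real assume s: "s \<noteq> 0" "s \<in> {0..l}"
    have "lift_pt (c s) = of_real s *s pad ((c s - c 0) /\<^sub>R s) + P"
      using s by (simp add: vec3_eq_iff P_def scaleR_conv_of_real[where 'a=complex] field_simps)
    then have "hperp P (lift_pt (c s)) W = of_real s * hperp P (pad ((c s - c 0) /\<^sub>R s)) W"
      by (simp add: hperp_add hperp_scale hperp_self)
    then have "hperp P (pad ((c s - c 0) /\<^sub>R s)) W = Z s * \<tau> s / Z l * b / of_real s"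
      using s eq[of s] by (metis nonzero_mult_div_cancel_left of_real_eq_0_iff)
    then show "Z s * of_real (tanh (s/2) / s / tanh (l/2)) / Z l * b = hperp P (pad ((c s - c 0) /\<^sub>R s)) W"
      by (simp add: \<tau>_def)
  qed
  ultimately have lim2: "((\<lambda>s. hperp P (pad ((c s - c 0) /\<^sub>R s)) W) \<longlongrightarrow>
      Z 0 * of_real ((1/2) / tanh (l/2)) / Z l * b) (at 0 within {0..l})"
    by (rule Lim_transform_eventually)
  have "at (0::real) within {0..l} \<noteq> bot"
    using l by (simp add: at_within_Icc_at_right)
  then have "Z 0 * of_real ((1/2) / tanh (l/2)) / Z l * b = 0"
    using tendsto_unique lim1 lim2 by blast
  then have "b = 0" using Z(1)[of 0] Z(1)[of l] l by simp
  then show ?thesis by (simp add: b_def P_def W_def)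
qed

section \<open>Projection to the common orthogonal line\<close>

text \<open>The frame of a line together with the unit vector \<open>e\<close> polar to the complex line through \<open>p\<close> orthogonal
to \<open>L\<close>, called the spine. In these coordinates the spine is the second axis.\<close>

definition adapted :: "complex^3^3 \<Rightarrow> (complex^2) set \<Rightarrow> complex^2 \<Rightarrow> complex^3 \<Rightarrow> bool" where
  "adapted M L p e \<longleftrightarrow> line_frame M L p \<and> hform e e = 1 \<and> (M *v e)$2 = 0 \<and> (M *v e)$3 = 0"

text \<open>Subtracting the component along the polar vector \<open>e\<close> projects orthogonally to the spine.\<close>

definition spine_vec :: "complex^3 \<Rightarrow> complex^2 \<Rightarrow> complex^3" where
  "spine_vec e q = lift_pt q - hform (lift_pt q) e *s e"

definition spine_proj :: "complex^3 \<Rightarrow> complex^2 \<Rightarrow> complex^2" where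
  "spine_proj e q = drop_pt (spine_vec e q)"

lemma hsq_spine_vec:
  assumes "hform e e = 1"
  shows "hsq (spine_vec e q) = hsq (lift_pt q) - (cmod (hform (lift_pt q) e))\<^sup>2"
proof -
  have "hform (spine_vec e q) (spine_vec e q) =
      hform (lift_pt q) (lift_pt q) - hform (lift_pt q) e * cnj (hform (lift_pt q) e)"
    using assms hform_commute[of e "lift_pt q"] by (simp add: spine_vec_def hform_simps)
  then have "complex_of_real (hsq (spine_vec e q)) =
      complex_of_real (hsq (lift_pt q) - (cmod (hform (lift_pt q) e))\<^sup>2)"
    unfolding hform_self by (simp add: complex_norm_square del: of_real_power)
  then show ?thesis using of_real_eq_iff by blast
qed

lemma spine_vec_negative: "hform e e = 1 \<Longrightarrow> q \<in> H2C \<Longrightarrow> hsq (spine_vec e q) < 0"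
  by (simp add: hsq_spine_vec H2C_hsq) (smt (verit) zero_le_power2)

lemma spine_proj_H2C: "hform e e = 1 \<Longrightarrow> q \<in> H2C \<Longrightarrow> spine_proj e q \<in> H2C"
  by (simp add: spine_proj_def drop_H2C spine_vec_negative)

lemma spine_vec_frame:
  assumes "adapted M L p e"
  shows "M *v spine_vec e q = vector [0, (M *v lift_pt q)$2, (M *v lift_pt q)$3]"
proof -
  define u where "u = (M *v e)$1"
  have M: "M \<in> carrier U21" using assms by (simp add: adapted_def line_frame_def)
  have Me: "(M *v e)$1 = u" "(M *v e)$2 = 0" "(M *v e)$3 = 0"
    using assms by (auto simp: adapted_def u_def)
  have "hform (M *v e) (M *v e) = 1" using assms M by (simp add: adapted_def U21_hform)
  then have u: "u * cnj u = 1" by (simp add: hform_def Me)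
  have "hform (lift_pt q) e = (M *v lift_pt q)$1 * cnj u"
    using U21_hform[OF M, of "lift_pt q" e] by (simp add: hform_def[of "M *v _"] Me)
  then have "M *v spine_vec e q = M *v lift_pt q - ((M *v lift_pt q)$1 * cnj u) *s (M *v e)"
    by (simp add: spine_vec_def matrix_vector_mult_diff_distrib matrix_scale)
  then show ?thesis
    using u by (simp add: vec3_eq_iff Me mult.assoc) (simp add: mult.commute)
qed

text \<open>The projection to the spine forgets the first coordinate.\<close>

lemma hratio_spine:
  assumes "adapted M L p e" "q \<in> H2C"
  shows "hratio (lift_pt p) (lift_pt (spine_proj e q)) =
    (cmod ((M *v lift_pt q)$3))\<^sup>2 / ((cmod ((M *v lift_pt q)$3))\<^sup>2 - (cmod ((M *v lift_pt q)$2))\<^sup>2)"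
    and "(cmod ((M *v lift_pt q)$2))\<^sup>2 < (cmod ((M *v lift_pt q)$3))\<^sup>2"
proof -
  let ?S = "spine_vec e q" and ?P = "M *v lift_pt p"
  have f: "line_frame M L p" and e: "hform e e = 1" using assms by (auto simp: adapted_def)
  have M: "M \<in> carrier U21" "?P$1 = 0" "?P$2 = 0" and P: "?P$3 \<noteq> 0"
    using f frame_third_nonzero[OF f] frame_point[OF f] by (auto simp: line_frame_def)
  have hS: "hsq ?S = (cmod ((M *v lift_pt q)$2))\<^sup>2 - (cmod ((M *v lift_pt q)$3))\<^sup>2"
    using U21_hsq[OF M(1), of ?S] by (simp add: spine_vec_frame[OF assms(1)]) (simp add: hsq_def)
  then show "(cmod ((M *v lift_pt q)$2))\<^sup>2 < (cmod ((M *v lift_pt q)$3))\<^sup>2"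
    using spine_vec_negative[OF e assms(2)] by simp
  have "hratio (lift_pt p) (lift_pt (spine_proj e q)) = hratio (lift_pt p) ?S"
    using hratio_drop[of "lift_pt p" ?S] spine_vec_negative[OF e assms(2)] frame_point[OF f]
    by (simp add: spine_proj_def H2C_hsq)
  also have "\<dots> = hratio ?P (M *v ?S)" using M by (simp add: hratio_U21)
  also have "\<dots> = (cmod ((M *v lift_pt q)$3))\<^sup>2 / - hsq (M *v ?S)"
    using M P by (simp add: hratio_def hform_def hsq_def[of ?P] norm_mult power_mult_distrib spine_vec_frame[OF assms(1)])
  finally show "hratio (lift_pt p) (lift_pt (spine_proj e q)) =
    (cmod ((M *v lift_pt q)$3))\<^sup>2 / ((cmod ((M *v lift_pt q)$3))\<^sup>2 - (cmod ((M *v lift_pt q)$2))\<^sup>2)"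
    using M by (simp add: U21_hsq hS)
qed

text \<open>The function \<open>s\<close> on positive reals. It is a decreasing involution.\<close>

definition s_real :: "real \<Rightarrow> real" where
  "s_real r = 2 * arsinh (1 / sinh (r / 2))"

lemma s_real_pos: "0 < r \<Longrightarrow> 0 < s_real r"
  by (simp add: s_real_def)

lemma s_real_involution: "s_real (s_real r) = r"
  by (simp add: s_real_def arsinh_sinh_real)

lemma s_real_antimono: "0 < a \<Longrightarrow> a < b \<Longrightarrow> s_real b < s_real a"
  by (simp add: s_real_def arsinh_real_strict_mono divide_simps)

text \<open>Off the tube the first coordinate is large, at least \<open>tanh (r/2)\<close>. In the unit ball this leaves less
than \<open>1 / cosh (r/2) = tanh (s_real r / 2)\<close> for the second, and the point at Euclidean distance \<open>tanh (d/2)\<close>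
from the centre on the second axis is at distance \<open>d\<close> from \<open>p\<close>.\<close>

lemma outside_tube_height:
  assumes ad: "adapted M L p e" and r: "0 < r" and q: "q \<in> H2C" "q \<notin> tube L p r"
  shows "rho p (spine_proj e q) < s_real r"
proof -
  define a b c C where "a = (cmod ((M *v lift_pt q)$1))\<^sup>2" and "b = (cmod ((M *v lift_pt q)$2))\<^sup>2"
    and "c = (cmod ((M *v lift_pt q)$3))\<^sup>2" and "C = (cosh (r/2))\<^sup>2"
  have f: "line_frame M L p" and e: "hform e e = 1" using ad by (auto simp: adapted_def)
  have "tanh (r/2) * cmod ((M *v lift_pt q)$3) \<le> cmod ((M *v lift_pt q)$1)"
    using q by (simp add: tube_frame[OF f r])
  then have "(tanh (r/2) * cmod ((M *v lift_pt q)$3))\<^sup>2 \<le> (cmod ((M *v lift_pt q)$1))\<^sup>2"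
    using r by (intro power_mono) auto
  then have "(tanh (r/2))\<^sup>2 * c \<le> a"
    by (simp add: power_mult_distrib a_def c_def)
  then have "(tanh (r/2))\<^sup>2 * C * c \<le> a * C"
    using mult_right_mono[of "(tanh (r/2))\<^sup>2 * c" a C] by (simp add: C_def mult_ac)
  then have 1: "(C - 1) * c \<le> a * C" by (simp add: C_def tanh_cosh_sq)
  have "a + b < c"
    using hsq_frame[OF f, of q] q(1) by (simp add: H2C_hsq a_def b_def c_def)
  then have "(a + b) * C < c * C" by (simp add: C_def)
  with 1 have 2: "b * C < c" by (simp add: algebra_simps)
  have sinh: "sinh (r/2) \<noteq> 0" using r by simp
  have "(cosh (s_real r / 2))\<^sup>2 = (1 / sinh (r/2))\<^sup>2 + 1"
    by (simp add: s_real_def cosh_square_eq)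
  also have "\<dots> = C / (C - 1)"
    using sinh by (simp add: C_def cosh_square_eq power_divide field_simps)
  finally have s: "(cosh (s_real r / 2))\<^sup>2 = C / (C - 1)" .
  have C1: "C > 1" using sinh by (simp add: C_def cosh_square_eq)
  have bc: "b < c" using hratio_spine(2)[OF ad q(1)] by (simp add: b_def c_def)
  have "c / (c - b) < C / (C - 1)"
    using 2 C1 bc by (simp add: divide_simps algebra_simps)
  then show ?thesis
    using rho_less_iff[of p "spine_proj e q" "s_real r"] hratio_spine(1)[OF ad q(1)] s
      frame_point[OF f] spine_proj_H2C[OF e q(1)] s_real_pos[OF r]
    by (simp add: b_def c_def)
qed

lemma spine_proj_on_line:
  assumes ad: "adapted M L p e" and x: "x \<in> L"
  shows "spine_proj e x = p"
proof -
  have f: "line_frame M L p" and e: "hform e e = 1" using ad by (auto simp: adapted_def)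
  obtain M' where M': "M' ** M = mat 1"
    using U21_invertible f unfolding line_frame_def by metis
  have xH: "x \<in> H2C" "p \<in> H2C" using frame_point[OF f] x by auto
  let ?P = "M *v lift_pt p" and ?X = "M *v lift_pt x"
  have z: "?P$1 = 0" "?P$2 = 0" "?P$3 \<noteq> 0" "?X$2 = 0" "?X$3 \<noteq> 0"
    using f x frame_third_nonzero[OF f] xH by (auto simp: line_frame_def)
  have "M *v spine_vec e x = (?X$3 / ?P$3) *s ?P"
    using z by (simp add: spine_vec_frame[OF ad] vec3_eq_iff)
  also have "\<dots> = M *v ((?X$3 / ?P$3) *s lift_pt p)" by (simp add: matrix_scale)
  finally have "spine_vec e x = (?X$3 / ?P$3) *s lift_pt p"
    by (metis M' matrix_vector_mul_assoc matrix_vector_mul_lid)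
  then show ?thesis using z by (simp add: spine_proj_def drop_scale)
qed

text \<open>Projection to the spine does not increase distances, and \<open>x\<close> projects to \<open>p\<close>. The estimate goes through
the projection of \<open>q\<close> to \<open>L\<close>: in the plane of \<open>L\<close> it is the reversed Cauchy--Schwarz inequality.\<close>

lemma height_le_rho:
  assumes ad: "adapted M L p e" and x: "x \<in> L" and q: "q \<in> H2C"
  shows "rho p (spine_proj e q) \<le> rho x q"
proof -
  have f: "line_frame M L p" and e: "hform e e = 1" using ad by (auto simp: adapted_def)
  have M: "M \<in> carrier U21" using f by (simp add: line_frame_def)
  define X Q where "X = M *v lift_pt x" and "Q = M *v lift_pt q"
  define x1 x3 q1 q2 q3 where "x1 = cmod (X$1)" and "x3 = cmod (X$3)"
    and "q1 = cmod (Q$1)" and "q2 = cmod (Q$2)" and "q3 = cmod (Q$3)"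
  have xH: "x \<in> H2C" "p \<in> H2C" using frame_point[OF f] x by auto
  have X2: "X$2 = 0" using f x by (auto simp: line_frame_def X_def)
  have "hsq X < 0" "hsq Q < 0" using xH q M by (simp_all add: X_def Q_def U21_hsq H2C_hsq)
  then have hx: "hsq X = x1\<^sup>2 - x3\<^sup>2" "hsq X < 0" and hq: "hsq Q = q1\<^sup>2 + q2\<^sup>2 - q3\<^sup>2" "hsq Q < 0"
    using X2 by (simp_all add: x1_def x3_def q1_def q2_def q3_def hsq_def[of X] hsq_def[of Q])
  have "x3 * q3 - x1 * q1 \<le> cmod (hform X Q)"
    using norm_triangle_ineq2[of "X$3 * cnj (Q$3)" "X$1 * cnj (Q$1)"] X2
    by (simp add: hform_def norm_mult x1_def x3_def q1_def q3_def norm_minus_commute)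
  moreover have lt: "x1 < x3" "q1 < q3"
  proof -
    have "x1\<^sup>2 < x3\<^sup>2" "q1\<^sup>2 < q3\<^sup>2" using hx hq zero_le_power2[of q2] by linarith+
    then show "x1 < x3" "q1 < q3"
      by (auto intro: power2_less_imp_less simp: x3_def q3_def)
  qed
  moreover have "x1 * q1 \<le> x3 * q3"
    using lt by (intro mult_mono) (auto simp: x1_def x3_def q1_def q3_def)
  ultimately have "(x3 * q3 - x1 * q1)\<^sup>2 \<le> (cmod (hform X Q))\<^sup>2"
    by (intro power_mono) auto
  moreover have "(x3\<^sup>2 - x1\<^sup>2) * (q3\<^sup>2 - q1\<^sup>2) \<le> (x3 * q3 - x1 * q1)\<^sup>2"
    using zero_le_power2[of "x3 * q1 - x1 * q3"] by (simp add: power2_eq_square algebra_simps)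
  ultimately have 1: "(x3\<^sup>2 - x1\<^sup>2) * (q3\<^sup>2 - q1\<^sup>2) \<le> (cmod (hform X Q))\<^sup>2" by linarith
  have "q3\<^sup>2 / (q3\<^sup>2 - q2\<^sup>2) \<le> (q3\<^sup>2 - q1\<^sup>2) / (q3\<^sup>2 - q1\<^sup>2 - q2\<^sup>2)"
  proof -
    have "q3\<^sup>2 * (q3\<^sup>2 - q1\<^sup>2 - q2\<^sup>2) \<le> (q3\<^sup>2 - q1\<^sup>2) * (q3\<^sup>2 - q2\<^sup>2)"
      by (simp add: algebra_simps)
    moreover have "0 < q3\<^sup>2 - q1\<^sup>2 - q2\<^sup>2" "0 < q3\<^sup>2 - q2\<^sup>2"
      using hq zero_le_power2[of q1] by linarith+
    ultimately show ?thesis by (simp add: frac_le_eq divide_simps)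
  qed
  also have "\<dots> = (x3\<^sup>2 - x1\<^sup>2) * (q3\<^sup>2 - q1\<^sup>2) / (hsq X * hsq Q)"
    using hx hq by (simp add: divide_simps) (simp add: algebra_simps)
  also have "\<dots> \<le> hratio X Q"
    unfolding hratio_def using hx(2) hq(2) 1 by (intro divide_right_mono) (auto simp: mult_nonpos_nonpos)
  also have "\<dots> = hratio (lift_pt x) (lift_pt q)" using M by (simp add: X_def Q_def hratio_U21)
  finally have "hratio (lift_pt p) (lift_pt (spine_proj e q)) \<le> hratio (lift_pt x) (lift_pt q)"
    by (simp add: hratio_spine(1)[OF ad q] q2_def q3_def Q_def)
  then show ?thesis
    using rho_mono_hratio[OF xH(2) spine_proj_H2C[OF e q] xH(1) q] by simp
qed

lemma continuous_on_rho:
  assumes "continuous_on S f" "f ` S \<subseteq> H2C" "p \<in> H2C"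
  shows "continuous_on S (\<lambda>x. rho p (f x))"
proof -
  have "continuous_on S (\<lambda>x. hratio (lift_pt p) (lift_pt (f x)))"
    unfolding hratio_def hsq_def hform_def lift_pt_nth
    using assms by (intro continuous_intros) (auto simp: H2C_def image_subset_iff)
  then have "continuous_on S (\<lambda>x. sqrt (hratio (lift_pt p) (lift_pt (f x))))"
    by (rule continuous_on_real_sqrt)
  then have "continuous_on S (\<lambda>x. arcosh (sqrt (hratio (lift_pt p) (lift_pt (f x)))))"
    by (rule continuous_on_compose2[OF continuous_on_arcosh[OF order_refl]])
      (use assms(2) hratio_ge1[OF assms(3)] in \<open>auto simp: image_subset_iff\<close>)
  then show ?thesis
    unfolding rho_hratio by (rule continuous_on_mult[OF continuous_on_const])
qed

lemma continuous_on_spine_proj: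
  assumes "hform e e = 1"
  shows "continuous_on H2C (spine_proj e)"
  unfolding continuous_on_def spine_proj_def
proof (intro ballI tendsto_drop_pt)
  fix x assume "x \<in> H2C"
  then show "spine_vec e x $ 3 \<noteq> 0"
    using hsq_neg_third spine_vec_negative assms by blast
  show "(spine_vec e \<longlongrightarrow> spine_vec e x) (at x within H2C)"
  proof (rule vec_tendstoI)
    have "((\<lambda>q. hform (lift_pt q) e) \<longlongrightarrow> hform (lift_pt x) e) (at x within H2C)"
      by (intro tendsto_hform tendsto_lift_pt tendsto_intros)
    then show "((\<lambda>q. spine_vec e q $ i) \<longlongrightarrow> spine_vec e x $ i) (at x within H2C)" for i
      unfolding spine_vec_def vector_minus_component vector_smult_component
      by (intro tendsto_intros tendsto_vec_nth tendsto_lift_pt) auto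
  qed
qed

text \<open>Perpendicularity at either end says that the other end point lies on the spine of the line at this
end. Both spines contain the two distinct end points, so they coincide and have the same polar vector.\<close>

lemma common_spine:
  assumes L1: "complex_line L1" and L2: "complex_line L2" and disj: "L1 \<inter> L2 = {}"
    and og: "orthogeodesic L1 L2 c l"
  obtains M N e where "adapted M L1 (c 0) e" "adapted N L2 (c l) e" "rho (c 0) (c l) = l"
proof -
  have geo: "geodesic_segment c l" and p: "c 0 \<in> L1" "c l \<in> L2"
    and perp: "perpendicular_at c l 0 L1" "perpendicular_at c l l L2"
    using og by (auto simp: orthogeodesic_def)
  have l: "0 < l" using geo by (simp add: geodesic_segment_def)
  have dist: "rho (c 0) (c l) = l"
    using geo l by (auto simp: geodesic_segment_def)
  define c' where "c' s = c (l - s)" for s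
  have geo': "geodesic_segment c' l"
    using geo by (auto simp: geodesic_segment_def c'_def)
  have perp': "perpendicular_at c' l 0 L2"
  proof -
    obtain v where v: "(c has_vector_derivative v) (at l within {0..l})"
      "\<And>w. w \<in> line_tangent L2 (c l) \<Longrightarrow> riem (c l) v w = 0"
      using perp(2) by (auto simp: perpendicular_at_def)
    have "((\<lambda>s. l - s) has_vector_derivative -1) (at 0 within {0..l})"
      by (auto intro!: derivative_eq_intros)
    moreover have "(\<lambda>s. l - s) ` {0..l} = {0..l}"
      by (auto simp: image_def intro!: bexI[of _ "l - _"])
    ultimately have "((c \<circ> (\<lambda>s. l - s)) has_vector_derivative (-1) *\<^sub>R v) (at 0 within {0..l})"
      using v(1) by (intro vector_diff_chain_within) auto
    then have "(c' has_vector_derivative - v) (at 0 within {0..l})"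
      by (simp add: o_def c'_def[abs_def])
    moreover have "riem (c' 0) (- v) w = 0" if "w \<in> line_tangent L2 (c' 0)" for w
    proof -
      have "hperp P (pad (- v)) W = - hperp P (pad v) W" for P W
        by (simp add: hperp_def hform_def algebra_simps)
      then have "riem (c l) (-v) w = - riem (c l) v w"
        by (simp add: riem_hperp)
      then show ?thesis using v(2) that by (simp add: c'_def)
    qed
    ultimately show ?thesis by (auto simp: perpendicular_at_def)
  qed
  define P Q where "P = lift_pt (c 0)" and "Q = lift_pt (c l)"
  have h1: "hperp P Q (lift_pt q) = 0" if "q \<in> L1" for q
    using perpendicular_hperp[OF geo perp(1) p(1) that] by (simp add: P_def Q_def)
  have h2: "hperp Q P (lift_pt q) = 0" if "q \<in> L2" for q
    using perpendicular_hperp[OF geo' perp' _ that] p(2) by (simp add: P_def Q_def c'_def)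
  \<comment> \<open>Orthogonality to all directions of \<open>L\<close> at \<open>p\<close> kills the first coordinate.\<close>
  have key: "(M *v R)$1 = 0"
    if f: "line_frame M L p" and h: "\<And>q. q \<in> L \<Longrightarrow> hperp (lift_pt p) R (lift_pt q) = 0" for M L p R
  proof -
    have M: "M \<in> carrier U21" and P: "(M *v lift_pt p)$1 = 0" "(M *v lift_pt p)$2 = 0"
      using f by (auto simp: line_frame_def)
    obtain y k where y: "y \<in> L" "k \<noteq> 0" "M *v lift_pt y = k *s vector [1, 0, 2]"
      using frame_off_centre_point[OF f] .
    have "hperp (M *v lift_pt p) (M *v R) (M *v lift_pt y) = 0"
      using h[OF y(1)] M by (simp add: hperp_U21)
    then have "hperp (M *v lift_pt p) (M *v R) (vector [1, 0, 2]) = 0"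
      using y(2) by (simp add: y(3) hperp_scale_right)
    moreover have "(M *v lift_pt p)$3 \<noteq> 0"
      using frame_third_nonzero[OF f] frame_point[OF f] by blast
    ultimately show ?thesis using P by (simp add: hperp_def hform_def algebra_simps)
  qed
  obtain M where f1: "line_frame M L1 (c 0)" using line_frame_exists[OF L1 p(1)] .
  obtain N where f2: "line_frame N L2 (c l)" using line_frame_exists[OF L2 p(2)] .
  have M: "M \<in> carrier U21" and N: "N \<in> carrier U21" using f1 f2 by (auto simp: line_frame_def)
  obtain M' where M': "M' \<in> carrier U21" "M ** M' = mat 1"
    using U21_invertible[OF M] by metis
  define e where "e = M' *v axis 1 1"
  have Me: "M *v e = axis 1 1" by (simp add: e_def matrix_vector_mul_assoc M')
  have ee: "hform e e = 1" using M' by (simp add: e_def U21_hform) (simp add: hform_def axis_def)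
  have MQ: "(M *v Q)$1 = 0" using key[OF f1] h1 by (simp add: P_def)
  have NP: "(N *v P)$1 = 0" using key[OF f2] h2 by (simp add: Q_def)
  have "hform (axis 1 1) v = cnj (v$1)" for v
    by (simp add: hform_def axis_def)
  then have "hform e v = cnj ((M *v v)$1)" for v
    using U21_hform[OF M, of e v] by (simp add: Me)
  then have "hform e Q = 0" "hform e P = 0"
    using MQ f1 by (simp_all add: line_frame_def P_def)
  then have "hform (N *v e) (N *v Q) = 0" "hform (N *v e) (N *v P) = 0"
    using N by (simp_all add: U21_hform)
  moreover have NQ: "(N *v Q)$1 = 0" "(N *v Q)$2 = 0" "(N *v Q)$3 \<noteq> 0"
    using f2 frame_third_nonzero[OF f2] frame_point[OF f2] by (auto simp: line_frame_def Q_def)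
  moreover have "(N *v P)$2 \<noteq> 0"
    using f2 frame_point[OF f1] p(1) disj by (auto simp: line_frame_def P_def)
  ultimately have "(N *v e)$3 = 0" "(N *v e)$2 = 0"
    using NP by (auto simp: hform_def)
  then have "adapted N L2 (c l) e" using f2 ee by (simp add: adapted_def)
  moreover have "adapted M L1 (c 0) e" using f1 ee by (simp add: adapted_def Me axis_def)
  ultimately show ?thesis using that dist by blast
qed

section \<open>Ping-pong for two groups\<close>

lemma fp_words_Cons:
  "a # w \<in> fp_words G H \<longleftrightarrow> a \<in> fp_letters G H \<and> w \<in> fp_words G H \<and> (w = [] \<or> isl a \<noteq> isl (hd w))"
  by (cases w) (auto simp: fp_words_def)

lemma fp_words_snoc:
  "w @ [a] \<in> fp_words G H \<longleftrightarrow> w \<in> fp_words G H \<and> a \<in> fp_letters G H \<and> (w = [] \<or> isl (last w) \<noteq> isl a)"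
  by (auto simp: fp_words_def successively_append_iff)

text \<open>The complements of \<open>V\<close> and \<open>W\<close> are disjoint because \<open>V\<close> and \<open>W\<close> cover \<open>H\<close>. Non-trivial elements of \<open>A\<close> send \<open>V\<close>, and
with it the complement of \<open>W\<close>, to the complement of \<open>V\<close>; those of \<open>B\<close> do the same with \<open>V\<close> and \<open>W\<close> exchanged.\<close>

locale ping_pong = group G for G (structure) +
  fixes A B :: "'a set" and H :: "'x set" and \<phi> :: "'a \<Rightarrow> 'x \<Rightarrow> 'x" and V W :: "'x set"
  assumes A: "subgroup A G" and B: "subgroup B G"
    and \<phi>_mult: "\<And>g h x. g \<in> carrier G \<Longrightarrow> h \<in> carrier G \<Longrightarrow> x \<in> H \<Longrightarrow> \<phi> (g \<otimes> h) x = \<phi> g (\<phi> h x)"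
    and \<phi>_one: "\<And>x. x \<in> H \<Longrightarrow> \<phi> \<one> x = x"
    and \<phi>_closed: "\<And>g x. g \<in> carrier G \<Longrightarrow> x \<in> H \<Longrightarrow> \<phi> g x \<in> H"
    and V: "V \<subseteq> H" and W: "W \<subseteq> H" and cover: "H \<subseteq> V \<union> W"
    and A_moves: "\<And>a x. a \<in> A \<Longrightarrow> a \<noteq> \<one> \<Longrightarrow> x \<in> V \<Longrightarrow> \<phi> a x \<notin> V"
    and B_moves: "\<And>b x. b \<in> B \<Longrightarrow> b \<noteq> \<one> \<Longrightarrow> x \<in> W \<Longrightarrow> \<phi> b x \<notin> W"
begin

abbreviation FP where "FP \<equiv> free_product (G\<lparr>carrier := A\<rparr>) (G\<lparr>carrier := B\<rparr>)"
abbreviation words where "words \<equiv> fp_words (G\<lparr>carrier := A\<rparr>) (G\<lparr>carrier := B\<rparr>)"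
abbreviation letters where "letters \<equiv> fp_letters (G\<lparr>carrier := A\<rparr>) (G\<lparr>carrier := B\<rparr>)"
abbreviation val :: "'a + 'a \<Rightarrow> 'a" where "val \<equiv> case_sum id id"

text \<open>Both are indexed by \<open>isl\<close> of a letter, so that the two kinds of letters are treated uniformly.\<close>

definition factor :: "bool \<Rightarrow> 'a set" where "factor s = (if s then A else B)"
definition region :: "bool \<Rightarrow> 'x set" where "region s = (if s then V else W)"

lemma letter_iff: "a \<in> letters \<longleftrightarrow> val a \<in> factor (isl a) \<and> val a \<noteq> \<one>"
  by (cases a) (auto simp: fp_letters_def factor_def)

lemma factor_subgroup: "subgroup (factor s) G"
  using A B by (simp add: factor_def)

lemma factor_closed: "a \<in> factor s \<Longrightarrow> a \<in> carrier G"
  using factor_subgroup subgroup.mem_carrier by metis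

lemma eval_Nil [simp]: "fp_eval G [] = \<one>"
  and eval_Cons [simp]: "fp_eval G (a # w) = val a \<otimes> fp_eval G w"
  by (simp_all add: fp_eval_def)

lemma eval_closed: "set w \<subseteq> letters \<Longrightarrow> fp_eval G w \<in> carrier G"
  by (induction w) (auto simp: letter_iff factor_closed)

lemma eval_words_closed: "w \<in> words \<Longrightarrow> fp_eval G w \<in> carrier G"
  by (auto simp: fp_words_def eval_closed)

lemma eval_snoc: "set w \<subseteq> letters \<Longrightarrow> a \<in> letters \<Longrightarrow> fp_eval G (w @ [a]) = fp_eval G w \<otimes> val a"
  by (induction w) (auto simp: letter_iff factor_closed eval_closed m_assoc)

lemma letter_moves:
  assumes "a \<in> letters" "x \<in> region (isl a)"
  shows "\<phi> (val a) x \<in> H - region (isl a)"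
proof -
  have a: "val a \<in> factor (isl a)" "val a \<noteq> \<one>" using assms letter_iff by auto
  have "x \<in> H" using assms(2) V W by (auto simp: region_def split: if_splits)
  then show ?thesis
    using assms(2) a A_moves[of "val a" x] B_moves[of "val a" x] \<phi>_closed[of "val a" x] factor_closed[OF a(1)]
    by (auto simp: region_def factor_def split: if_splits)
qed

text \<open>The suffixes of the word send the point alternately to the complements of \<open>V\<close> and \<open>W\<close>, each of which is
contained in the region that the next letter moves.\<close>

lemma word_moves:
  assumes "w \<in> words" "w \<noteq> []" "x \<in> region (isl (last w))"
  shows "\<phi> (fp_eval G w) x \<in> H - region (isl (hd w))"
  using assms
proof (induction w)
  case (Cons a w)
  have xH: "x \<in> H" using Cons.prems(3) V W by (auto simp: region_def split: if_splits)
  have a: "a \<in> letters" "val a \<in> carrier G" and w: "w \<in> words" "w = [] \<or> isl a \<noteq> isl (hd w)"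
    using Cons.prems letter_iff factor_closed by (auto simp: fp_words_Cons)
  let ?y = "\<phi> (fp_eval G w) x"
  have "?y \<in> region (isl a)"
  proof (cases "w = []")
    case True
    then show ?thesis using Cons.prems(3) xH by (simp add: \<phi>_one)
  next
    case False
    then have "?y \<in> H - region (isl (hd w))" using Cons w by simp
    then show ?thesis using w(2) False cover by (auto simp: region_def)
  qed
  then show ?case
    using letter_moves[OF a(1)] a(2) eval_words_closed[OF w(1)] xH by (simp add: \<phi>_mult)
qed simp

lemma nontrivial_word_moves:
  assumes "w \<in> words" "w \<noteq> []" "x \<in> V \<inter> W"
  shows "\<phi> (fp_eval G w) x \<notin> V \<inter> W"
proof -
  have "x \<in> region s" for s using assms(3) by (simp add: region_def)
  then have "\<phi> (fp_eval G w) x \<notin> region (isl (hd w))" using word_moves[OF assms(1,2)] by blast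
  then show ?thesis by (auto simp: region_def split: if_splits)
qed

lemma group_FP: "group FP"
  using group_free_product subgroup_imp_group A B by blast

lemma eval_fp_cons:
  assumes "a \<in> letters" "w \<in> words"
  shows "fp_eval G (fp_cons (G\<lparr>carrier := A\<rparr>) (G\<lparr>carrier := B\<rparr>) a w) = val a \<otimes> fp_eval G w"
proof (cases w)
  case (Cons b v)
  have b: "b \<in> letters" "v \<in> words" using assms(2) Cons by (auto simp: fp_words_Cons)
  have c: "val a \<in> carrier G" "val b \<in> carrier G" "fp_eval G v \<in> carrier G"
    using assms(1) b letter_iff factor_closed eval_words_closed by blast+
  show ?thesis
    using c unfolding Cons by (cases a; cases b) (auto simp flip: m_assoc)
qed (cases a; simp)

lemma eval_mult:
  assumes "u \<in> words" "v \<in> words"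
  shows "fp_eval G (u \<otimes>\<^bsub>FP\<^esub> v) = fp_eval G u \<otimes> fp_eval G v"
  using assms
proof (induction u)
  case Nil
  then show ?case by (simp add: free_product_def eval_words_closed)
next
  case (Cons a u)
  have a: "a \<in> letters" "u \<in> words" using Cons.prems by (auto simp: fp_words_Cons)
  have "u \<otimes>\<^bsub>FP\<^esub> v \<in> words"
    using monoid.m_closed[OF group.is_monoid[OF group_FP], of u v] a Cons.prems by (simp add: free_product_def)
  then have "fp_eval G ((a # u) \<otimes>\<^bsub>FP\<^esub> v) = val a \<otimes> fp_eval G (u \<otimes>\<^bsub>FP\<^esub> v)"
    using eval_fp_cons[OF a(1)] by (simp add: free_product_def)
  moreover have "val a \<in> carrier G" "fp_eval G u \<in> carrier G" "fp_eval G v \<in> carrier G"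
    using a Cons.prems eval_words_closed factor_closed letter_iff by blast+
  ultimately show ?case
    using Cons a by (simp add: m_assoc)
qed

lemma factors_closed: "A \<union> B \<subseteq> carrier G"
  using A B by (auto dest: subgroup.mem_carrier)

lemma eval_in_generate: "w \<in> words \<Longrightarrow> fp_eval G w \<in> generate G (A \<union> B)"
proof (induction w)
  case (Cons a w)
  then have "val a \<in> A \<union> B" "w \<in> words"
    by (auto simp: fp_words_Cons letter_iff factor_def split: if_splits)
  then show ?case using generate.eng[OF generate.incl Cons.IH] by simp
qed (simp add: generate.one)

lemma generate_eval: "g \<in> generate G (A \<union> B) \<Longrightarrow> \<exists>w\<in>words. fp_eval G w = g"
proof (induction rule: generate.induct)
  have single: "\<exists>w\<in>words. fp_eval G w = h" if "h \<in> A \<union> B" for h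
  proof (cases "h = \<one>")
    case True
    then show ?thesis by (intro bexI[of _ "[]"]) (auto simp: fp_words_def)
  next
    case False
    define a where "a = (if h \<in> A then Inl h else Inr h :: 'a + 'a)"
    have "a \<in> letters" "val a = h" using that False by (auto simp: a_def letter_iff factor_def)
    moreover have "h \<in> carrier G" using that factors_closed by blast
    ultimately show ?thesis by (intro bexI[of _ "[a]"]) (auto simp: fp_words_def)
  qed
  {
    case one
    show ?case by (intro bexI[of _ "[]"]) (auto simp: fp_words_def)
  next
    case (incl h)
    then show ?case by (rule single)
  next
    case (inv h)
    then have "inv h \<in> A \<union> B" using A B by (auto simp: subgroup.m_inv_closed)
    then show ?case by (rule single)
  next
    case (eng h1 h2)
    then obtain u v where "u \<in> words" "v \<in> words" "fp_eval G u = h1" "fp_eval G v = h2" by blast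
    then show ?case
      using eval_mult[of u v] monoid.m_closed[OF group.is_monoid[OF group_FP], of u v]
      by (intro bexI[of _ "u \<otimes>\<^bsub>FP\<^esub> v"]) (auto simp: free_product_def)
  }
qed

lemma free_product_generate:
  assumes x: "x \<in> V \<inter> W"
  shows "is_free_product_of G (generate G (A \<union> B)) A B"
proof -
  let ?K = "G\<lparr>carrier := generate G (A \<union> B)\<rparr>"
  have K: "group ?K"
    using generate_is_subgroup[OF factors_closed] subgroup_imp_group by blast
  have hom: "fp_eval G \<in> hom FP ?K"
    using eval_mult eval_in_generate by (auto simp: hom_def free_product_def)
  have gh: "group_hom FP ?K (fp_eval G)"
    using group_FP K hom by (simp add: group_hom_def group_hom_axioms_def)
  have "w = []" if w: "w \<in> words" "fp_eval G w = \<one>" for w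
  proof (rule ccontr)
    assume "w \<noteq> []"
    then have "\<phi> (fp_eval G w) x \<notin> V \<inter> W" using nontrivial_word_moves w(1) x by blast
    then show False using w(2) x V by (auto simp: \<phi>_one)
  qed
  then have "kernel FP ?K (fp_eval G) = {\<one>\<^bsub>FP\<^esub>}"
    by (auto simp: kernel_def free_product_def fp_words_def)
  then have "inj_on (fp_eval G) (carrier FP)"
    by (rule group_hom.trivial_ker_imp_inj[OF gh])
  moreover have "fp_eval G ` carrier FP = carrier ?K"
    using eval_in_generate generate_eval by (force simp: free_product_def)
  ultimately show ?thesis
    using hom by (simp add: is_free_product_of_def iso_def bij_betw_def)
qed

text \<open>Absorbing at most one letter at each end into the outer factors prescribes how the remaining word
begins and ends.\<close>

lemma strip_word:
  assumes g: "g \<in> generate G (A \<union> B)"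
  obtains a b w where "a \<in> factor s" "b \<in> factor t" "w \<in> words" "g = a \<otimes> fp_eval G w \<otimes> b"
    "w \<noteq> [] \<Longrightarrow> isl (hd w) \<noteq> s \<and> isl (last w) \<noteq> t"
proof -
  obtain w0 where w0: "w0 \<in> words" "fp_eval G w0 = g" using generate_eval[OF g] by blast
  have one: "\<one> \<in> factor r" for r using factor_subgroup subgroup.one_closed by metis
  obtain a w1 where w1: "a \<in> factor s" "w1 \<in> words" "g = a \<otimes> fp_eval G w1" "w1 \<noteq> [] \<Longrightarrow> isl (hd w1) \<noteq> s"
  proof (cases "w0 \<noteq> [] \<and> isl (hd w0) = s")
    case True
    then obtain c v where w: "w0 = c # v" "isl c = s" by (cases w0) auto
    then show ?thesis
      using that[of "val c" v] w0 by (auto simp: fp_words_Cons letter_iff)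
  next
    case False
    then show ?thesis using that[of \<one> w0] w0 eval_words_closed[OF w0(1)] one by auto
  qed
  have ac: "a \<in> carrier G" using w1(1) factor_closed by blast
  show ?thesis
  proof (cases "w1 \<noteq> [] \<and> isl (last w1) = t")
    case True
    then obtain c v where w: "w1 = v @ [c]" "isl c = t" by (cases w1 rule: rev_cases) auto
    then have v: "v \<in> words" "c \<in> letters" "v \<noteq> [] \<Longrightarrow> isl (last v) \<noteq> t"
      using w1(2) by (auto simp: fp_words_snoc)
    have c: "val c \<in> factor t" using v(2) w(2) by (auto simp: letter_iff)
    have "fp_eval G w1 = fp_eval G v \<otimes> val c"
      using v by (simp add: w(1) eval_snoc fp_words_def)
    then have "g = a \<otimes> fp_eval G v \<otimes> val c"
      using w1(3) ac eval_words_closed[OF v(1)] factor_closed[OF c] by (simp add: m_assoc)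
    moreover have "v \<noteq> [] \<Longrightarrow> isl (hd v) \<noteq> s" using w1(4) w(1) by auto
    ultimately show ?thesis using that[of a "val c" v] w1(1) c v by blast
  next
    case False
    have "g = a \<otimes> fp_eval G w1 \<otimes> \<one>" using w1(3) ac eval_words_closed[OF w1(2)] by simp
    then show ?thesis using that[of a \<one> w1] w1 False one by blast
  qed
qed

text \<open>Without its outer \<open>A\<close>-letters, the word of \<open>g\<close> begins and ends in \<open>B\<close>, or is empty and \<open>g \<in> A\<close>. In the first case
it sends \<open>L \<subseteq> W\<close> off \<open>W\<close>, and the removed letters preserve \<open>L\<close>.\<close>

lemma embedded_or_disjoint:
  assumes g: "g \<in> generate G (A \<union> B)" and L: "L \<subseteq> W" and stab: "\<And>a x. a \<in> A \<Longrightarrow> x \<in> L \<Longrightarrow> \<phi> a x \<in> L"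
    and ng: "g \<notin> A" and x: "x \<in> L"
  shows "\<phi> g x \<notin> L"
proof
  assume gx: "\<phi> g x \<in> L"
  obtain a b w where ab: "a \<in> A" "b \<in> A" "w \<in> words" "g = a \<otimes> fp_eval G w \<otimes> b"
    and hl: "w \<noteq> [] \<Longrightarrow> \<not> isl (hd w) \<and> \<not> isl (last w)"
    using strip_word[OF g, of True True] by (auto simp: factor_def)
  have c: "a \<in> carrier G" "b \<in> carrier G" "fp_eval G w \<in> carrier G"
    using A ab eval_words_closed subgroup.mem_carrier by metis+
  have ne: "w \<noteq> []"
    using ng ab A c by (auto simp: subgroup.m_closed)
  have bx: "\<phi> b x \<in> L" "\<phi> b x \<in> W" "\<phi> b x \<in> H" "x \<in> H" using stab[OF ab(2) x] L W x by auto
  have y: "\<phi> (fp_eval G w) (\<phi> b x) \<in> H - W"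
    using word_moves[OF ab(3) ne, of "\<phi> b x"] hl[OF ne] bx by (simp add: region_def)
  have "\<phi> (inv a) (\<phi> g x) = \<phi> (inv a \<otimes> (a \<otimes> (fp_eval G w \<otimes> b))) x"
    using c bx ab(4) by (simp add: \<phi>_mult[symmetric] m_assoc)
  also have "inv a \<otimes> (a \<otimes> (fp_eval G w \<otimes> b)) = fp_eval G w \<otimes> b"
    using c by (simp flip: m_assoc)
  also have "\<phi> \<dots> x = \<phi> (fp_eval G w) (\<phi> b x)" using c bx by (simp add: \<phi>_mult)
  finally have "\<phi> (fp_eval G w) (\<phi> b x) \<in> L"
    using stab[OF subgroup.m_inv_closed[OF A ab(1)] gx] by simp
  then show False using y L by blast
qed

end

section \<open>The injectivity radius\<close>

lemma s_fun_nonneg: "0 \<le> s_fun I"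
proof (cases I)
  case (real x)
  then show ?thesis using s_real_pos[of x]
    by (auto simp: s_fun_def simp flip: s_real_def intro: less_imp_le)
qed (auto simp: s_fun_def)

text \<open>As \<open>s\<close> is a decreasing involution, \<open>s(inj) < a\<close> means that the injectivity radius exceeds \<open>s(a)\<close>; take an
injective radius beyond \<open>s(a)\<close>.\<close>

lemma injective_disc:
  assumes "s_fun (inj_radius \<Gamma> L p) < ereal a"
  obtains r where "0 < r" "inj_on (orb \<Gamma>) {q \<in> L. rho p q < r}" "s_real r < a"
proof -
  let ?I = "inj_radius \<Gamma> L p"
  have "0 < ereal a" using s_fun_nonneg assms by (rule le_less_trans)
  then have a: "0 < a" by simp
  have "ereal (s_real a) < ?I"
  proof (cases ?I)
    case (real x)
    have x: "0 < x" and "s_real x < a"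
      using assms real by (auto simp: s_fun_def s_real_def split: if_splits)
    then have "s_real a < s_real (s_real x)"
      using s_real_antimono[of "s_real x" a] s_real_pos[OF x] by blast
    then show ?thesis by (simp add: s_real_involution real)
  next
    case MInf
    then show ?thesis using assms by (simp add: s_fun_def)
  qed simp
  then obtain r where r: "s_real a < r" "inj_on (orb \<Gamma>) {q \<in> L. rho p q < r}"
    unfolding inj_radius_def less_Sup_iff by auto
  have "s_real r < a"
    using s_real_antimono[OF s_real_pos[OF a] r(1)] by (simp add: s_real_involution)
  moreover have "0 < r" using s_real_pos[OF a] r(1) by (rule less_trans)
  ultimately show ?thesis using that r(2) by blast
qed

lemma ereal_sum_less_split:
  assumes "(x::ereal) + y < ereal d" "0 \<le> x" "0 \<le> y"
  obtains a b where "x < ereal a" "y < ereal b" "a + b = d"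
proof -
  obtain u v where uv: "x = ereal u" "y = ereal v"
    using assms by (cases x; cases y) auto
  then show ?thesis
    using assms(1) by (intro that[of "u + (d - u - v) / 2" "v + (d - u - v) / 2"]) (auto simp: field_simps)
qed

section \<open>Two tubes that cover the ball\<close>

lemma open_H2C: "open H2C"
proof -
  have "H2C = ball 0 1" by (auto simp: H2C_norm)
  then show ?thesis by (metis open_ball)
qed

lemma open_tube:
  assumes f: "line_frame M L p" and r: "0 < r"
  shows "open (tube L p r)"
proof -
  have c: "continuous_on UNIV (\<lambda>q. (M *v lift_pt q) $ i)" for i
    unfolding continuous_on_def
    by (intro ballI tendsto_vec_nth tendsto_matrix_vector tendsto_lift_pt tendsto_intros)
  have "open {q. cmod ((M *v lift_pt q)$1) < tanh (r/2) * cmod ((M *v lift_pt q)$3)}"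
    by (intro open_Collect_less continuous_intros c)
  moreover have "tube L p r = H2C \<inter> {q. cmod ((M *v lift_pt q)$1) < tanh (r/2) * cmod ((M *v lift_pt q)$3)}"
    by (auto simp: tube_frame[OF f r])
  ultimately show ?thesis using open_H2C by auto
qed

lemma centre_in_tube:
  assumes "line_frame M L p" "0 < r"
  shows "p \<in> tube L p r"
proof -
  have "(M *v lift_pt p)$1 = 0" "p \<in> H2C" "(M *v lift_pt p)$3 \<noteq> 0"
    using assms(1) frame_point[OF assms(1)] frame_third_nonzero[OF assms(1)]
    by (auto simp: line_frame_def)
  then show ?thesis using assms(2) by (simp add: tube_frame[OF assms])
qed

lemma closed_cover_of_interval:
  fixes S T :: "real set"
  assumes "closed S" "closed T" "{0..1} \<subseteq> S \<union> T" "1 \<in> S" "0 \<in> T"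
  obtains t where "t \<in> {0..1}" "t \<in> S" "t \<in> T"
proof -
  have 1: "1 \<in> S \<inter> {0..1}" "0 \<in> T \<inter> {0..1}" using assms(4,5) by auto
  have "S \<inter> T \<inter> {0..1} \<noteq> {}"
  proof
    assume "S \<inter> T \<inter> {0..1} = {}"
    from connected_closedD[OF connected_Icc this assms(3,1,2)] 1 show False by blast
  qed
  then show ?thesis using that by blast
qed

lemma rho_self: "p \<in> H2C \<Longrightarrow> rho p p = 0"
  by (simp add: rho_hratio hratio_def hform_self norm_of_real power2_eq_square H2C_hsq)

lemma set_distance_eqI:
  assumes "a \<in> S" "b \<in> T" "d a b = D" "\<And>x y. x \<in> S \<Longrightarrow> y \<in> T \<Longrightarrow> D \<le> d x y"
  shows "set_distance d S T = D"
  unfolding set_distance_def using assms by (intro cInf_eq_minimum) auto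

text \<open>The vector \<open>e\<close> is polar to the common spine of the two lines. The radii are those of injective discs.
All hypotheses are symmetric under exchange of the two lines, so each one-sided conclusion below
also holds for the other line.\<close>

locale separated_lines =
  fixes L1 L2 :: "(complex^2) set" and p1 p2 :: "complex^2" and M N :: "complex^3^3"
    and e :: "complex^3" and r1 r2 :: real and \<Gamma>1 \<Gamma>2 :: "(complex^3^3) set set"
  assumes M: "adapted M L1 p1 e" and N: "adapted N L2 p2 e"
    and r: "0 < r1" "0 < r2" "s_real r1 + s_real r2 < rho p1 p2"
    and C1: "C_Fuchsian \<Gamma>1 L1" and C2: "C_Fuchsian \<Gamma>2 L2"
    and inj1: "inj_on (orb \<Gamma>1) {q \<in> L1. rho p1 q < r1}"
    and inj2: "inj_on (orb \<Gamma>2) {q \<in> L2. rho p2 q < r2}"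
begin

lemma swap: "separated_lines L2 L1 p2 p1 N M e r2 r1 \<Gamma>2 \<Gamma>1"
  using M N r C1 C2 inj1 inj2 by (simp add: separated_lines_def rho_commute add.commute)

abbreviation "V \<equiv> tube L1 p1 r1"
abbreviation "W \<equiv> tube L2 p2 r2"
abbreviation "F q \<equiv> rho p1 (spine_proj e q)"
abbreviation "G q \<equiv> rho p2 (spine_proj e q)"
abbreviation "\<Gamma> \<equiv> generate PU21 (\<Gamma>1 \<union> \<Gamma>2)"

lemma frame1: "line_frame M L1 p1" and frame2: "line_frame N L2 p2" and e: "hform e e = 1"
  using M N by (auto simp: adapted_def)

lemma pts: "p1 \<in> L1" "p2 \<in> L2" "p1 \<in> H2C" "p2 \<in> H2C" "L1 \<subseteq> H2C" "L2 \<subseteq> H2C"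
  using frame1 frame2 frame_point[OF frame1] frame_point[OF frame2] by (auto simp: line_frame_def)

lemma s_pos: "0 < s_real r1" "0 < s_real r2"
  using r s_real_pos by auto

lemma FG: "q \<in> H2C \<Longrightarrow> rho p1 p2 \<le> F q + G q"
  using rho_triangle[OF spine_proj_H2C[OF e] pts(3,4), of q] by (simp add: rho_commute)

lemma outside_V: "q \<in> H2C \<Longrightarrow> q \<notin> V \<Longrightarrow> F q < s_real r1"
  by (rule outside_tube_height[OF M r(1)])

lemma outside_W: "q \<in> H2C \<Longrightarrow> q \<notin> W \<Longrightarrow> G q < s_real r2"
  by (rule outside_tube_height[OF N r(2)])

lemma cover: "H2C \<subseteq> V \<union> W"
proof
  fix q assume "q \<in> H2C"
  then show "q \<in> V \<union> W"
    using FG[of q] outside_V[of q] outside_W[of q] r(3) by fastforce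
qed

lemma L1_in_W: "L1 \<subseteq> W"
proof
  fix x assume x: "x \<in> L1"
  then have "G x = rho p1 p2" by (simp add: spine_proj_on_line[OF M] rho_commute)
  then show "x \<in> W" using outside_W[of x] x pts r(3) s_pos by fastforce
qed

lemma p1_in: "p1 \<in> V \<inter> W"
  using centre_in_tube[OF frame1 r(1)] L1_in_W pts by blast

lemma lines_distance: "x \<in> L1 \<Longrightarrow> y \<in> L2 \<Longrightarrow> rho p1 p2 \<le> rho x y"
  using height_le_rho[OF M, of x y] FG[of y] pts
  by (auto simp: spine_proj_on_line[OF N] rho_self)

lemma subgroups: "subgroup \<Gamma>1 PU21" "subgroup \<Gamma>2 PU21"
  using C1 C2 by (auto simp: C_Fuchsian_def discrete_subgroup_def)

lemma group_closed: "g \<in> \<Gamma>1 \<union> \<Gamma>2 \<Longrightarrow> g \<in> carrier PU21"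
  by (metis UnE subgroup.mem_carrier subgroups)

sublocale PP: ping_pong PU21 \<Gamma>1 \<Gamma>2 H2C act V W
proof (intro ping_pong.intro ping_pong_axioms.intro group_PU21)
  show "V \<subseteq> H2C" "W \<subseteq> H2C" unfolding tube_def by blast+
  show "act a x \<notin> V" if "a \<in> \<Gamma>1" "a \<noteq> \<one>\<^bsub>PU21\<^esub>" "x \<in> V" for a x
    using tube_moved_off[OF C1 inj1 that] .
  show "act b x \<notin> W" if "b \<in> \<Gamma>2" "b \<noteq> \<one>\<^bsub>PU21\<^esub>" "x \<in> W" for b x
    using tube_moved_off[OF C2 inj2 that] .
qed (simp_all add: subgroups act_mult act_one act_H2C cover)

lemma stab1: "a \<in> \<Gamma>1 \<Longrightarrow> x \<in> L1 \<Longrightarrow> act a x \<in> L1"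
  using C1 by (auto simp: C_Fuchsian_def)

lemma stab2: "a \<in> \<Gamma>2 \<Longrightarrow> x \<in> L2 \<Longrightarrow> act a x \<in> L2"
  using C2 by (auto simp: C_Fuchsian_def)

lemma \<Gamma>_subgroup: "subgroup \<Gamma> PU21"
  by (rule PU21.generate_is_subgroup) (use group_closed in blast)

lemma discrete: "discrete_subgroup \<Gamma>"
proof -
  let ?W = "{g \<in> carrier PU21. act g p1 \<in> V \<inter> W}"
  have "openin PU21_topology ?W"
    using open_tube[OF frame1 r(1)] open_tube[OF frame2 r(2)] pts by (intro openin_act_preimage) auto
  moreover have "g = \<one>\<^bsub>PU21\<^esub>" if g: "g \<in> ?W" "g \<in> \<Gamma>" for g
  proof -
    obtain w where w: "w \<in> PP.words" "fp_eval PU21 w = g" using PP.generate_eval[OF g(2)] by blast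
    then have "w = []" using PP.nontrivial_word_moves[OF w(1) _ p1_in] g(1) by blast
    then show ?thesis using w by simp
  qed
  moreover have "\<one>\<^bsub>PU21\<^esub> \<in> ?W" "\<one>\<^bsub>PU21\<^esub> \<in> \<Gamma>"
    using p1_in by (auto simp: act_one generate.one)
  ultimately have "openin PU21_topology ?W \<and> ?W \<inter> \<Gamma> = {\<one>\<^bsub>PU21\<^esub>}" by blast
  then show ?thesis using \<Gamma>_subgroup unfolding discrete_subgroup_iff by blast
qed

lemma embedded: "embedded_surface \<Gamma> \<Gamma>1 L1"
  unfolding embedded_surface_def
proof
  fix g assume "g \<in> \<Gamma>"
  then show "g \<in> \<Gamma>1 \<or> act g ` L1 \<inter> L1 = {}"
    using PP.embedded_or_disjoint[OF _ L1_in_W stab1] by blast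
qed

text \<open>On a geodesic from \<open>x1\<close> to \<open>w x2\<close>, suppose that a point \<open>x\<close> had \<open>F x\<close> below \<open>rho p1 p2 - s(r2)\<close> and \<open>G (w\<^sup>-\<^sup>1 x)\<close>
below \<open>s(r2)\<close>. The first gives \<open>x \<in> W\<close>, the second \<open>w\<^sup>-\<^sup>1 x \<in> V\<close> and so \<open>x \<notin> W\<close>. Hence one of the two bounds holds
at each point of the geodesic; each holds at one end, so by connectedness both hold somewhere. There the
distances to \<open>x1\<close> and to \<open>w x2\<close> add up to at least \<open>rho p1 p2\<close>.\<close>

lemma moved_line_distance:
  assumes w: "w \<in> carrier PU21" "\<And>x. x \<in> V \<Longrightarrow> act w x \<in> H2C - W"
    and x: "x1 \<in> L1" "x2 \<in> L2"
  shows "rho p1 p2 \<le> rho x1 (act w x2)"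
proof -
  have L2V: "L2 \<subseteq> V" using separated_lines.L1_in_W[OF swap] .
  define y where "y = act w x2"
  define w' where "w' = inv\<^bsub>PU21\<^esub> w"
  have w': "w' \<in> carrier PU21" using w(1) by (simp add: w'_def)
  have xH: "x1 \<in> H2C" "x2 \<in> H2C" using x pts by auto
  have y: "y \<in> H2C" "y \<notin> W" using w(2)[of x2] x(2) L2V by (auto simp: y_def)
  obtain \<gamma> :: "real \<Rightarrow> complex^2" where \<gamma>: "continuous_on {0..1} \<gamma>" "\<gamma> ` {0..1} \<subseteq> H2C"
    "\<gamma> 0 = x1" "\<gamma> 1 = y" "\<And>t. t \<in> {0..1} \<Longrightarrow> rho x1 (\<gamma> t) + rho (\<gamma> t) y = rho x1 y"
    using geodesic_exists[OF xH(1) y(1)] by metis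
  have \<gamma>H: "\<gamma> t \<in> H2C" if "t \<in> {0..1}" for t using that \<gamma>(2) by blast
  have contF: "continuous_on {0..1} (\<lambda>t. F (\<gamma> t))"
    using pts \<gamma>H
    by (intro continuous_on_rho continuous_on_compose2[OF continuous_on_spine_proj[OF e] \<gamma>(1)])
      (auto simp: spine_proj_H2C[OF e])
  have contG: "continuous_on {0..1} (\<lambda>t. G (act w' (\<gamma> t)))"
    using pts \<gamma>H w'
    by (intro continuous_on_rho continuous_on_compose2[OF continuous_on_spine_proj[OF e]]
        continuous_on_compose2[OF continuous_on_act[OF w'] \<gamma>(1)])
      (auto simp: spine_proj_H2C[OF e] act_H2C)
  let ?d = "rho p1 p2" and ?s = "s_real r2"
  let ?S = "{t \<in> {0..1}. ?d - ?s \<le> F (\<gamma> t)}" and ?T = "{t \<in> {0..1}. ?s \<le> G (act w' (\<gamma> t))}"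
  have "closed ?S"
    by (rule continuous_on_closed_Collect_le[OF continuous_on_const contF]) simp
  moreover have "closed ?T"
    by (rule continuous_on_closed_Collect_le[OF continuous_on_const contG]) simp
  moreover have "{0..1} \<subseteq> ?S \<union> ?T"
  proof
    fix t :: real assume t: "t \<in> {0..1}"
    show "t \<in> ?S \<union> ?T"
    proof (rule ccontr)
      assume "t \<notin> ?S \<union> ?T"
      then have lt: "F (\<gamma> t) < ?d - ?s" "G (act w' (\<gamma> t)) < ?s" using t by auto
      have "\<gamma> t \<in> W" using lt(1) FG[OF \<gamma>H[OF t]] outside_W[OF \<gamma>H[OF t]] by fastforce
      moreover have "act w' (\<gamma> t) \<in> V"
        using lt(2) FG[OF act_H2C[OF w' \<gamma>H[OF t]]] outside_V[OF act_H2C[OF w' \<gamma>H[OF t]]] r(3) by fastforce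
      ultimately show False
        using w(2)[of "act w' (\<gamma> t)"] act_inv'[OF w(1) \<gamma>H[OF t]] by (auto simp: w'_def)
    qed
  qed
  moreover have "1 \<in> ?S"
    using outside_W[OF y] FG[OF y(1)] by (simp add: \<gamma>(4))
  moreover have "0 \<in> ?T"
  proof -
    have "act w' x1 \<notin> V"
      using w(2)[of "act w' x1"] act_inv'[OF w(1) xH(1)] L1_in_W x(1) by (auto simp: w'_def)
    then show ?thesis
      using outside_V[of "act w' x1"] FG[of "act w' x1"] act_H2C[OF w' xH(1)] r(3) by (simp add: \<gamma>(3))
  qed
  ultimately obtain t where "t \<in> {0..1}" "t \<in> ?S" "t \<in> ?T"
    by (rule closed_cover_of_interval)
  then have t: "t \<in> {0..1}" "?d - ?s \<le> F (\<gamma> t)" "?s \<le> G (act w' (\<gamma> t))" by auto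
  have "?d - ?s \<le> rho x1 (\<gamma> t)"
    using t(2) height_le_rho[OF M x(1) \<gamma>H[OF t(1)]] by (rule order_trans)
  moreover have "?s \<le> rho (\<gamma> t) y"
  proof -
    have "?s \<le> rho x2 (act w' (\<gamma> t))"
      using t(3) height_le_rho[OF N x(2) act_H2C[OF w' \<gamma>H[OF t(1)]]] by (rule order_trans)
    also have "\<dots> = rho y (\<gamma> t)"
      using act_rho[OF w(1) xH(2) act_H2C[OF w' \<gamma>H[OF t(1)]]] act_inv'[OF w(1) \<gamma>H[OF t(1)]]
      by (simp add: y_def w'_def)
    finally show ?thesis by (simp add: rho_commute)
  qed
  ultimately show ?thesis using \<gamma>(5)[OF t(1)] by (simp add: y_def)
qed

text \<open>Letters of \<open>\<Gamma>1\<close> in front and of \<open>\<Gamma>2\<close> behind preserve the two lines and can be stripped, which leaves either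
no word or one to which the previous lemma applies.\<close>

lemma orbit_distance:
  assumes g: "g \<in> \<Gamma>" and x: "x1 \<in> L1" "x2 \<in> L2"
  shows "rho p1 p2 \<le> rho x1 (act g x2)"
proof -
  obtain a b w where ab: "a \<in> \<Gamma>1" "b \<in> \<Gamma>2" "w \<in> PP.words" "g = a \<otimes>\<^bsub>PU21\<^esub> fp_eval PU21 w \<otimes>\<^bsub>PU21\<^esub> b"
    and hl: "w \<noteq> [] \<Longrightarrow> \<not> isl (hd w) \<and> isl (last w)"
    using PP.strip_word[OF g, of True False] by (auto simp: PP.factor_def)
  have c: "a \<in> carrier PU21" "b \<in> carrier PU21" "fp_eval PU21 w \<in> carrier PU21"
    using group_closed[of a] group_closed[of b] PP.eval_words_closed[OF ab(3)] ab(1,2) by simp_all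
  have xH: "x1 \<in> H2C" "x2 \<in> H2C" using x pts by auto
  let ?y1 = "act (inv\<^bsub>PU21\<^esub> a) x1" and ?y2 = "act b x2" and ?h = "fp_eval PU21 w"
  have y: "?y1 \<in> L1" "?y2 \<in> L2"
    using stab1 stab2 ab x subgroup.m_inv_closed[OF subgroups(1)] by auto
  have yH: "?y1 \<in> H2C" "?y2 \<in> H2C" using y pts by auto
  have "rho p1 p2 \<le> rho ?y1 (act ?h ?y2)"
  proof (cases "w = []")
    case True
    then show ?thesis using lines_distance[OF y] yH by (simp add: act_one)
  next
    case False
    have "act ?h q \<in> H2C - W" if "q \<in> V" for q
      using PP.word_moves[OF ab(3) False, of q] hl[OF False] that by (simp add: PP.region_def)
    then show ?thesis by (rule moved_line_distance[OF c(3) _ y])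
  qed
  also have "\<dots> = rho (act a ?y1) (act a (act ?h ?y2))"
    using act_rho[OF c(1) yH(1)] c yH by (simp add: act_H2C)
  also have "\<dots> = rho x1 (act g x2)"
    using c xH by (simp add: ab(4) act_mult act_inv' act_H2C)
  finally show ?thesis .
qed

lemma set_distance_lines: "set_distance rho L1 L2 = rho p1 p2"
  using pts lines_distance by (intro set_distance_eqI) auto

lemma set_distance_quotient: "set_distance rho_quot (orb \<Gamma> ` L1) (orb \<Gamma> ` L2) = rho p1 p2"
proof -
  have ge: "rho p1 p2 \<le> rho x y" if x: "x \<in> orb \<Gamma> x1" "y \<in> orb \<Gamma> x2" "x1 \<in> L1" "x2 \<in> L2" for x y x1 x2
  proof -
    obtain g h where gh: "g \<in> \<Gamma>" "h \<in> \<Gamma>" "x = act g x1" "y = act h x2"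
      using x(1,2) unfolding orb_def by blast
    have c: "g \<in> carrier PU21" "h \<in> carrier PU21"
      using gh subgroup.mem_carrier[OF \<Gamma>_subgroup] by auto
    have xH: "x1 \<in> H2C" "x2 \<in> H2C" using x(3,4) pts by auto
    have "rho p1 p2 \<le> rho x1 (act (inv\<^bsub>PU21\<^esub> g \<otimes>\<^bsub>PU21\<^esub> h) x2)"
      using gh x(3,4) \<Gamma>_subgroup by (intro orbit_distance) (auto simp: subgroup.m_closed subgroup.m_inv_closed)
    also have "\<dots> = rho (act g x1) (act g (act (inv\<^bsub>PU21\<^esub> g \<otimes>\<^bsub>PU21\<^esub> h) x2))"
      using act_rho[OF c(1) xH(1)] c xH by (simp add: act_H2C)
    also have "\<dots> = rho x y"
      using c xH by (simp add: gh act_mult act_inv' act_H2C)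
    finally show ?thesis .
  qed
  have self: "x \<in> orb \<Gamma> x" for x
    unfolding orb_def using generate.one act_one by (metis imageI)
  have quot: "rho p1 p2 \<le> rho_quot (orb \<Gamma> x1) (orb \<Gamma> x2)" if "x1 \<in> L1" "x2 \<in> L2" for x1 x2
    unfolding rho_quot_def set_distance_def
    using self ge that by (intro cInf_greatest) blast+
  have "rho_quot (orb \<Gamma> p1) (orb \<Gamma> p2) = rho p1 p2"
    unfolding rho_quot_def using self ge pts by (intro set_distance_eqI) blast+
  then show ?thesis
    using pts quot by (intro set_distance_eqI[of "orb \<Gamma> p1" _ "orb \<Gamma> p2"]) auto
qed

end

theorem theoremD:
  fixes \<Gamma>\<^sub>1 \<Gamma>\<^sub>2 \<Gamma> :: "(complex^3^3) set set"
    and L\<^sub>1 L\<^sub>2 :: "(complex^2) set"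
    and c :: "real \<Rightarrow> complex^2" and l :: real
    and p\<^sub>1 p\<^sub>2 :: "complex^2"
  assumes "C_Fuchsian \<Gamma>\<^sub>1 L\<^sub>1" and "C_Fuchsian \<Gamma>\<^sub>2 L\<^sub>2"
    and "L\<^sub>1 \<inter> L\<^sub>2 = {}"
    and "orthogeodesic L\<^sub>1 L\<^sub>2 c l" and "p\<^sub>1 = c 0" and "p\<^sub>2 = c l"
    and "s_fun (inj_radius \<Gamma>\<^sub>1 L\<^sub>1 p\<^sub>1) + s_fun (inj_radius \<Gamma>\<^sub>2 L\<^sub>2 p\<^sub>2)
           < ereal (set_distance rho L\<^sub>1 L\<^sub>2)"
    and "\<Gamma> = generate PU21 (\<Gamma>\<^sub>1 \<union> \<Gamma>\<^sub>2)"
  shows "discrete_subgroup \<Gamma>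
    \<and> is_free_product_of PU21 \<Gamma> \<Gamma>\<^sub>1 \<Gamma>\<^sub>2
    \<and> embedded_surface \<Gamma> \<Gamma>\<^sub>1 L\<^sub>1 \<and> embedded_surface \<Gamma> \<Gamma>\<^sub>2 L\<^sub>2
    \<and> set_distance rho_quot (orb \<Gamma> ` L\<^sub>1) (orb \<Gamma> ` L\<^sub>2) = set_distance rho L\<^sub>1 L\<^sub>2"
proof -
  have lines: "complex_line L\<^sub>1" "complex_line L\<^sub>2"
    using assms(1,2) by (auto simp: C_Fuchsian_def)
  obtain M N e where MN: "adapted M L\<^sub>1 p\<^sub>1 e" "adapted N L\<^sub>2 p\<^sub>2 e"
    using common_spine[OF lines assms(3,4)] assms(5,6) by metis
  have p: "p\<^sub>1 \<in> L\<^sub>1" "p\<^sub>2 \<in> L\<^sub>2" using MN by (auto simp: adapted_def line_frame_def)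
  have "set_distance rho L\<^sub>1 L\<^sub>2 \<le> rho p\<^sub>1 p\<^sub>2"
  proof -
    have "L\<^sub>1 \<subseteq> H2C" "L\<^sub>2 \<subseteq> H2C" using lines by (auto simp: complex_line_def)
    then have "bdd_below {rho a b | a b. a \<in> L\<^sub>1 \<and> b \<in> L\<^sub>2}"
      using rho_nonneg by (intro bdd_belowI[of _ 0]) blast
    then show ?thesis
      unfolding set_distance_def using p by (intro cInf_lower) auto
  qed
  then have "s_fun (inj_radius \<Gamma>\<^sub>1 L\<^sub>1 p\<^sub>1) + s_fun (inj_radius \<Gamma>\<^sub>2 L\<^sub>2 p\<^sub>2) < ereal (rho p\<^sub>1 p\<^sub>2)"
    using assms(7) by (meson ereal_less_eq(3) less_le_trans)
  then obtain a b where ab: "s_fun (inj_radius \<Gamma>\<^sub>1 L\<^sub>1 p\<^sub>1) < ereal a"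
    "s_fun (inj_radius \<Gamma>\<^sub>2 L\<^sub>2 p\<^sub>2) < ereal b" "a + b = rho p\<^sub>1 p\<^sub>2"
    using ereal_sum_less_split s_fun_nonneg by metis
  obtain r1 where r1: "0 < r1" "inj_on (orb \<Gamma>\<^sub>1) {q \<in> L\<^sub>1. rho p\<^sub>1 q < r1}" "s_real r1 < a"
    using injective_disc[OF ab(1)] .
  obtain r2 where r2: "0 < r2" "inj_on (orb \<Gamma>\<^sub>2) {q \<in> L\<^sub>2. rho p\<^sub>2 q < r2}" "s_real r2 < b"
    using injective_disc[OF ab(2)] .
  interpret S: separated_lines L\<^sub>1 L\<^sub>2 p\<^sub>1 p\<^sub>2 M N e r1 r2 \<Gamma>\<^sub>1 \<Gamma>\<^sub>2
    using MN r1 r2 ab(3) assms(1,2) by unfold_locales auto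
  have "embedded_surface (generate PU21 (\<Gamma>\<^sub>2 \<union> \<Gamma>\<^sub>1)) \<Gamma>\<^sub>2 L\<^sub>2"
    using separated_lines.embedded[OF S.swap] .
  then show ?thesis
    using S.discrete S.PP.free_product_generate[OF S.p1_in] S.embedded
      S.set_distance_lines S.set_distance_quotient
    by (simp add: assms(8) Un_commute)
qed

end
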